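(* Let $s_n$ be the number of weakly threshold sequences with $n$ terms and let $w_n$ be the number of isomorphism classes of weakly threshold graphs with $n$ vertices. For integers $n \geq 1$, \[s_n = \frac{2+\left(1+\sqrt{2}\right)^n + \left(1-\sqrt{2}\right)^n}{4},\] and \begin{align*} w_n = {}&c_1\left(\frac{1+\sqrt{5}}{2}\right)^n + c_2\left(\frac{1-\sqrt{5}}{2}\right)^n\\ &+ c_3\left(\frac{6-(1+i \sqrt{3}) (27-3 \sqrt{57})^{1/3}-(1-i \sqrt{3}) (27+3\sqrt{57})^{1/3}}{6}\right)^n\\ &+ c_4\left(\frac{6-(1-i \sqrt{3}) (27-3 \sqrt{57})^{1/3}-(1+i \sqrt{3}) (27+3\sqrt{57})^{1/3}}{6}\right)^n\\ &+ c_5\left( \frac{3+(27-3 \sqrt{57})^{1/3}+(27+3\sqrt{57})^{1/3}}{3}\right)^n, \end{align*} where \begin{align*} c_1 &= \frac{\sqrt{5}+1}{3\sqrt{5}}, \qquad c_2 = \frac{\sqrt{5}-1}{3\sqrt{5}},\\ c_3 &= \frac{1}{9}\left(1 - \frac{(1+i \sqrt{3}) (3 \sqrt{57}-19)^{1/3}}{4\cdot 19^{2/3}}+\frac{1-i \sqrt{3}}{2\cdot (19 (3 \sqrt{57}-19))^{1/3}}\right),\\ c_4 &= \frac{1}{9}\left(1 - \frac{(1-i \sqrt{3}) (3 \sqrt{57}-19)^{1/3}}{4\cdot 19^{2/3}}+\frac{1+i \sqrt{3}}{2\cdot (19 (3 \sqrt{57}-19))^{1/3}}\right),\\ c_5 &=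 \frac{1}{9}\left(1+\frac{(3 \sqrt{57}-19)^{1/3}}{2 \cdot 19^{2/3}}- \frac{1}{(19 (3 \sqrt{57}-19))^{1/3}}\right). \end{align*}
   Context: Graphs are finite and simple, with at least one vertex. A degree sequence is the list $d=(d_1,\dots,d_n)$ of vertex degrees of a graph, written in nonincreasing order. For a degree sequence $d$ put $m(d)=\max\{i : d_i\ge i-1\}$ and, for $1\le k\le m(d)$, $\Delta_k(d)=k(k-1)+\sum_{i>k}\min\{k,d_i\}-\sum_{i=1}^k d_i$. A degree sequence $d$ is a weakly threshold sequence if $\Delta_k(d)\le 1$ for all $k\in\{1,\dots,m(d)\}$, and a weakly threshold graph is a graph whose degree sequence is weakly threshold. Graphs are counted up to isomorphism. Here $i=\sqrt{-1}$ and all cube roots are real cube roots of positive real numbers. *)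

theory Defs
  imports Complex_Main "HOL-Library.Multiset"
begin

text \<open>A graph is a pair of a vertex set and a set of edges, an edge being a two-element set of
  vertices.\<close>

type_synonym 'a ugraph = "'a set \<times> 'a set set"

abbreviation vertices :: "'a ugraph \<Rightarrow> 'a set" where
  "vertices G \<equiv> fst G"

abbreviation edges :: "'a ugraph \<Rightarrow> 'a set set" where
  "edges G \<equiv> snd G"

definition simple_graph :: "'a ugraph \<Rightarrow> bool" where
  "simple_graph G \<longleftrightarrow>
     finite (vertices G) \<and> vertices G \<noteq> {} \<and>
     (\<forall>e\<in>edges G. e \<subseteq> vertices G \<and> card e = 2)"

definition vertex_degree :: "'a ugraph \<Rightarrow> 'a \<Rightarrow> nat" where
  "vertex_degree G v = card {e \<in> edges G. v \<in> e}"

definition degree_list :: "'a ugraph \<Rightarrow> nat list" where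
  "degree_list G =
     rev (sorted_list_of_multiset (image_mset (vertex_degree G) (mset_set (vertices G))))"

definition isomorphic :: "'a ugraph \<Rightarrow> 'b ugraph \<Rightarrow> bool" where
  "isomorphic G H \<longleftrightarrow>
     (\<exists>f. bij_betw f (vertices G) (vertices H) \<and> (\<lambda>e. f ` e) ` edges G = edges H)"

text \<open>Since graphs are finite, restricting the vertices to natural numbers loses no degree
  sequence and no isomorphism class.\<close>

definition degree_sequence :: "nat list \<Rightarrow> bool" where
  "degree_sequence d \<longleftrightarrow> (\<exists>G :: nat ugraph. simple_graph G \<and> degree_list G = d)"

text \<open>The terms of a degree sequence are numbered from 1, list positions from 0.\<close>

abbreviation seq_term :: "nat list \<Rightarrow> nat \<Rightarrow> nat" where
  "seq_term d i \<equiv> d ! (i - 1)"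

definition seq_m :: "nat list \<Rightarrow> nat" where
  "seq_m d = Max {i \<in> {1..length d}. seq_term d i \<ge> i - 1}"

definition seq_Delta :: "nat \<Rightarrow> nat list \<Rightarrow> int" where
  "seq_Delta k d =
     int k * (int k - 1) + (\<Sum>i = k + 1..length d. int (min k (seq_term d i)))
       - (\<Sum>i = 1..k. int (seq_term d i))"

definition weakly_threshold_sequence :: "nat list \<Rightarrow> bool" where
  "weakly_threshold_sequence d \<longleftrightarrow>
     degree_sequence d \<and> (\<forall>k\<in>{1..seq_m d}. seq_Delta k d \<le> 1)"

definition weakly_threshold_graph :: "'a ugraph \<Rightarrow> bool" where
  "weakly_threshold_graph G \<longleftrightarrow>
     simple_graph G \<and> weakly_threshold_sequence (degree_list G)"

definition iso_rel :: "(nat ugraph \<times> nat ugraph) set" where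
  "iso_rel = {(G, H). simple_graph G \<and> simple_graph H \<and> isomorphic G H}"

definition num_wt_sequences :: "nat \<Rightarrow> nat" where
  "num_wt_sequences n = card {d. weakly_threshold_sequence d \<and> length d = n}"

definition num_wt_graphs :: "nat \<Rightarrow> nat" where
  "num_wt_graphs n =
     card ({G. weakly_threshold_graph G \<and> card (vertices G) = n} // iso_rel)"

end

theory Submission
  imports Defs
begin

text \<open>
  A degree sequence is weakly threshold when its Erdos-Gallai inequalities hold with slack at most one. The idea is
  to build these graphs by steps whose effect on all slacks is transparent. Adding an isolated or a dominating
  vertex, attaching a leaf to a vertex of maximum degree, adding a vertex that is adjacent to everything but one
  leaf, and joining the inner vertices of a path on four vertices to everything: each step keeps the old slacks,
  possibly moved by one or two places, and new slacks that count are at most one (\<open>small_slack_shift\<close> and its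
  instances).

  Conversely, every weakly threshold graph is obtained in this way. Call it a core if it has neither an isolated nor
  a dominating vertex; call a vertex a top if it misses exactly one other vertex. The slack inequalities
  for \<open>k = 1\<close> and \<open>k = 2\<close> show that a core has a top, has a leaf, and has two tops or two leaves
  (\<open>core_tops_leaves\<close>). If it has one top, then a leaf on that top can be removed; if it has one leaf, then a top
  not adjacent to that leaf can be removed; if it has two of each, then it is the join with a path. These cases
  exclude each other, and the first two are exchanged by complementation (\<open>wt_compl\<close>).

  For counting it remains to see how far a step is ambiguous. By complementation only the leaf on a top needs
  attention: on a core with a single leaf whose neighbour is a top, that neighbour and the other tops give different
  results, and otherwise all tops give the same result up to isomorphism (\<open>iso_map_to_top\<close>). Degree sequences do
  not see the difference.
  Let \<open>w\<close> count all graphs, \<open>a\<close> the cores with one top, and \<open>m\<close> those among them whose top misses a leaf. Then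

    \<open>w(n+1) = 2 w(n) + 2 a(n+1) + w(n-3)\<close>,
    \<open>a(n+1) = 2 a(n) + m(n) + w(n-4)\<close>,
    \<open>m(n+1) = m(n) + a(n) + w(n-4)\<close>

  for isomorphism classes, and for sequences the same without the term \<open>m(n)\<close>; the terms \<open>w(n-3)\<close> and \<open>w(n-4)\<close>
  are absent when the index is negative. The first recurrence starts at \<open>n = 1\<close>, with \<open>w(0) = w(1) = 1\<close>, and there are
  no cores on fewer than four vertices. Solving the two systems gives the closed forms: for sequences the
  characteristic roots that survive are 1 and \<open>1 \<plusminus> sqrt 2\<close>, and for graphs they are those of \<open>x^2 - x - 1\<close>
  and of \<open>x^3 - 3 x^2 + x - 1\<close>, the latter written with Cardano's formula.
\<close>

section \<open>Graphs and their isomorphisms\<close>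

text \<open>Unlike a simple graph, a graph here may have no vertices. The empty graph serves as the start of
  the recursion: it makes the path on four vertices the join of a path with a smaller graph.\<close>

definition graph :: "'a ugraph \<Rightarrow> bool" where
  "graph G \<longleftrightarrow> finite (vertices G) \<and> (\<forall>e\<in>edges G. e \<subseteq> vertices G \<and> card e = 2)"

lemma simple_graph_iff: "simple_graph G \<longleftrightarrow> graph G \<and> vertices G \<noteq> {}"
  by (auto simp: simple_graph_def graph_def)

definition adj :: "'a ugraph \<Rightarrow> 'a \<Rightarrow> 'a \<Rightarrow> bool" where
  "adj G x y \<longleftrightarrow> {x, y} \<in> edges G"

abbreviation nbhd :: "'a ugraph \<Rightarrow> 'a \<Rightarrow> 'a set" where
  "nbhd G v \<equiv> {x. adj G v x}"

lemma adj_sym: "adj G x y \<longleftrightarrow> adj G y x"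
  by (simp add: adj_def insert_commute)

lemma graph_finite [simp]: "graph G \<Longrightarrow> finite (vertices G)"
  by (simp add: graph_def)

lemma adjD:
  assumes "graph G" "adj G x y"
  shows "x \<in> vertices G" "y \<in> vertices G" "x \<noteq> y"
proof -
  have "{x, y} \<subseteq> vertices G" "card {x, y} = 2"
    using assms by (auto simp: graph_def adj_def)
  then show "x \<in> vertices G" "y \<in> vertices G" "x \<noteq> y" by auto
qed

lemma nbhd_subset: "graph G \<Longrightarrow> nbhd G v \<subseteq> vertices G - {v}"
  by (auto dest: adjD)

lemma finite_nbhd [simp]: "graph G \<Longrightarrow> finite (nbhd G v)"
  by (meson finite_Diff finite_subset graph_finite nbhd_subset)

lemma edge_cases:
  assumes "graph G" "e \<in> edges G"
  obtains x y where "e = {x, y}" "adj G x y"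
  using assms by (auto simp: graph_def adj_def card_2_iff)

lemma graph_eqI:
  assumes "graph G" "graph H" "vertices G = vertices H" "\<And>x y. adj G x y \<longleftrightarrow> adj H x y"
  shows "G = H"
proof -
  have "e \<in> edges G \<longleftrightarrow> e \<in> edges H" for e
    using assms by (metis adj_def edge_cases)
  then show ?thesis using assms(3) by (simp add: prod_eq_iff set_eq_iff)
qed

lemma degree_eq_card_nbhd:
  assumes "graph G" shows "vertex_degree G v = card (nbhd G v)"
proof -
  have "{e \<in> edges G. v \<in> e} = (\<lambda>x. {v, x}) ` nbhd G v" (is "?L = ?R")
  proof
    show "?L \<subseteq> ?R"
    proof
      fix e assume e: "e \<in> ?L"
      then obtain x y where "e = {x, y}" "adj G x y" using assms edge_cases by blast
      with e show "e \<in> ?R" by (auto simp: adj_def insert_commute)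
    qed
  qed (auto simp: adj_def)
  moreover have "inj_on (\<lambda>x. {v, x}) (nbhd G v)" by (auto simp: inj_on_def doubleton_eq_iff)
  ultimately show ?thesis by (simp add: vertex_degree_def card_image)
qed

lemma degree_less_card:
  assumes "graph G" "v \<in> vertices G" shows "vertex_degree G v < card (vertices G)"
proof -
  have "nbhd G v \<subseteq> vertices G - {v}" using nbhd_subset assms(1) .
  then have "card (nbhd G v) \<le> card (vertices G - {v})"
    using assms(1) by (intro card_mono) auto
  then show ?thesis using assms
    by (metis card_Diff1_less degree_eq_card_nbhd graph_finite le_less_trans)
qed

text \<open>The new vertex \<open>v\<close> is meant to lie outside the graph, and its neighbourhood \<open>N\<close> inside.\<close>

definition add :: "'a ugraph \<Rightarrow> 'a \<Rightarrow> 'a set \<Rightarrow> 'a ugraph" where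
  "add G v N = (insert v (vertices G), edges G \<union> (\<lambda>x. {v, x}) ` N)"

definition del :: "'a ugraph \<Rightarrow> 'a \<Rightarrow> 'a ugraph" where
  "del G v = (vertices G - {v}, {e \<in> edges G. v \<notin> e})"

definition compl :: "'a ugraph \<Rightarrow> 'a ugraph" where
  "compl G = (vertices G, {{x, y} | x y. x \<in> vertices G \<and> y \<in> vertices G \<and> x \<noteq> y \<and> \<not> adj G x y})"

lemma vertices_ops [simp]:
  "vertices (add G v N) = insert v (vertices G)"
  "vertices (del G v) = vertices G - {v}"
  "vertices (compl G) = vertices G"
  by (simp_all add: add_def del_def compl_def)

lemma adj_add [simp]: "adj (add G v N) x y \<longleftrightarrow> adj G x y \<or> x = v \<and> y \<in> N \<or> y = v \<and> x \<in> N"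
  by (auto simp: adj_def add_def doubleton_eq_iff)

lemma adj_del [simp]: "adj (del G v) x y \<longleftrightarrow> adj G x y \<and> x \<noteq> v \<and> y \<noteq> v"
  by (auto simp: adj_def del_def)

lemma adj_compl [simp]:
  "adj (compl G) x y \<longleftrightarrow> x \<in> vertices G \<and> y \<in> vertices G \<and> x \<noteq> y \<and> \<not> adj G x y"
  by (auto simp: adj_def compl_def doubleton_eq_iff insert_commute)

lemma graph_add [simp]:
  "graph G \<Longrightarrow> v \<notin> vertices G \<Longrightarrow> N \<subseteq> vertices G \<Longrightarrow> graph (add G v N)"
  by (auto simp: graph_def add_def card_insert_if)

lemma graph_del [simp]: "graph G \<Longrightarrow> graph (del G v)"
  by (auto simp: graph_def del_def)

lemma graph_compl [simp]: "graph G \<Longrightarrow> graph (compl G)"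
  by (auto simp: graph_def compl_def card_2_iff)

lemma add_del:
  assumes "graph G" "v \<in> vertices G"
  shows "add (del G v) v (nbhd G v) = G"
proof (rule graph_eqI)
  show "graph (add (del G v) v (nbhd G v))"
    using assms nbhd_subset[OF assms(1), of v] by (intro graph_add) auto
qed (use assms adj_sym[of G] in \<open>auto dest: adjD\<close>)

lemma compl_compl [simp]: "graph G \<Longrightarrow> compl (compl G) = G"
  by (rule graph_eqI) (auto dest: adjD)

lemma compl_add:
  assumes "graph H" "v \<notin> vertices H" "N \<subseteq> vertices H"
  shows "compl (add H v N) = add (compl H) v (vertices H - N)"
  by (rule graph_eqI) (use assms in \<open>auto dest: adjD\<close>)

lemma degree_add:
  assumes "graph H" "v \<notin> vertices H" "N \<subseteq> vertices H"
  shows "vertex_degree (add H v N) v = card N"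
    and "x \<in> vertices H \<Longrightarrow> vertex_degree (add H v N) x = vertex_degree H x + of_bool (x \<in> N)"
proof -
  have g: "graph (add H v N)" using assms by simp
  have "nbhd (add H v N) v = N" using assms by (auto dest: adjD)
  then show "vertex_degree (add H v N) v = card N" using degree_eq_card_nbhd[OF g] by simp
  assume x: "x \<in> vertices H"
  then have "nbhd (add H v N) x = nbhd H x \<union> (if x \<in> N then {v} else {})"
    using assms by (auto dest: adjD)
  moreover have "v \<notin> nbhd H x" using assms by (auto dest: adjD)
  ultimately show "vertex_degree (add H v N) x = vertex_degree H x + of_bool (x \<in> N)"
    using degree_eq_card_nbhd[OF g] degree_eq_card_nbhd[OF assms(1)] assms(1) by simp
qed

lemma degree_compl:
  assumes "graph G" "x \<in> vertices G"
  shows "vertex_degree (compl G) x = card (vertices G) - 1 - vertex_degree G x"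
proof -
  have "nbhd (compl G) x = (vertices G - {x}) - nbhd G x" using assms by auto
  then have "card (nbhd (compl G) x) = card (vertices G - {x}) - card (nbhd G x)"
    using assms by (simp add: card_Diff_subset nbhd_subset)
  then show ?thesis using assms by (simp add: degree_eq_card_nbhd)
qed

definition iso_map :: "('a \<Rightarrow> 'b) \<Rightarrow> 'a ugraph \<Rightarrow> 'b ugraph \<Rightarrow> bool" where
  "iso_map f G H \<longleftrightarrow> bij_betw f (vertices G) (vertices H) \<and>
     (\<forall>x\<in>vertices G. \<forall>y\<in>vertices G. adj H (f x) (f y) \<longleftrightarrow> adj G x y)"

lemma iso_mapD:
  assumes "iso_map f G H"
  shows "x \<in> vertices G \<Longrightarrow> f x \<in> vertices H"
    and "x \<in> vertices G \<Longrightarrow> y \<in> vertices G \<Longrightarrow> adj H (f x) (f y) \<longleftrightarrow> adj G x y"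
    and "x \<in> vertices G \<Longrightarrow> y \<in> vertices G \<Longrightarrow> f x = f y \<longleftrightarrow> x = y"
    and "f ` vertices G = vertices H"
  using assms by (auto simp: iso_map_def bij_betw_def inj_on_def)

text \<open>Isomorphisms are handled through adjacency, because the constructions below are described by their
  adjacency relations; an injective map is determined on edges by what it does to pairs.\<close>

lemma isomorphic_iff:
  assumes "graph G" "graph H"
  shows "isomorphic G H \<longleftrightarrow> (\<exists>f. iso_map f G H)"
proof -
  have "(\<lambda>e. f ` e) ` edges G = edges H \<longleftrightarrow>
      (\<forall>x\<in>vertices G. \<forall>y\<in>vertices G. adj H (f x) (f y) \<longleftrightarrow> adj G x y)"
    if f: "bij_betw f (vertices G) (vertices H)" for f
  proof
    assume eq: "(\<lambda>e. f ` e) ` edges G = edges H"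
    show "\<forall>x\<in>vertices G. \<forall>y\<in>vertices G. adj H (f x) (f y) \<longleftrightarrow> adj G x y"
    proof (intro ballI iffI)
      fix x y assume xy: "x \<in> vertices G" "y \<in> vertices G"
      { assume "adj G x y"
        then have "f ` {x, y} \<in> edges H" unfolding adj_def eq[symmetric] by (rule imageI)
        then show "adj H (f x) (f y)" by (simp add: adj_def) }
      assume "adj H (f x) (f y)"
      then obtain e where e: "e \<in> edges G" "f ` {x, y} = f ` e"
        unfolding adj_def eq[symmetric] by auto
      moreover have "e \<subseteq> vertices G" using e(1) assms(1) by (auto simp: graph_def)
      ultimately have "{x, y} = e"
        using f xy inj_on_image_eq_iff[of f "vertices G" "{x, y}" e] by (auto simp: bij_betw_def)
      then show "adj G x y" using e by (simp add: adj_def)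
    qed
  next
    assume a: "\<forall>x\<in>vertices G. \<forall>y\<in>vertices G. adj H (f x) (f y) \<longleftrightarrow> adj G x y"
    show "(\<lambda>e. f ` e) ` edges G = edges H"
    proof (intro equalityI subsetI)
      fix e' assume "e' \<in> (\<lambda>e. f ` e) ` edges G"
      then obtain e where "e \<in> edges G" and e': "e' = f ` e" by auto
      then obtain x y where xy: "e = {x, y}" "adj G x y" using assms(1) edge_cases by blast
      then have "adj H (f x) (f y)" using a adjD[OF assms(1)] by blast
      then show "e' \<in> edges H" using e' xy by (simp add: adj_def)
    next
      fix e' assume "e' \<in> edges H"
      then obtain x' y' where e': "e' = {x', y'}" "adj H x' y'" using assms(2) edge_cases by blast
      then have "x' \<in> f ` vertices G" "y' \<in> f ` vertices G"
        using f adjD[OF assms(2)] by (auto simp: bij_betw_def)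
      then obtain x y where xy: "x \<in> vertices G" "y \<in> vertices G" "x' = f x" "y' = f y" by auto
      then have "{x, y} \<in> edges G" using a e'(2) by (auto simp: adj_def)
      then show "e' \<in> (\<lambda>e. f ` e) ` edges G" using e'(1) xy by (intro image_eqI[of _ _ "{x, y}"]) auto
    qed
  qed
  then show ?thesis unfolding isomorphic_def iso_map_def by meson
qed

lemma iso_map_id: "iso_map id G G" by (simp add: iso_map_def)

lemma iso_map_comp: "iso_map f G H \<Longrightarrow> iso_map g H K \<Longrightarrow> iso_map (g \<circ> f) G K"
  by (auto simp: iso_map_def bij_betw_apply intro: bij_betw_trans)

lemma iso_map_inv: "iso_map f G H \<Longrightarrow> iso_map (inv_into (vertices G) f) H G"
proof -
  assume f: "iso_map f G H"
  let ?g = "inv_into (vertices G) f"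
  have b: "bij_betw f (vertices G) (vertices H)" using f by (simp add: iso_map_def)
  have "adj G (?g x) (?g y) \<longleftrightarrow> adj H x y" if "x \<in> vertices H" "y \<in> vertices H" for x y
    using iso_mapD(2)[OF f, of "?g x" "?g y"] that b
    by (simp add: bij_betw_inv_into_right[OF b] bij_betwE[OF bij_betw_inv_into[OF b]])
  then show ?thesis using bij_betw_inv_into[OF b] by (simp add: iso_map_def)
qed

lemma iso_map_degree:
  assumes "graph G" "graph H" "iso_map f G H" "x \<in> vertices G"
  shows "vertex_degree H (f x) = vertex_degree G x"
proof -
  have "nbhd H (f x) = f ` nbhd G x"
  proof (intro equalityI subsetI)
    fix y' assume "y' \<in> nbhd H (f x)"
    then have "y' \<in> f ` vertices G"
      using iso_mapD(4)[OF assms(3)] adjD(2)[OF assms(2)] by simp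
    then obtain y where "y \<in> vertices G" "y' = f y" by blast
    with \<open>y' \<in> nbhd H (f x)\<close> show "y' \<in> f ` nbhd G x" using iso_mapD(2)[OF assms(3)] assms(4) by auto
  qed (use adjD[OF assms(1)] iso_mapD(2)[OF assms(3)] in blast)
  moreover have "inj_on f (nbhd G x)"
    using assms(3) nbhd_subset[OF assms(1), of x]
    by (auto simp: iso_map_def bij_betw_def intro: inj_on_subset[of f "vertices G"])
  ultimately show ?thesis using assms by (simp add: degree_eq_card_nbhd card_image)
qed

text \<open>Exchanging two vertices with the same neighbours outside the pair is an automorphism. All
  ambiguity in removing a vertex below, except for one symmetry of a path, is of this kind.\<close>

lemma twin_swap:
  assumes "graph G" "x \<in> vertices G" "y \<in> vertices G"
    and "\<And>z. z \<noteq> x \<Longrightarrow> z \<noteq> y \<Longrightarrow> adj G x z \<longleftrightarrow> adj G y z"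
  shows "iso_map (id(x := y, y := x)) G G"
  unfolding iso_map_def
proof (intro conjI ballI)
  show "bij_betw (id(x := y, y := x)) (vertices G) (vertices G)"
    using assms(2,3) by (auto simp: bij_betw_def inj_on_def)
  fix a b
  have irr: "\<not> adj G z z" for z using adjD(3)[OF assms(1)] by blast
  have sym: "adj G z x \<longleftrightarrow> adj G x z" "adj G z y \<longleftrightarrow> adj G y z" for z
    by (rule adj_sym)+
  show "adj G ((id(x := y, y := x)) a) ((id(x := y, y := x)) b) \<longleftrightarrow> adj G a b"
  proof (cases "a = x \<or> a = y")
    case True
    then show ?thesis
      using irr sym assms(4) by (cases "b = x \<or> b = y") (metis fun_upd_apply id_apply)+
  next
    case False
    then show ?thesis
      using sym assms(4)[of a] by (cases "b = x \<or> b = y") (metis fun_upd_apply id_apply)+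
  qed
qed

lemma iso_map_add:
  assumes "graph H" "graph H'" "v \<notin> vertices H" "v' \<notin> vertices H'" "N \<subseteq> vertices H"
    and h: "iso_map h H H'"
  shows "iso_map (h(v := v')) (add H v N) (add H' v' (h ` N))"
  unfolding iso_map_def
proof (intro conjI ballI)
  show "bij_betw (h(v := v')) (vertices (add H v N)) (vertices (add H' v' (h ` N)))"
    using h assms(3,4) by (auto simp: iso_map_def bij_betw_def inj_on_def)
next
  fix x y assume xy: "x \<in> vertices (add H v N)" "y \<in> vertices (add H v N)"
  have *: "h z \<in> h ` N \<longleftrightarrow> z \<in> N" if "z \<in> vertices H" for z
    using iso_mapD(3)[OF h] that assms(5) by blast
  have "\<not> adj H' v' z" "\<not> adj H' z v'" for z using assms(2,4) by (auto dest: adjD)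
  moreover have "\<not> adj H v z" "\<not> adj H z v" for z using assms(1,3) by (auto dest: adjD)
  moreover have "h z \<noteq> v'" if "z \<in> vertices H" for z using that assms(4) iso_mapD(1)[OF h] by blast
  moreover have "v' \<notin> h ` N" "v \<notin> N" using assms iso_mapD(1)[OF h] by auto
  ultimately show "adj (add H' v' (h ` N)) ((h(v := v')) x) ((h(v := v')) y) = adj (add H v N) x y"
    using xy * assms(3) iso_mapD(2)[OF h] unfolding adj_add vertices_ops
    by (cases "x = v"; cases "y = v") simp_all
qed

lemma iso_map_add_cancel:
  assumes "graph H" "graph H'" "v \<notin> vertices H" "v' \<notin> vertices H'"
    and f: "iso_map f (add H v N) (add H' v' N')" "f v = v'"
  shows "iso_map f H H'"
  unfolding iso_map_def
proof (intro conjI ballI)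
  have "inj_on f (insert v (vertices H))" "f ` insert v (vertices H) = insert v' (vertices H')"
    using f(1) by (simp_all add: iso_map_def bij_betw_def)
  then have "inj_on f (vertices H)" "v' \<notin> f ` vertices H"
    "insert v' (f ` vertices H) = insert v' (vertices H')"
    using assms(3) f(2) by auto
  then show "bij_betw f (vertices H) (vertices H')"
    using assms(4) by (simp add: bij_betw_def insert_ident)
next
  fix x y assume "x \<in> vertices H" "y \<in> vertices H"
  moreover from this have "x \<noteq> v" "y \<noteq> v" "f x \<noteq> v'" "f y \<noteq> v'" 
    using assms(3) iso_mapD(3)[OF f(1)] f(2) by (metis insert_iff vertices_ops(1))+
  ultimately show "adj H' (f x) (f y) = adj H x y"
    using iso_mapD(2)[OF f(1), of x y] by auto
qed

section \<open>Degree lists and slack\<close>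

abbreviation degrees :: "'a ugraph \<Rightarrow> nat multiset" where
  "degrees G \<equiv> image_mset (vertex_degree G) (mset_set (vertices G))"

lemma mset_degree_list [simp]: "mset (degree_list G) = degrees G"
  by (simp add: degree_list_def)

lemma sorted_degree_list: "sorted (rev (degree_list G))"
  by (simp add: degree_list_def)

lemma length_degree_list [simp]: "length (degree_list G) = card (vertices G)"
  by (metis mset_degree_list size_image_mset size_mset size_mset_set)

lemma set_degree_list [simp]: "graph G \<Longrightarrow> set (degree_list G) = vertex_degree G ` vertices G"
  by (metis finite_set_mset_mset_set graph_finite mset_degree_list set_image_mset set_mset_mset)

text \<open>Degree lists are computed by exhibiting a sorted list with the right multiset of entries.\<close>

lemma degree_list_eqI:
  assumes "sorted (rev xs)" "mset xs = degrees G"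
  shows "degree_list G = xs"
proof -
  have "sorted_list_of_multiset (degrees G) = sort (rev xs)"
    using assms(2) sorted_list_of_multiset_mset[of "rev xs"] by simp
  then show ?thesis using assms(1) by (simp add: degree_list_def sorted_sort_id)
qed

lemma degree_list_eq_iff: "degree_list G = degree_list H \<longleftrightarrow> degrees G = degrees H"
  by (metis degree_list_eqI mset_degree_list sorted_degree_list)

lemma degrees_add:
  assumes "graph H" "v \<notin> vertices H" "N \<subseteq> vertices H"
  shows "degrees (add H v N) =
    add_mset (card N) (image_mset (\<lambda>x. vertex_degree H x + of_bool (x \<in> N)) (mset_set (vertices H)))"
proof -
  have "image_mset (vertex_degree (add H v N)) (mset_set (vertices H)) =
      image_mset (\<lambda>x. vertex_degree H x + of_bool (x \<in> N)) (mset_set (vertices H))"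
    using degree_add(2)[OF assms] assms(1) by (intro image_mset_cong) auto
  then show ?thesis using assms degree_add(1)[OF assms] by simp
qed

lemma iso_map_degrees:
  assumes "graph G" "graph H" "iso_map f G H"
  shows "degrees G = degrees H"
proof -
  have "degrees H = image_mset (vertex_degree H) (image_mset f (mset_set (vertices G)))"
    using assms by (simp add: image_mset_mset_set iso_map_def bij_betw_def)
  also have "\<dots> = degrees G"
    using iso_map_degree[OF assms] assms(1)
    by (simp add: image_mset.compositionality) (intro image_mset_cong, auto)
  finally show ?thesis by simp
qed

lemma card_degree_eq:
  assumes "graph G"
  shows "card {v \<in> vertices G. vertex_degree G v = c} = length (filter (\<lambda>x. x = c) (degree_list G))"
proof -
  have "length (filter (\<lambda>x. x = c) (degree_list G)) = size (filter_mset (\<lambda>x. x = c) (degrees G))"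
    by (metis mset_degree_list mset_filter size_mset)
  also have "\<dots> = card {v \<in> vertices G. vertex_degree G v = c}"
    using assms by (simp add: filter_mset_image_mset filter_mset_mset_set)
  finally show ?thesis by simp
qed

text \<open>The quantity \<open>seq_Delta\<close>, the slack in the \<open>k\<close>-th Erdos-Gallai inequality, written with
  \<open>take\<close> and \<open>drop\<close> so that it can be computed by rewriting.\<close>

definition slack :: "nat \<Rightarrow> nat list \<Rightarrow> int" where
  "slack k d = int k * (int k - 1) + (\<Sum>x\<leftarrow>drop k d. int (min k x)) - (\<Sum>x\<leftarrow>take k d. int x)"

text \<open>The bound \<open>k + 1 \<le> seq_m d\<close> becomes a condition on the single entry at position \<open>k\<close>; for
  sorted lists the two agree.\<close>

definition small_slack :: "nat list \<Rightarrow> bool" where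
  "small_slack d \<longleftrightarrow> (\<forall>k<length d. k \<le> d ! k \<longrightarrow> slack (Suc k) d \<le> 1)"

lemma seq_Delta_eq_slack:
  assumes "k \<le> length d" shows "seq_Delta k d = slack k d"
proof -
  have "(\<Sum>i = k + 1..length d. int (min k (seq_term d i))) = (\<Sum>i = 0..<length d - k. int (min k (d ! (k + i))))"
    by (rule sum.reindex_bij_witness[of _ "\<lambda>i. Suc (k + i)" "\<lambda>i. i - Suc k"]) auto
  also have "\<dots> = (\<Sum>x\<leftarrow>drop k d. int (min k x))"
    by (simp add: sum_list_sum_nth)
  finally have 1: "(\<Sum>i = k + 1..length d. int (min k (seq_term d i))) = (\<Sum>x\<leftarrow>drop k d. int (min k x))" .
  have "(\<Sum>i = 1..k. int (seq_term d i)) = (\<Sum>i = 0..<k. int (d ! i))"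
    by (rule sum.reindex_bij_witness[of _ Suc "\<lambda>i. i - 1"]) auto
  also have "\<dots> = (\<Sum>x\<leftarrow>take k d. int x)"
    using assms by (simp add: sum_list_sum_nth)
  finally have 2: "(\<Sum>i = 1..k. int (seq_term d i)) = (\<Sum>x\<leftarrow>take k d. int x)" .
  show ?thesis unfolding seq_Delta_def slack_def 1 2 by simp
qed

lemma small_slack_iff:
  assumes "sorted (rev d)" "d \<noteq> []"
  shows "(\<forall>k\<in>{1..seq_m d}. seq_Delta k d \<le> 1) \<longleftrightarrow> small_slack d"
proof -
  let ?M = "{i \<in> {1..length d}. seq_term d i \<ge> i - 1}"
  have fin: "finite ?M" by simp
  have "1 \<in> ?M" using assms(2) by (cases d) auto
  then have ne: "?M \<noteq> {}" by blast
  have "seq_m d \<in> ?M" unfolding seq_m_def using fin ne by (rule Max_in)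
  then have m: "seq_m d \<le> length d" "seq_m d - 1 \<le> d ! (seq_m d - 1)" by auto
  have "k < seq_m d \<longleftrightarrow> k < length d \<and> k \<le> d ! k" for k
  proof
    assume k: "k < seq_m d"
    then have "d ! (seq_m d - 1) \<le> d ! k"
      using assms(1) m(1) sorted_rev_nth_mono[of d k "seq_m d - 1"] by auto
    then show "k < length d \<and> k \<le> d ! k" using k m by auto
  next
    assume "k < length d \<and> k \<le> d ! k"
    then have "Suc k \<in> ?M" by auto
    then have "Suc k \<le> seq_m d" unfolding seq_m_def using fin by (rule Max_ge[rotated])
    then show "k < seq_m d" by simp
  qed
  then have "small_slack d \<longleftrightarrow> (\<forall>k<seq_m d. slack (Suc k) d \<le> 1)"
    unfolding small_slack_def by blast
  also have "\<dots> \<longleftrightarrow> (\<forall>k\<in>{1..seq_m d}. slack k d \<le> 1)"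
    by (metis One_nat_def Suc_le_eq Suc_pred atLeastAtMost_iff less_Suc_eq_le not_less_eq_eq zero_less_Suc le_0_eq not_gr_zero)
  finally show ?thesis using seq_Delta_eq_slack m(1) by auto
qed

text \<open>The common pattern of the enlargements below: the new list has the old slacks again, moved by
  \<open>j\<close> places, and the remaining indices are harmless, either because their slack is at most one or because
  they lie beyond the range that counts.\<close>

lemma small_slack_shift:
  assumes "\<And>k. k < length d \<Longrightarrow> j + k < length d'"
    and "\<And>k. k < length d \<Longrightarrow> j + k \<le> d' ! (j + k) \<longleftrightarrow> k \<le> d ! k"
    and "\<And>k. k < length d \<Longrightarrow> k \<le> d ! k \<Longrightarrow> slack (Suc (j + k)) d' = slack (Suc k) d"
    and "\<And>i. i < j \<Longrightarrow> slack (Suc i) d' \<le> 1"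
    and "\<And>i. j + length d \<le> i \<Longrightarrow> i < length d' \<Longrightarrow> i \<le> d' ! i \<Longrightarrow> slack (Suc i) d' \<le> 1"
  shows "small_slack d' \<longleftrightarrow> small_slack d"
proof
  assume a: "small_slack d'"
  show "small_slack d" unfolding small_slack_def
  proof (intro allI impI)
    fix k assume k: "k < length d" "k \<le> d ! k"
    then have "slack (Suc (j + k)) d' \<le> 1"
      using a assms(1,2)[of k] unfolding small_slack_def by blast
    then show "slack (Suc k) d \<le> 1" using assms(3) k by simp
  qed
next
  assume a: "small_slack d"
  show "small_slack d'" unfolding small_slack_def
  proof (intro allI impI)
    fix i assume i: "i < length d'" "i \<le> d' ! i"
    consider "i < j" | "j + length d \<le> i" | k where "i = j + k" "k < length d"
      by (metis le_add_diff_inverse nat_add_left_cancel_less not_le)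
    then show "slack (Suc i) d' \<le> 1"
    proof cases
      case 3
      then show ?thesis using a assms(2,3)[of k] i unfolding small_slack_def by simp
    qed (use assms(4,5) i in auto)
  qed
qed

lemma small_slack_isolated: "small_slack (d @ [0]) \<longleftrightarrow> small_slack d"
proof (rule small_slack_shift[where j = 0])
  fix i assume "0 + length d \<le> i" "i < length (d @ [0])" "i \<le> (d @ [0]) ! i"
  then have "i = length d" "d = []" by (auto simp: nth_append)
  then show "slack (Suc i) (d @ [0]) \<le> 1" by (simp add: slack_def)
qed (auto simp: slack_def nth_append)

lemma sum_min_Suc: "(\<Sum>x\<leftarrow>xs. int (min (Suc k) (Suc x))) = (\<Sum>x\<leftarrow>xs. int (min k x)) + int (length xs)"
  by (induction xs) auto

lemma sum_Suc: "(\<Sum>x\<leftarrow>xs. int (Suc x)) = (\<Sum>x\<leftarrow>xs. int x) + int (length xs)"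
  by (induction xs) auto

lemma slack_0 [simp]: "slack 0 d = 0"
  by (simp add: slack_def sum_list_triv)

text \<open>Putting a large term in front and raising the following terms by one moves the slack by one
  place, up to two corrections: for the difference between the new term and the number of raised terms, and for the
  terms \<open>s\<close> at the end, which are not raised.\<close>

lemma slack_Cons_map_Suc_append:
  "k \<le> length r \<Longrightarrow> slack (Suc k) (y # map Suc r @ s) =
     slack k (r @ s) + int (length r) - int y
     + (\<Sum>x\<leftarrow>s. int (min (Suc k) x)) - (\<Sum>x\<leftarrow>s. int (min k x))"
  by (simp add: slack_def drop_map take_map comp_def sum_min_Suc sum_Suc algebra_simps of_nat_diff
      del: min_Suc_Suc of_nat_Suc) (simp add: algebra_simps)

lemma small_slack_dominating: "small_slack (length d # map Suc d) \<longleftrightarrow> small_slack d"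
proof (rule small_slack_shift[where j = 1])
  show "slack (Suc i) (length d # map Suc d) \<le> 1" if "i < 1" for i
    using slack_Cons_map_Suc_append[of 0 d "length d" "[]"] that by simp
qed (use slack_Cons_map_Suc_append[of _ d "length d" "[]"] in \<open>auto\<close>)

text \<open>A leaf attached to a vertex of maximum degree adds one to both sums in every slack, for every
  \<open>k \<ge> 1\<close>.\<close>

lemma small_slack_leaf:
  assumes "r \<noteq> []"
  shows "small_slack (Suc x # r @ [1]) \<longleftrightarrow> small_slack (x # r)"
proof (rule small_slack_shift[where j = 0])
  fix k assume k: "k < length (x # r)"
  show "0 + k < length (Suc x # r @ [1])" using k by simp
  show "0 + k \<le> (Suc x # r @ [1]) ! (0 + k) \<longleftrightarrow> k \<le> (x # r) ! k"
    using k by (cases k) (auto simp: nth_append)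
  show "slack (Suc (0 + k)) (Suc x # r @ [1]) = slack (Suc k) (x # r)"
    using k by (simp add: slack_def)
next
  fix i assume "0 + length (x # r) \<le> i" "i < length (Suc x # r @ [1])" "i \<le> (Suc x # r @ [1]) ! i"
  moreover from this have "i = Suc (length r)" by simp
  ultimately show "slack (Suc i) (Suc x # r @ [1]) \<le> 1" using assms by (simp add: nth_append)
qed simp

text \<open>The complementary operation: a new vertex adjacent to everything but one leaf. Its own slack is
  one, and the old slacks follow unchanged.\<close>

lemma small_slack_cotop:
  assumes "length r \<ge> 2"
  shows "small_slack (length r # map Suc r @ [1]) \<longleftrightarrow> small_slack (r @ [1])"
proof (rule small_slack_shift[where j = 1])
  note s = slack_Cons_map_Suc_append[of _ r "length r" "[1]"]
  fix k assume k: "k < length (r @ [1])"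
  show "1 + k < length (length r # map Suc r @ [1])" using k by simp
  show c: "1 + k \<le> (length r # map Suc r @ [1]) ! (1 + k) \<longleftrightarrow> k \<le> (r @ [1]) ! k"
    using k assms by (auto simp: nth_append less_Suc_eq)
  assume "k \<le> (r @ [1]) ! k"
  then have "k < length r" using k assms by (auto simp: less_Suc_eq)
  then show "slack (Suc (1 + k)) (length r # map Suc r @ [1]) = slack (Suc k) (r @ [1])"
    using s[of "Suc k"] by simp
next
  fix i :: nat assume "i < 1"
  then show "slack (Suc i) (length r # map Suc r @ [1]) \<le> 1"
    using slack_Cons_map_Suc_append[of 0 r "length r" "[1]"] by simp
qed auto

text \<open>The two inner vertices of the path contribute slacks 1 and 0 in front; the two end vertices lie
  beyond the range of indices that counts.\<close>

lemma small_slack_p4: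
  "small_slack ((length d + 2) # (length d + 2) # map (\<lambda>x. x + 2) d @ [1, 1]) \<longleftrightarrow> small_slack d"
proof -
  let ?n = "length d + 2"
  let ?e = "?n # ?n # map (\<lambda>x. x + 2) d @ [1, 1]"
  have e: "?e = ?n # map Suc ((length d + 1) # map Suc d) @ [1, 1]" by simp
  have s1: "slack (Suc k) ?e = slack k ((length d + 1) # map Suc d @ [1, 1]) + (if k = 0 then 1 else -1)"
    if "k \<le> length d + 1" for k
    unfolding e using slack_Cons_map_Suc_append[of k "(length d + 1) # map Suc d" ?n "[1, 1]"] that by auto
  have s2: "slack (Suc k) ((length d + 1) # map Suc d @ [1, 1]) = slack k d + 1"
    if "k \<le> length d" for k
    using slack_Cons_map_Suc_append[of k d "length d + 1" "[1, 1]"] that by (auto simp: slack_def)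
  show ?thesis
  proof (rule small_slack_shift[where j = 2])
    fix k assume k: "k < length d"
    show "2 + k < length ?e" "2 + k \<le> ?e ! (2 + k) \<longleftrightarrow> k \<le> d ! k"
      using k by (auto simp: nth_append)
    show "slack (Suc (2 + k)) ?e = slack (Suc k) d"
      using k s1[of "Suc (Suc k)"] s2[of "Suc k"] by simp
  next
    fix i :: nat assume "i < 2"
    then show "slack (Suc i) ?e \<le> 1" using s1[of i] s2[of 0] by (auto simp: less_2_cases_iff)
  next
    fix i assume "2 + length d \<le> i" "i < length ?e" "i \<le> ?e ! i"
    moreover from this have "i = 2 + length d \<or> i = 3 + length d" by auto
    ultimately show "slack (Suc i) ?e \<le> 1" by (auto simp: nth_append)
  qed
qed

section \<open>Enlarging weakly threshold graphs\<close>

text \<open>Weakly threshold graphs, with the empty graph admitted.\<close>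

definition wt :: "'a ugraph \<Rightarrow> bool" where
  "wt G \<longleftrightarrow> graph G \<and> small_slack (degree_list G)"

lemma wt_graph: "wt G \<Longrightarrow> graph G" by (simp add: wt_def)

lemma wt_add_isolated:
  assumes "graph H" "v \<notin> vertices H"
  shows "degree_list (add H v {}) = degree_list H @ [0]"
    and "wt (add H v {}) \<longleftrightarrow> wt H"
proof -
  show "degree_list (add H v {}) = degree_list H @ [0]"
    by (rule degree_list_eqI)
      (use assms degrees_add[OF assms, of "{}"] in \<open>simp_all add: sorted_degree_list\<close>)
  then show "wt (add H v {}) \<longleftrightarrow> wt H" using assms by (simp add: wt_def small_slack_isolated)
qed

lemma wt_add_dominating:
  assumes "graph H" "v \<notin> vertices H"
  shows "degree_list (add H v (vertices H)) = card (vertices H) # map Suc (degree_list H)"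
    and "wt (add H v (vertices H)) \<longleftrightarrow> wt H"
proof -
  show *: "degree_list (add H v (vertices H)) = card (vertices H) # map Suc (degree_list H)"
  proof (rule degree_list_eqI)
    show "sorted (rev (card (vertices H) # map Suc (degree_list H)))"
      using assms(1) sorted_degree_list[of H]
      by (auto simp: sorted_append rev_map sorted_map Suc_le_eq degree_less_card
          intro: sorted_wrt_mono_rel[rotated])
    have "image_mset (\<lambda>x. vertex_degree H x + of_bool (x \<in> vertices H)) (mset_set (vertices H)) =
        image_mset Suc (degrees H)"
      unfolding image_mset.compositionality using assms(1) by (intro image_mset_cong) auto
    then show "mset (card (vertices H) # map Suc (degree_list H)) = degrees (add H v (vertices H))"
      using degrees_add[OF assms, of "vertices H"] by simp
  qed
  show "wt (add H v (vertices H)) \<longleftrightarrow> wt H"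
    using assms small_slack_dominating[of "degree_list H"] unfolding wt_def * by simp
qed

lemma degrees_remove:
  assumes "graph H" "u \<in> vertices H"
  shows "degrees H = add_mset (vertex_degree H u) (image_mset (vertex_degree H) (mset_set (vertices H - {u})))"
  using assms by (simp add: mset_set.remove[of "vertices H" u])

text \<open>Maximality of the degree of \<open>u\<close> keeps its increased degree at the head of the list.\<close>

lemma wt_add_leaf:
  assumes "graph H" "v \<notin> vertices H" "u \<in> vertices H" "card (vertices H) \<ge> 2"
    and b: "\<And>x. x \<in> vertices H \<Longrightarrow> 1 \<le> vertex_degree H x \<and> vertex_degree H x \<le> vertex_degree H u"
  shows "degree_list (add H v {u}) = Suc (hd (degree_list H)) # tl (degree_list H) @ [1]"
    and "hd (degree_list H) = vertex_degree H u"
    and "wt (add H v {u}) \<longleftrightarrow> wt H"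
proof -
  define M where "M = image_mset (vertex_degree H) (mset_set (vertices H - {u}))"
  define r where "r = rev (sorted_list_of_multiset M)"
  have setr: "set r \<subseteq> vertex_degree H ` vertices H" using assms(1) by (auto simp: r_def M_def)
  have msetr: "mset r = M" by (simp add: r_def)
  have sr: "sorted (rev r)" by (simp add: r_def)
  have H: "degree_list H = vertex_degree H u # r"
  proof (rule degree_list_eqI)
    show "sorted (rev (vertex_degree H u # r))"
      using setr b sr by (auto simp: sorted_append)
  qed (use degrees_remove[OF assms(1,3)] msetr M_def in simp)
  have G: "degree_list (add H v {u}) = Suc (vertex_degree H u) # r @ [1]"
  proof (rule degree_list_eqI)
    have "x \<le> Suc (vertex_degree H u) \<and> 1 \<le> x" if "x \<in> set r" for x
      using setr b that by fastforce
    then show "sorted (rev (Suc (vertex_degree H u) # r @ [1]))"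
      using sr by (auto simp: sorted_append)
    have "image_mset (\<lambda>x. vertex_degree H x + of_bool (x \<in> {u})) (mset_set (vertices H - {u})) = M"
      unfolding M_def using assms(1) by (intro image_mset_cong) auto
    then have "image_mset (\<lambda>x. vertex_degree H x + of_bool (x \<in> {u})) (mset_set (vertices H)) =
        add_mset (Suc (vertex_degree H u)) M"
      using assms(1,3) by (simp add: mset_set.remove[of "vertices H" u])
    then show "mset (Suc (vertex_degree H u) # r @ [1]) = degrees (add H v {u})"
      using degrees_add[OF assms(1,2), of "{u}"] assms(3) msetr by simp
  qed
  show "degree_list (add H v {u}) = Suc (hd (degree_list H)) # tl (degree_list H) @ [1]"
    and "hd (degree_list H) = vertex_degree H u"
    by (simp_all add: H G)
  have "length (degree_list H) \<ge> 2" using assms(4) by simp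
  then have "r \<noteq> []" unfolding H by auto
  then show "wt (add H v {u}) \<longleftrightarrow> wt H"
    using assms small_slack_leaf[of r] by (simp add: wt_def H G)
qed

lemma wt_add_cotop:
  assumes "graph H" "v \<notin> vertices H" "p \<in> vertices H" "card (vertices H) \<ge> 3" "vertex_degree H p = 1"
    and b: "\<And>x. x \<in> vertices H \<Longrightarrow> 1 \<le> vertex_degree H x \<and> vertex_degree H x + 2 \<le> card (vertices H)"
  shows "wt (add H v (vertices H - {p})) \<longleftrightarrow> wt H"
proof -
  define M where "M = image_mset (vertex_degree H) (mset_set (vertices H - {p}))"
  define r where "r = rev (sorted_list_of_multiset M)"
  have setr: "set r \<subseteq> vertex_degree H ` vertices H" using assms(1) by (auto simp: r_def M_def)
  have msetr: "mset r = M" by (simp add: r_def)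
  have sr: "sorted (rev r)" by (simp add: r_def)
  have "size M = card (vertices H) - 1" using assms(1,3) by (simp add: M_def)
  then have len: "length r = card (vertices H) - 1" using msetr by (metis size_mset)
  have bound: "Suc x \<le> length r \<and> 1 \<le> x" if x: "x \<in> set r" for x
  proof -
    obtain y where "y \<in> vertices H" "x = vertex_degree H y" using setr x by blast
    then show ?thesis using b[of y] len by linarith
  qed
  have H: "degree_list H = r @ [1]"
  proof (rule degree_list_eqI)
    show "sorted (rev (r @ [1]))" using bound sr by auto
  qed (use degrees_remove[OF assms(1,3)] msetr M_def assms(5) in simp)
  have G: "degree_list (add H v (vertices H - {p})) = length r # map Suc r @ [1]"
  proof (rule degree_list_eqI)
    show "sorted (rev (length r # map Suc r @ [1]))"
      using sr bound len assms(4)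
      by (auto simp: sorted_append rev_map sorted_map intro: sorted_wrt_mono_rel[rotated])
    have "image_mset (\<lambda>x. vertex_degree H x + of_bool (x \<in> vertices H - {p})) (mset_set (vertices H - {p}))
        = image_mset Suc M"
      unfolding M_def image_mset.compositionality using assms(1) by (intro image_mset_cong) auto
    then have "image_mset (\<lambda>x. vertex_degree H x + of_bool (x \<in> vertices H - {p})) (mset_set (vertices H)) =
        add_mset 1 (image_mset Suc M)"
      using assms(1,3,5) by (simp add: mset_set.remove[of "vertices H" p])
    moreover have "card (vertices H - {p}) = length r" using len assms(1,3) by simp
    ultimately show "mset (length r # map Suc r @ [1]) = degrees (add H v (vertices H - {p}))"
      using degrees_add[OF assms(1,2), of "vertices H - {p}"] msetr by auto
  qed
  have "graph (add H v (vertices H - {p}))" using assms by auto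
  then show ?thesis
    using assms len small_slack_cotop[of r] by (simp add: wt_def H G)
qed

text \<open>The path \<open>a - b - c - d\<close> whose inner vertices \<open>b\<close> and \<open>c\<close> are also joined to all of \<open>H\<close>. It is built
  from four single additions, so that degrees and isomorphisms are inherited from those.\<close>

definition p4_join :: "'a ugraph \<Rightarrow> 'a \<Rightarrow> 'a \<Rightarrow> 'a \<Rightarrow> 'a \<Rightarrow> 'a ugraph" where
  "p4_join H a b c d =
     add (add (add (add H c (vertices H)) b (insert c (vertices H))) d {c}) a {b}"

definition fresh4 :: "'a ugraph \<Rightarrow> 'a \<Rightarrow> 'a \<Rightarrow> 'a \<Rightarrow> 'a \<Rightarrow> bool" where
  "fresh4 H a b c d \<longleftrightarrow> distinct [a, b, c, d] \<and> {a, b, c, d} \<inter> vertices H = {}"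

lemma p4_join_simps [simp]:
  "vertices (p4_join H a b c d) = {a, b, c, d} \<union> vertices H"
  "graph H \<Longrightarrow> fresh4 H a b c d \<Longrightarrow> graph (p4_join H a b c d)"
  by (auto simp: p4_join_def fresh4_def)

lemma adj_p4_join:
  "adj (p4_join H a b c d) x y \<longleftrightarrow> adj H x y \<or> x = c \<and> y \<in> vertices H \<or> y = c \<and> x \<in> vertices H
    \<or> x = b \<and> y \<in> vertices H \<or> y = b \<and> x \<in> vertices H \<or> {x, y} = {a, b} \<or> {x, y} = {b, c} \<or> {x, y} = {c, d}"
  by (auto simp: p4_join_def doubleton_eq_iff)

lemma degree_p4_join:
  assumes "graph H" "fresh4 H a b c d"
  shows "vertex_degree (p4_join H a b c d) a = 1" "vertex_degree (p4_join H a b c d) d = 1"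
    "vertex_degree (p4_join H a b c d) b = card (vertices H) + 2"
    "vertex_degree (p4_join H a b c d) c = card (vertices H) + 2"
    "x \<in> vertices H \<Longrightarrow> vertex_degree (p4_join H a b c d) x = vertex_degree H x + 2"
proof -
  have f: "c \<notin> vertices H" "b \<notin> vertices H" "d \<notin> vertices H" "a \<notin> vertices H"
    "a \<noteq> b" "a \<noteq> c" "a \<noteq> d" "b \<noteq> c" "b \<noteq> d" "c \<noteq> d"
    using assms(2) by (auto simp: fresh4_def)
  define H1 where "H1 = add H c (vertices H)"
  define H2 where "H2 = add H1 b (insert c (vertices H))"
  define H3 where "H3 = add H2 d {c}"
  have G: "p4_join H a b c d = add H3 a {b}" by (simp add: p4_join_def H1_def H2_def H3_def)
  have v: "vertices H1 = insert c (vertices H)" "vertices H2 = insert b (insert c (vertices H))"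
    "vertices H3 = insert d (insert b (insert c (vertices H)))"
    by (simp_all add: H1_def H2_def H3_def)
  have g1: "graph H1" unfolding H1_def using assms(1) f by simp
  have g2: "graph H2" unfolding H2_def using g1 f by (intro graph_add) (auto simp: v)
  have g3: "graph H3" unfolding H3_def using g2 f by (intro graph_add) (auto simp: v)
  have d1: "vertex_degree H1 c = card (vertices H)"
    "x \<in> vertices H \<Longrightarrow> vertex_degree H1 x = vertex_degree H x + 1" for x
    unfolding H1_def using degree_add[OF assms(1) f(1)] by auto
  have d2: "vertex_degree H2 b = card (vertices H) + 1"
    "x \<in> vertices H1 \<Longrightarrow> vertex_degree H2 x = vertex_degree H1 x + 1" for x
    unfolding H2_def using degree_add[OF g1, of b "insert c (vertices H)"] f assms(1) by (auto simp: v)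
  have d3: "vertex_degree H3 d = 1"
    "x \<in> vertices H2 \<Longrightarrow> vertex_degree H3 x = vertex_degree H2 x + of_bool (x = c)" for x
    unfolding H3_def using degree_add[OF g2, of d "{c}"] f by (auto simp: v)
  have d4: "vertex_degree (p4_join H a b c d) a = 1"
    "x \<in> vertices H3 \<Longrightarrow> vertex_degree (p4_join H a b c d) x = vertex_degree H3 x + of_bool (x = b)" for x
    unfolding G using degree_add[OF g3, of a "{b}"] f by (auto simp: v)
  show "vertex_degree (p4_join H a b c d) a = 1" "vertex_degree (p4_join H a b c d) d = 1"
    "vertex_degree (p4_join H a b c d) b = card (vertices H) + 2"
    "vertex_degree (p4_join H a b c d) c = card (vertices H) + 2"
    using f d1 d2 d3 d4 by (simp_all add: v)
  assume "x \<in> vertices H"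
  then have x: "x \<in> vertices H" "x \<noteq> a" "x \<noteq> b" "x \<noteq> c" "x \<noteq> d" using f by auto
  then show "vertex_degree (p4_join H a b c d) x = vertex_degree H x + 2"
    using d1 d2 d3 d4 by (simp add: v)
qed

lemma wt_p4_join:
  assumes "graph H" "fresh4 H a b c d"
  shows "degree_list (p4_join H a b c d) = (card (vertices H) + 2) # (card (vertices H) + 2) #
      map (\<lambda>x. x + 2) (degree_list H) @ [1, 1]"
    and "wt (p4_join H a b c d) \<longleftrightarrow> wt H"
proof -
  let ?n = "card (vertices H) + 2"
  show G: "degree_list (p4_join H a b c d) = ?n # ?n # map (\<lambda>x. x + 2) (degree_list H) @ [1, 1]"
  proof (rule degree_list_eqI)
    have "sorted (rev (map (\<lambda>x. x + 2) (degree_list H)))"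
      using sorted_degree_list[of H]
      by (auto simp: rev_map sorted_map intro: sorted_wrt_mono_rel[rotated])
    then show "sorted (rev (?n # ?n # map (\<lambda>x. x + 2) (degree_list H) @ [1, 1]))"
      using assms(1) by (auto simp: sorted_append less_imp_le degree_less_card)
    have "image_mset (vertex_degree (p4_join H a b c d)) (mset_set (vertices H)) =
        image_mset (\<lambda>x. x + 2) (degrees H)"
      unfolding image_mset.compositionality
      using assms degree_p4_join(5)[OF assms] by (intro image_mset_cong) auto
    moreover have "mset_set (vertices (p4_join H a b c d)) =
        add_mset a (add_mset b (add_mset c (add_mset d (mset_set (vertices H)))))"
      using assms by (simp add: fresh4_def)
    ultimately show "mset (?n # ?n # map (\<lambda>x. x + 2) (degree_list H) @ [1, 1]) =
        degrees (p4_join H a b c d)"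
      using degree_p4_join(1-4)[OF assms] by simp
  qed
  show "wt (p4_join H a b c d) \<longleftrightarrow> wt H"
    using assms small_slack_p4[of "degree_list H"] unfolding wt_def G by simp
qed

text \<open>The complement of the path \<open>a - b - c - d\<close> is the path \<open>b - d - a - c\<close>, and the roles of inner and
  end vertices are exchanged.\<close>

lemma compl_p4_join:
  assumes "graph H" "fresh4 H a b c d"
  shows "fresh4 (compl H) b d a c" "compl (p4_join H a b c d) = p4_join (compl H) b d a c"
proof -
  show f: "fresh4 (compl H) b d a c" using assms(2) by (auto simp: fresh4_def)
  show "compl (p4_join H a b c d) = p4_join (compl H) b d a c"
  proof (rule graph_eqI)
    have ndist: "a \<noteq> b" "a \<noteq> c" "a \<noteq> d" "b \<noteq> c" "b \<noteq> d" "c \<noteq> d"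
      "b \<noteq> a" "c \<noteq> a" "d \<noteq> a" "c \<noteq> b" "d \<noteq> b" "d \<noteq> c"
      and nV: "a \<notin> vertices H" "b \<notin> vertices H" "c \<notin> vertices H" "d \<notin> vertices H"
      using assms(2) by (auto simp: fresh4_def)
    have out: "\<not> adj H a y" "\<not> adj H b y" "\<not> adj H c y" "\<not> adj H d y"
      "\<not> adj H y a" "\<not> adj H y b" "\<not> adj H y c" "\<not> adj H y d" for y
      using nV adjD[OF assms(1)] by metis+
    fix x y
    show "adj (compl (p4_join H a b c d)) x y \<longleftrightarrow> adj (p4_join (compl H) b d a c) x y"
    proof (cases "x \<in> {a, b, c, d}")
      case True
      then show ?thesis
        by (elim insertE emptyE)
          (simp_all add: adj_p4_join doubleton_eq_iff ndist nV out, (use nV ndist in auto)?)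
    next
      case False
      show ?thesis
      proof (cases "y \<in> {a, b, c, d}")
        case True
        then show ?thesis using False
          by (elim insertE emptyE)
            (simp_all add: adj_p4_join doubleton_eq_iff ndist nV out, (use nV ndist in auto)?)
      next
        case y: False
        show ?thesis using False y by (auto simp: adj_p4_join doubleton_eq_iff)
      qed
    qed
  qed (use assms f in auto)
qed

section \<open>Cores, tops and leaves\<close>

text \<open>What is left when no isolated and no dominating vertex can be removed.\<close>

definition core :: "'a ugraph \<Rightarrow> bool" where
  "core G \<longleftrightarrow> wt G \<and> vertices G \<noteq> {} \<and>
     (\<forall>v\<in>vertices G. 1 \<le> vertex_degree G v \<and> vertex_degree G v + 2 \<le> card (vertices G))"

text \<open>The vertices that miss exactly one other vertex. In a core these are the vertices of largest possible
  degree, just as the leaves have the smallest possible degree; complementation exchanges the two sets.\<close>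

definition tops :: "'a ugraph \<Rightarrow> 'a set" where
  "tops G = {v \<in> vertices G. vertex_degree G v = card (vertices G) - 2}"

definition leaves :: "'a ugraph \<Rightarrow> 'a set" where
  "leaves G = {v \<in> vertices G. vertex_degree G v = 1}"

lemma coreD:
  assumes "core G"
  shows "wt G" "graph G" "v \<in> vertices G \<Longrightarrow> 1 \<le> vertex_degree G v"
    "v \<in> vertices G \<Longrightarrow> vertex_degree G v + 2 \<le> card (vertices G)"
  using assms by (auto simp: core_def wt_def)

text \<open>On three vertices the bounds would force all degrees to be one, which no graph has.\<close>

lemma core_card:
  assumes "core G" shows "card (vertices G) \<ge> 4"
proof (rule ccontr)
  assume n: "\<not> ?thesis"
  note g = coreD(2)[OF assms]
  obtain v where v: "v \<in> vertices G" using assms by (auto simp: core_def)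
  have deg1: "card (nbhd G x) = 1" and c3: "card (vertices G) = 3" if "x \<in> vertices G" for x
    using coreD(3,4)[OF assms that] n by (auto simp: degree_eq_card_nbhd[OF g])
  obtain w where w: "nbhd G v = {w}" using deg1[OF v] card_1_singletonE by blast
  then have vw: "adj G v w" "w \<in> vertices G" "v \<noteq> w" using adjD[OF g] by blast+
  have "\<not> vertices G \<subseteq> {v, w}"
    using c3[OF v] card_mono[of "{v, w}" "vertices G"] by (auto simp: card_insert_if split: if_splits)
  then obtain z where z: "z \<in> vertices G" "z \<noteq> v" "z \<noteq> w" by blast
  then have V: "vertices G = {v, w, z}"
    using c3[OF v] v vw g by (intro card_seteq[symmetric]) auto
  obtain y where y: "nbhd G z = {y}" using deg1[OF z(1)] card_1_singletonE by blast
  then have zy: "adj G z y" by blast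
  then have "y \<in> {v, w}" using V adjD[OF g] by blast
  moreover obtain v' where v': "nbhd G w = {v'}" using deg1[OF vw(2)] card_1_singletonE by blast
  ultimately consider "adj G v z" | "adj G w z" "adj G w v"
    using zy vw(1) adj_sym[of G z y] adj_sym[of G v w] by auto
  then show False
  proof cases
    case 1
    then have "z \<in> {w}" using w by auto
    then show False using z by simp
  next
    case 2
    then have "z \<in> {v'}" "v \<in> {v'}" using v' by auto
    then show False using z by simp
  qed
qed

lemma finite_tops_leaves [simp]: "graph G \<Longrightarrow> finite (tops G)" "graph G \<Longrightarrow> finite (leaves G)"
  by (simp_all add: tops_def leaves_def)

lemma card_tops: "graph G \<Longrightarrow> card (tops G) = length (filter (\<lambda>x. x = card (vertices G) - 2) (degree_list G))"
  by (simp add: tops_def card_degree_eq)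

lemma card_leaves: "graph G \<Longrightarrow> card (leaves G) = length (filter (\<lambda>x. x = 1) (degree_list G))"
  by (simp add: leaves_def card_degree_eq)

lemma sum_min_2:
  "\<forall>x\<in>set r. 1 \<le> x \<Longrightarrow>
    (\<Sum>x\<leftarrow>r. int (min (Suc (Suc 0)) x)) = 2 * int (length r) - int (length (filter (\<lambda>x. x = 1) r))"
  by (induction r) auto

lemma sum_min_1:
  "\<forall>x\<in>set r. 1 \<le> x \<Longrightarrow> (\<Sum>x\<leftarrow>r. int (min (Suc 0) x)) = int (length r)"
  by (induction r) auto

text \<open>Here the slack inequalities constrain the structure. For \<open>k = 1\<close>
  the inequality says that the largest degree is at least \<open>n - 2\<close>; for \<open>k = 2\<close> it then says that the number of
  leaves plus the second largest degree is at least \<open>n - 1\<close>. In a core no degree exceeds \<open>n - 2\<close>.\<close>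

lemma core_tops_leaves:
  assumes "core G"
  shows "card (tops G) \<ge> 1" "card (leaves G) \<ge> 1" "card (tops G) \<ge> 2 \<or> card (leaves G) \<ge> 2"
proof -
  note g = coreD(2)[OF assms]
  let ?d = "degree_list G" and ?n = "card (vertices G)"
  have "length ?d \<ge> 4" using core_card[OF assms] by simp
  then obtain x y r where d: "?d = x # y # r"
    by (cases ?d; cases "tl ?d") auto
  have n: "?n = length r + 2" using arg_cong[OF d, of length] by simp
  have b: "1 \<le> z \<and> z + 2 \<le> ?n" if "z \<in> set ?d" for z
    using that coreD(3,4)[OF assms] g by auto
  have ss: "small_slack ?d" using coreD(1)[OF assms] by (simp add: wt_def)
  have bx: "1 \<le> x" "1 \<le> y" "x \<le> length r" "y \<le> length r" "\<forall>z\<in>set r. 1 \<le> z"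
    using b n unfolding d by auto
  \<comment> \<open>All terms are positive, so the slack at 1 is \<open>n - 1 - x\<close>.\<close>
  have "slack (Suc 0) ?d \<le> 1"
    using ss core_card[OF assms] unfolding small_slack_def length_degree_list by (metis le0 less_le_trans zero_less_numeral)
  then have x: "x = length r"
    using bx sum_min_1[of r] unfolding d by (simp add: slack_def)
  have "slack (Suc (Suc 0)) ?d \<le> 1"
    using ss d bx(2) unfolding small_slack_def by (auto dest: spec[of _ "Suc 0"])
  then have "length r \<le> length (filter (\<lambda>x. x = 1) r) + y - 1"
    using bx sum_min_2[of r] x unfolding d by (simp add: slack_def)
  moreover have "card (tops G) = (if y = length r then 2 else 1) + length (filter (\<lambda>x. x = length r) r)"
    using x by (simp add: card_tops[OF g] n) (simp add: d)
  moreover have "card (leaves G) \<ge> length (filter (\<lambda>x. x = 1) r)"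
    by (simp add: card_leaves[OF g] d)
  ultimately show "card (tops G) \<ge> 1" "card (leaves G) \<ge> 1" "card (tops G) \<ge> 2 \<or> card (leaves G) \<ge> 2"
    using bx by (auto split: if_splits)
qed

section \<open>Decomposing weakly threshold graphs\<close>

lemma leaf_nbhd:
  assumes "graph G" "l \<in> leaves G"
  obtains w where "nbhd G l = {w}"
  using assms card_1_singletonE[of "nbhd G l"] by (auto simp: leaves_def degree_eq_card_nbhd)

lemma top_nonnbhd:
  assumes "core G" "u \<in> tops G"
  obtains s where "s \<in> vertices G" "s \<noteq> u" "\<not> adj G u s"
    "\<And>x. x \<in> vertices G \<Longrightarrow> x \<noteq> u \<Longrightarrow> x \<noteq> s \<Longrightarrow> adj G u x"
proof -
  note g = coreD(2)[OF assms(1)]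
  have "card (vertices G - {u} - nbhd G u) = card (vertices G - {u}) - card (nbhd G u)"
    using g nbhd_subset[OF g] by (intro card_Diff_subset) auto
  also have "\<dots> = 1"
    using assms(2) core_card[OF assms(1)] g by (simp add: tops_def flip: degree_eq_card_nbhd)
  finally obtain s where s: "vertices G - {u} - nbhd G u = {s}" by (rule card_1_singletonE)
  then show ?thesis by (intro that[of s]) blast+
qed

lemma core_tops_leaves_disjoint: "core G \<Longrightarrow> tops G \<inter> leaves G = {}"
  using core_card[of G] by (auto simp: tops_def leaves_def)

lemma core_iff:
  "core G \<longleftrightarrow> wt G \<and> vertices G \<noteq> {} \<and>
    (\<forall>v\<in>vertices G. vertex_degree G v \<noteq> 0 \<and> vertex_degree G v \<noteq> card (vertices G) - 1)"
proof -
  have "vertex_degree G v + 2 \<le> card (vertices G) \<longleftrightarrow> vertex_degree G v \<noteq> card (vertices G) - 1"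
    if "wt G" "v \<in> vertices G" for v
    using degree_less_card[OF wt_graph[OF that(1)] that(2)] by linarith
  then show ?thesis unfolding core_def by (metis One_nat_def Suc_leI le_zero_eq neq0_conv not_one_le_zero)
qed

lemma wt_cases:
  assumes "wt G" "vertices G \<noteq> {}"
  obtains (isolated) H v where "wt H" "v \<notin> vertices H" "G = add H v {}"
    | (dominating) H v where "wt H" "v \<notin> vertices H" "G = add H v (vertices H)"
    | (core) "core G"
proof (cases "core G")
  case False
  note g = wt_graph[OF assms(1)]
  obtain v where v: "v \<in> vertices G" "vertex_degree G v = 0 \<or> vertex_degree G v = card (vertices G) - 1"
    using False assms by (auto simp: core_iff)
  define H where "H = del G v"
  have H: "graph H" "v \<notin> vertices H" using g by (auto simp: H_def)
  have G: "G = add H v (nbhd G v)" using add_del[OF g v(1)] by (simp add: H_def)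
  have sub: "nbhd G v \<subseteq> vertices H" using nbhd_subset[OF g] by (simp add: H_def)
  from v(2) show ?thesis
  proof
    assume "vertex_degree G v = 0"
    then have "nbhd G v = {}" using g by (simp add: degree_eq_card_nbhd)
    then show ?thesis using isolated[of H v] H G wt_add_isolated(2)[OF H] assms(1) by metis
  next
    assume "vertex_degree G v = card (vertices G) - 1"
    then have "card (nbhd G v) = card (vertices H)" using g v by (simp add: degree_eq_card_nbhd H_def)
    then have "nbhd G v = vertices H" using sub H(1) by (simp add: card_subset_eq)
    then show ?thesis using dominating[of H v] H G wt_add_dominating(2)[OF H] assms(1) by metis
  qed
qed (use that in simp)

text \<open>After a leaf has been attached to a top \<open>u\<close>, every other vertex misses one vertex more than
  before, so \<open>u\<close> is the only top left.\<close>

lemma core_add_leaf: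
  assumes "core H" "u \<in> tops H" "v \<notin> vertices H"
  shows "core (add H v {u})" "tops (add H v {u}) = {u}" "leaves (add H v {u}) = insert v (leaves H)"
proof -
  note h = coreD(2)[OF assms(1)]
  have n: "card (vertices H) \<ge> 4" using core_card assms(1) .
  have u: "u \<in> vertices H" "vertex_degree H u = card (vertices H) - 2" using assms(2) by (auto simp: tops_def)
  have dv: "vertex_degree (add H v {u}) v = 1" using degree_add(1)[OF h assms(3)] u by simp
  have dx: "vertex_degree (add H v {u}) x = vertex_degree H x + of_bool (x = u)" if "x \<in> vertices H" for x
    using degree_add(2)[OF h assms(3), of "{u}" x] u that by simp
  have c: "card (vertices (add H v {u})) = Suc (card (vertices H))" using assms(3) h by simp
  have b: "1 \<le> vertex_degree H x \<and> vertex_degree H x + 2 \<le> card (vertices H)" if "x \<in> vertices H" for x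
    using coreD(3,4)[OF assms(1) that] by simp
  have "wt (add H v {u})"
  proof (subst wt_add_leaf(3)[OF h assms(3) u(1)])
    show "1 \<le> vertex_degree H x \<and> vertex_degree H x \<le> vertex_degree H u" if "x \<in> vertices H" for x
      using b[OF that] u(2) by linarith
  qed (use n coreD(1)[OF assms(1)] in auto)
  then show "core (add H v {u})"
    unfolding core_def c
  proof (intro conjI ballI)
    fix x assume "x \<in> vertices (add H v {u})"
    then have "x = v \<or> x \<in> vertices H" by simp
    then show "1 \<le> vertex_degree (add H v {u}) x"
      "vertex_degree (add H v {u}) x + 2 \<le> Suc (card (vertices H))"
      using dv dx[of x] b[of x] n by (auto simp: of_bool_def)
  qed auto
  have "vertex_degree (add H v {u}) x = Suc (card (vertices H)) - 2 \<longleftrightarrow> x = u" if "x \<in> insert v (vertices H)" for x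
    using that dv dx[of x] b[of x] n u by (cases "x = v") (auto simp: of_bool_def)
  then show "tops (add H v {u}) = {u}" unfolding tops_def c using u(1) by auto
  have "vertex_degree (add H v {u}) x = 1 \<longleftrightarrow> vertex_degree H x = 1" if "x \<in> vertices H" for x
    using that dx[of x] n u by auto
  then show "leaves (add H v {u}) = insert v (leaves H)" unfolding leaves_def using dv by auto
qed

lemma core_imp_wt_add_cotop:
  assumes "core H" "p \<in> leaves H" "v \<notin> vertices H"
  shows "wt (add H v (vertices H - {p}))"
proof -
  have "card (vertices H) \<ge> 4" using core_card assms(1) .
  then show ?thesis
    using assms coreD[OF assms(1)] wt_add_cotop[of H v p] by (auto simp: leaves_def)
qed

lemma core_p4_join:
  assumes "wt H" "fresh4 H a b c d"
  shows "core (p4_join H a b c d)" "tops (p4_join H a b c d) = {b, c}" "leaves (p4_join H a b c d) = {a, d}"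
    "card (vertices (p4_join H a b c d)) = card (vertices H) + 4"
proof -
  note h = wt_graph[OF assms(1)]
  note deg = degree_p4_join[OF h assms(2)]
  have f: "a \<noteq> b" "a \<noteq> c" "a \<noteq> d" "b \<noteq> c" "b \<noteq> d" "c \<noteq> d"
    "a \<notin> vertices H" "b \<notin> vertices H" "c \<notin> vertices H" "d \<notin> vertices H"
    using assms(2) by (auto simp: fresh4_def)
  show c: "card (vertices (p4_join H a b c d)) = card (vertices H) + 4"
    using f h by simp
  have b: "vertex_degree H x < card (vertices H)" if "x \<in> vertices H" for x
    using degree_less_card[OF h that] .
  show "core (p4_join H a b c d)"
    unfolding core_def c
  proof (intro conjI ballI)
    fix x assume "x \<in> vertices (p4_join H a b c d)"
    then consider "x \<in> {a, b, c, d}" | "x \<in> vertices H" by auto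
    then have "1 \<le> vertex_degree (p4_join H a b c d) x \<and>
        vertex_degree (p4_join H a b c d) x + 2 \<le> card (vertices H) + 4"
    proof cases
      case 1
      then show ?thesis using deg by (elim insertE emptyE) simp_all
    next
      case 2
      then show ?thesis using deg(5)[of x] b[of x] by simp
    qed
    then show "1 \<le> vertex_degree (p4_join H a b c d) x"
      "vertex_degree (p4_join H a b c d) x + 2 \<le> card (vertices H) + 4" by simp_all
  qed (use wt_p4_join(2)[OF h assms(2)] assms(1) in auto)
  have "vertex_degree (p4_join H a b c d) x = card (vertices H) + 2 \<longleftrightarrow> x \<in> {b, c}"
    "vertex_degree (p4_join H a b c d) x = 1 \<longleftrightarrow> x \<in> {a, d}"
    if x: "x \<in> {a, b, c, d} \<union> vertices H" for x
  proof -
    consider "x = a" | "x = b" | "x = c" | "x = d" | "x \<in> vertices H" "x \<notin> {a, b, c, d}"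
      using x by blast
    then have "(vertex_degree (p4_join H a b c d) x = card (vertices H) + 2 \<longleftrightarrow> x \<in> {b, c}) \<and>
        (vertex_degree (p4_join H a b c d) x = 1 \<longleftrightarrow> x \<in> {a, d})"
    proof cases
      case 5
      then show ?thesis using deg(5)[of x] b[of x] by simp
    qed (use deg f in auto)
    then show "vertex_degree (p4_join H a b c d) x = card (vertices H) + 2 \<longleftrightarrow> x \<in> {b, c}"
      "vertex_degree (p4_join H a b c d) x = 1 \<longleftrightarrow> x \<in> {a, d}" by simp_all
  qed
  then show "tops (p4_join H a b c d) = {b, c}" "leaves (p4_join H a b c d) = {a, d}"
    unfolding tops_def leaves_def c by auto
qed

text \<open>A single top misses just one of the at least two leaves, so some leaf hangs on the top. Removing
  that leaf leaves a core, because no other vertex had degree \<open>n - 2\<close>.\<close>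

lemma one_top_decomp:
  assumes "core G" "card (tops G) = 1"
  obtains H v u where "core H" "v \<notin> vertices H" "u \<in> tops H" "G = add H v {u}"
proof -
  note g = coreD(2)[OF assms(1)]
  have n: "card (vertices G) \<ge> 4" using core_card assms(1) .
  obtain u where u: "tops G = {u}" using assms(2) card_1_singletonE by blast
  then have uV: "u \<in> vertices G" "vertex_degree G u = card (vertices G) - 2" by (auto simp: tops_def)
  obtain s where s: "\<And>x. x \<in> vertices G \<Longrightarrow> x \<noteq> u \<Longrightarrow> x \<noteq> s \<Longrightarrow> adj G u x"
    using top_nonnbhd[OF assms(1), of u] u by (metis singletonI)
  have "card (leaves G) \<ge> 2" using core_tops_leaves(3)[OF assms(1)] assms(2) by simp
  then have "\<not> leaves G \<subseteq> {s}" using card_mono[of "{s}" "leaves G"] by auto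
  then obtain v where v: "v \<in> leaves G" "v \<noteq> s" by blast
  have vV: "v \<in> vertices G" using v by (simp add: leaves_def)
  have "v \<noteq> u" using v u core_tops_leaves_disjoint[OF assms(1)] by auto
  then have "adj G v u" using s[OF vV] v adj_sym[of G v u] by simp
  moreover obtain w where "nbhd G v = {w}" using leaf_nbhd[OF g v(1)] .
  ultimately have nv: "nbhd G v = {u}" by auto
  define H where "H = del G v"
  have H: "graph H" "v \<notin> vertices H" "vertices H = vertices G - {v}" using g by (auto simp: H_def)
  have G: "G = add H v {u}" using add_del[OF g vV] nv by (simp add: H_def)
  have uH: "u \<in> vertices H" using H(3) uV \<open>v \<noteq> u\<close> by simp
  have c: "card (vertices H) = card (vertices G) - 1" using H(3) vV g by simp
  have dG: "vertex_degree G x = vertex_degree H x + of_bool (x = u)" if "x \<in> vertices H" for x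
    using degree_add(2)[OF H(1,2), of "{u}" x] uH that G by simp
  have du: "vertex_degree H u = card (vertices H) - 2" using dG[OF uH] uV c by simp
  have bx: "1 \<le> vertex_degree H x \<and> vertex_degree H x + 2 \<le> card (vertices H)" if x: "x \<in> vertices H" for x
  proof (cases "x = u")
    case True
    show ?thesis using du c n unfolding True by linarith
  next
    case False
    then have "x \<in> vertices G" "x \<notin> tops G" using x H(3) u by auto
    then show ?thesis using dG[OF x] False coreD(3,4)[OF assms(1), of x] c by (simp add: tops_def)
  qed
  have "wt H"
  proof (subst wt_add_leaf(3)[OF H(1,2) uH, symmetric])
    show "1 \<le> vertex_degree H x \<and> vertex_degree H x \<le> vertex_degree H u" if "x \<in> vertices H" for x
      using bx[OF that] du by linarith
  qed (use n c coreD(1)[OF assms(1)] G in auto)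
  then have "core H" using bx uH by (auto simp: core_def)
  moreover have "u \<in> tops H" using uH du by (simp add: tops_def)
  ultimately show ?thesis using that H(2) G by blast
qed

text \<open>Among at least two tops, one is not the neighbour of the only leaf. That top misses the
  leaf and nothing else, and removing it leaves a core, because all other vertices have degree at least two.\<close>

lemma one_leaf_decomp:
  assumes "core G" "card (leaves G) = 1"
  obtains H v p where "core H" "v \<notin> vertices H" "p \<in> leaves H" "G = add H v (vertices H - {p})"
proof -
  note g = coreD(2)[OF assms(1)]
  have n: "card (vertices G) \<ge> 4" using core_card assms(1) .
  obtain p where p: "leaves G = {p}" using assms(2) card_1_singletonE by blast
  then have pV: "p \<in> vertices G" "vertex_degree G p = 1" by (auto simp: leaves_def)
  obtain w where w: "nbhd G p = {w}" using leaf_nbhd[OF g, of p] p by auto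
  have "card (tops G) \<ge> 2" using core_tops_leaves(3)[OF assms(1)] assms(2) by simp
  then have "\<not> tops G \<subseteq> {w}" using card_mono[of "{w}" "tops G"] by auto
  then obtain v where v: "v \<in> tops G" "v \<noteq> w" by blast
  have vV: "v \<in> vertices G" using v by (simp add: tops_def)
  have vp: "v \<noteq> p" using v p core_tops_leaves_disjoint[OF assms(1)] by auto
  have npv: "\<not> adj G v p" using w v(2) adj_sym[of G v p] by auto
  obtain s where s: "\<not> adj G v s" "\<And>x. x \<in> vertices G \<Longrightarrow> x \<noteq> v \<Longrightarrow> x \<noteq> s \<Longrightarrow> adj G v x"
    using top_nonnbhd[OF assms(1) v(1)] by auto
  then have "s = p" using npv vp pV by blast
  define H where "H = del G v"
  have H: "graph H" "v \<notin> vertices H" "vertices H = vertices G - {v}" using g by (auto simp: H_def)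
  have "nbhd G v = vertices H - {p}"
    using s \<open>s = p\<close> nbhd_subset[OF g, of v] H(3) by auto
  then have G: "G = add H v (vertices H - {p})" using add_del[OF g vV] by (simp add: H_def)
  have pH: "p \<in> vertices H" using H(3) pV vp by simp
  have c: "card (vertices H) = card (vertices G) - 1" using H(3) vV g by simp
  have dG: "vertex_degree G x = vertex_degree H x + of_bool (x \<noteq> p)" if "x \<in> vertices H" for x
    using degree_add(2)[OF H(1,2), of "vertices H - {p}" x] that G by simp
  have dp: "vertex_degree H p = 1" using dG[OF pH] pV by simp
  have bx: "1 \<le> vertex_degree H x \<and> vertex_degree H x + 2 \<le> card (vertices H)" if x: "x \<in> vertices H" for x
  proof (cases "x = p")
    case True
    then show ?thesis using dp c n by simp
  next
    case False
    then have "x \<in> vertices G" "x \<notin> leaves G" using x H(3) p by auto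
    then show ?thesis using dG[OF x] False coreD(3,4)[OF assms(1), of x] c by (simp add: leaves_def)
  qed
  have "wt H"
    using wt_add_cotop[OF H(1,2) pH _ dp bx] n c coreD(1)[OF assms(1)] G by auto
  then have "core H" using bx pH by (auto simp: core_def)
  moreover have "p \<in> leaves H" using pH dp by (simp add: leaves_def)
  ultimately show ?thesis using that H(2) G by blast
qed

text \<open>Two tops miss only one vertex each, while every leaf is missed by one of them. So two tops and two
  leaves match up: each of the two tops misses exactly one of the two leaves and is adjacent to everything else.\<close>

lemma p4_join_decomp:
  assumes "core G" "card (tops G) \<ge> 2" "card (leaves G) \<ge> 2"
  obtains H a b c d where "wt H" "fresh4 H a b c d" "G = p4_join H a b c d"
proof -
  note g = coreD(2)[OF assms(1)]
  obtain b c where bc: "b \<in> tops G" "c \<in> tops G" "b \<noteq> c"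
    using assms(2) by (metis card_le_Suc0_iff_eq finite_tops_leaves(1) g not_less_eq_eq numeral_2_eq_2)
  have bcV: "b \<in> vertices G" "c \<in> vertices G" using bc by (auto simp: tops_def)
  obtain p q where pq: "p \<in> leaves G" "q \<in> leaves G" "p \<noteq> q"
    using assms(3) by (metis card_le_Suc0_iff_eq finite_tops_leaves(2) g not_less_eq_eq numeral_2_eq_2)
  obtain d where d: "d \<in> vertices G" "d \<noteq> b" "\<not> adj G b d"
      "\<And>x. x \<in> vertices G \<Longrightarrow> x \<noteq> b \<Longrightarrow> x \<noteq> d \<Longrightarrow> adj G b x"
    using top_nonnbhd[OF assms(1) bc(1)] by metis
  obtain a where a: "a \<in> vertices G" "a \<noteq> c" "\<not> adj G c a"
      "\<And>x. x \<in> vertices G \<Longrightarrow> x \<noteq> c \<Longrightarrow> x \<noteq> a \<Longrightarrow> adj G c x"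
    using top_nonnbhd[OF assms(1) bc(2)] by metis
  have ad: "l = a \<or> l = d" if l: "l \<in> leaves G" for l
  proof (rule ccontr)
    assume "\<not> (l = a \<or> l = d)"
    moreover have "l \<in> vertices G" "l \<noteq> b" "l \<noteq> c"
      using l bc core_tops_leaves_disjoint[OF assms(1)] by (auto simp: leaves_def)
    ultimately have "adj G l b" "adj G l c"
      using a(4)[of l] d(4)[of l] adj_sym[of G l b] adj_sym[of G l c] by auto
    moreover obtain w where w: "nbhd G l = {w}" using leaf_nbhd[OF g l] .
    ultimately have "b \<in> {w}" "c \<in> {w}" unfolding w[symmetric] by simp_all
    then show False using bc(3) by simp
  qed
  then have l: "a \<in> leaves G" "d \<in> leaves G" "a \<noteq> d" using pq by metis+
  have ne: "a \<noteq> b" "d \<noteq> c" using l bc core_tops_leaves_disjoint[OF assms(1)] by auto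
  have ab: "adj G a b" using d(4)[OF a(1)] ne l(3) adj_sym[of G a b] by simp
  have dc: "adj G d c" using a(4)[OF d(1)] ne l(3) adj_sym[of G d c] by simp
  obtain w where "nbhd G a = {w}" using leaf_nbhd[OF g l(1)] .
  then have na: "adj G a x \<longleftrightarrow> x = b" for x using ab by (metis mem_Collect_eq singletonD)
  obtain w' where "nbhd G d = {w'}" using leaf_nbhd[OF g l(2)] .
  then have nd: "adj G d x \<longleftrightarrow> x = c" for x using dc by (metis mem_Collect_eq singletonD)
  have nb: "adj G b x \<longleftrightarrow> x \<in> vertices G \<and> x \<noteq> b \<and> x \<noteq> d" for x
    using d adjD[OF g, of b x] by metis
  have nc: "adj G c x \<longleftrightarrow> x \<in> vertices G \<and> x \<noteq> c \<and> x \<noteq> a" for x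
    using a adjD[OF g, of c x] by metis
  have rev: "adj G x a \<longleftrightarrow> x = b" "adj G x d \<longleftrightarrow> x = c"
    "adj G x b \<longleftrightarrow> x \<in> vertices G \<and> x \<noteq> b \<and> x \<noteq> d" "adj G x c \<longleftrightarrow> x \<in> vertices G \<and> x \<noteq> c \<and> x \<noteq> a" for x
    using na nb nc nd adj_sym[of G x] by metis+
  define H where "H = del (del (del (del G a) d) b) c"
  have H: "graph H" "vertices H = vertices G - {a, b, c, d}" 
    "\<And>x y. adj H x y \<longleftrightarrow> adj G x y \<and> x \<notin> {a, b, c, d} \<and> y \<notin> {a, b, c, d}"
    using g by (auto simp: H_def)
  have f: "fresh4 H a b c d" using H(2) ne l(3) a(2) d(2) bc(3) by (auto simp: fresh4_def)
  have "G = p4_join H a b c d"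
  proof (rule graph_eqI)
    show "vertices G = vertices (p4_join H a b c d)" using H(2) a(1) d(1) bcV by auto
    have ndist: "a \<noteq> b" "a \<noteq> c" "a \<noteq> d" "b \<noteq> c" "b \<noteq> d" "c \<noteq> d"
      "b \<noteq> a" "c \<noteq> a" "d \<noteq> a" "c \<noteq> b" "d \<noteq> b" "d \<noteq> c"
      using f by (auto simp: fresh4_def)
    fix x y
    show "adj G x y \<longleftrightarrow> adj (p4_join H a b c d) x y"
    proof (cases "x \<in> {a, b, c, d}")
      case True
      then show ?thesis
        by (elim insertE emptyE)
          (simp_all add: adj_p4_join H(2,3) doubleton_eq_iff ndist na nb nc nd, (use ndist a(1) d(1) bcV in auto)?)
    next
      case x: False
      show ?thesis
      proof (cases "y \<in> {a, b, c, d}")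
        case True
        then show ?thesis using x
          by (elim insertE emptyE)
            (simp_all add: adj_p4_join H(2,3) doubleton_eq_iff ndist rev)
      next
        case y: False
        show ?thesis using x y by (auto simp: adj_p4_join H doubleton_eq_iff)
      qed
    qed
  qed (use f H(1) g in auto)
  moreover have "wt H" using calculation coreD(1)[OF assms(1)] wt_p4_join(2)[OF H(1) f] by simp
  ultimately show ?thesis using that f by blast
qed

lemma core_compl:
  assumes "core G" "wt (compl G)"
  shows "core (compl G)" "tops (compl G) = leaves G" "leaves (compl G) = tops G"
proof -
  have d: "vertex_degree (compl G) v = card (vertices G) - 1 - vertex_degree G v"
    "1 \<le> vertex_degree G v" "vertex_degree G v + 2 \<le> card (vertices G)" if "v \<in> vertices G" for v
    using coreD(3,4)[OF assms(1) that] degree_compl[OF coreD(2)[OF assms(1)] that] by simp_all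
  show "core (compl G)"
    using assms d by (auto simp: core_def)
  show "tops (compl G) = leaves G" 
    unfolding tops_def leaves_def using d by fastforce
  show "leaves (compl G) = tops G"
    unfolding tops_def leaves_def using d by fastforce
qed

text \<open>The class is closed under complementation because its constructions come in complementary pairs:
  isolated and dominating vertices, leaves on a top and vertices missing a leaf, and the join with a path, which
  is complementary to itself. This lets every count for one leaf be read off from the count for one top.\<close>

lemma wt_compl: "wt G \<Longrightarrow> wt (compl G)"
proof (induction "card (vertices G)" arbitrary: G rule: less_induct)
  case less
  note g = wt_graph[OF less.prems]
  have card: "card (vertices H) < card (vertices G)" if "graph H" "v \<notin> vertices H" "G = add H v N" for H v N
    using that g by simp
  show ?case
  proof (cases "vertices G = {}")
    case True
    then have "compl G = G" using g by (intro graph_eqI) (auto dest: adjD)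
    then show ?thesis using less.prems by simp
  next
    case False
    from less.prems False show ?thesis
    proof (cases rule: wt_cases)
      case (isolated H v)
      then have "compl G = add (compl H) v (vertices (compl H))"
        using compl_add[of H v "{}"] by (simp add: wt_graph)
      then show ?thesis
        using isolated less.hyps[OF card] wt_add_dominating(2)[of "compl H" v] wt_graph[of H] by simp
    next
      case (dominating H v)
      then have "compl G = add (compl H) v {}"
        using compl_add[of H v "vertices H"] by (simp add: wt_graph)
      then show ?thesis
        using dominating less.hyps[OF card] wt_add_isolated(2)[of "compl H" v] wt_graph[of H] by simp
    next
      case core
      consider "card (tops G) = 1" | "card (leaves G) = 1" | "card (tops G) \<ge> 2" "card (leaves G) \<ge> 2"
        using core_tops_leaves[OF core] by linarith
      then show ?thesis
      proof cases
        case 1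
        then obtain H v u where H: "core H" "v \<notin> vertices H" "u \<in> tops H" "G = add H v {u}"
          using one_top_decomp[OF core] by blast
        then have "u \<in> vertices H" by (simp add: tops_def)
        then have G: "compl G = add (compl H) v (vertices (compl H) - {u})"
          using compl_add[of H v "{u}"] H coreD(2)[OF H(1)] by simp
        have "wt (compl H)" using less.hyps[OF card] H coreD by blast
        then show ?thesis
          using core_compl[OF H(1)] H core_imp_wt_add_cotop[of "compl H" u v] G by simp
      next
        case 2
        then obtain H v p where H: "core H" "v \<notin> vertices H" "p \<in> leaves H" "G = add H v (vertices H - {p})"
          using one_leaf_decomp[OF core] by blast
        then have "p \<in> vertices H" by (simp add: leaves_def)
        moreover from this have "vertices H - (vertices H - {p}) = {p}" by blast
        ultimately have G: "compl G = add (compl H) v {p}"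
          using compl_add[of H v "vertices H - {p}"] H coreD(2)[OF H(1)] by simp
        have "wt (compl H)" using less.hyps[OF card] H coreD by blast
        then show ?thesis
          using core_compl[OF H(1)] H core_add_leaf[of "compl H" p v] G coreD(1) by simp
      next
        case 3
        then obtain H a b c d where H: "wt H" "fresh4 H a b c d" "G = p4_join H a b c d"
          using p4_join_decomp[OF core] by blast
        note h = wt_graph[OF H(1)]
        have "wt (compl H)" using less.hyps[of H] core_p4_join(4)[OF H(1,2)] H by simp
        then show ?thesis
          using compl_p4_join[OF h H(2)] wt_p4_join(2)[of "compl H" b d a c] H(3) h by simp
      qed
    qed
  qed
qed

section \<open>Counting through correspondences\<close>

lemma card_image_cong_kernel:
  assumes "\<And>a b. a \<in> A \<Longrightarrow> b \<in> A \<Longrightarrow> f a = f b \<longleftrightarrow> g a = g b"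
  shows "card (f ` A) = card (g ` A)"
proof -
  have "bij_betw (\<lambda>c. g (inv_into A f c)) (f ` A) (g ` A)"
    unfolding bij_betw_def
  proof
    have inv: "inv_into A f c \<in> A \<and> f (inv_into A f c) = c" if "c \<in> f ` A" for c
      using that by (auto intro: inv_into_into f_inv_into_f)
    show "inj_on (\<lambda>c. g (inv_into A f c)) (f ` A)"
      by (rule inj_onI) (metis inv assms)
    have "g (inv_into A f (f a)) = g a" if "a \<in> A" for a
      using inv[of "f a"] assms that by blast
    then show "(\<lambda>c. g (inv_into A f c)) ` f ` A = g ` A" by (simp add: image_image)
  qed
  then show ?thesis by (rule bij_betw_same_card)
qed

text \<open>Counting values of an invariant through a relation in place of a bijection: objects related by
  \<open>T\<close> need to determine each other only up to the invariants.\<close>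

lemma card_image_correspondence:
  assumes "\<And>a. a \<in> A \<Longrightarrow> \<exists>b\<in>B. T a b"
    and "\<And>b. b \<in> B \<Longrightarrow> \<exists>a\<in>A. T a b"
    and "\<And>a b a' b'. a \<in> A \<Longrightarrow> b \<in> B \<Longrightarrow> a' \<in> A \<Longrightarrow> b' \<in> B \<Longrightarrow> T a b \<Longrightarrow> T a' b' \<Longrightarrow>
      f a = f a' \<longleftrightarrow> g b = g b'"
  shows "card (f ` A) = card (g ` B)"
proof -
  obtain t where t: "\<And>a. a \<in> A \<Longrightarrow> t a \<in> B \<and> T a (t a)" using assms(1) by metis
  have "card (f ` A) = card ((g \<circ> t) ` A)"
  proof (rule card_image_cong_kernel)
    fix a a' assume "a \<in> A" "a' \<in> A"
    then show "f a = f a' \<longleftrightarrow> (g \<circ> t) a = (g \<circ> t) a'"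
      using assms(3)[of a "t a" a' "t a'"] t by simp
  qed
  moreover have "(g \<circ> t) ` A = g ` B"
  proof (intro equalityI subsetI)
    fix y assume "y \<in> g ` B"
    then obtain b where b: "b \<in> B" "y = g b" by blast
    then obtain a where a: "a \<in> A" "T a b" using assms(2) by blast
    then have "g b = g (t a)" using assms(3)[of a b a "t a"] b t by simp
    then show "y \<in> (g \<circ> t) ` A" using a b by auto
  qed (use t in auto)
  ultimately show ?thesis by simp
qed

section \<open>Symmetries of cores\<close>

lemma iso_map_p4_join:
  assumes "graph H" "graph H'" "fresh4 H a b c d" "fresh4 H' a' b' c' d'" and h: "iso_map h H H'"
  shows "iso_map (h(c := c', b := b', d := d', a := a')) (p4_join H a b c d) (p4_join H' a' b' c' d')"
proof -
  have f: "a \<noteq> b" "a \<noteq> c" "a \<noteq> d" "b \<noteq> c" "b \<noteq> d" "c \<noteq> d"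
    "a \<notin> vertices H" "b \<notin> vertices H" "c \<notin> vertices H" "d \<notin> vertices H"
    and f': "a' \<noteq> b'" "a' \<noteq> c'" "a' \<noteq> d'" "b' \<noteq> c'" "b' \<noteq> d'" "c' \<noteq> d'"
    "a' \<notin> vertices H'" "b' \<notin> vertices H'" "c' \<notin> vertices H'" "d' \<notin> vertices H'"
    using assms(3,4) by (auto simp: fresh4_def)
  have im: "h ` vertices H = vertices H'" using iso_mapD(4)[OF h] .
  have cong: "(h(c := c')) ` vertices H = vertices H'" using im f by (auto simp: image_iff)
  define K1 where "K1 = add H c (vertices H)"
  define K2 where "K2 = add K1 b (insert c (vertices H))"
  define K3 where "K3 = add K2 d {c}"
  define L1 where "L1 = add H' c' (vertices H')"
  define L2 where "L2 = add L1 b' (insert c' (vertices H'))"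
  define L3 where "L3 = add L2 d' {c'}"
  have v: "vertices K1 = insert c (vertices H)" "vertices K2 = insert b (insert c (vertices H))"
    "vertices K3 = insert d (insert b (insert c (vertices H)))"
    "vertices L1 = insert c' (vertices H')" "vertices L2 = insert b' (insert c' (vertices H'))"
    "vertices L3 = insert d' (insert b' (insert c' (vertices H')))"
    by (simp_all add: K1_def K2_def K3_def L1_def L2_def L3_def)
  have g1: "graph K1" "graph L1" unfolding K1_def L1_def using assms f f' by simp_all
  have g2: "graph K2" "graph L2" unfolding K2_def L2_def using g1 f f' by (auto intro!: graph_add simp: v)
  have g3: "graph K3" "graph L3" unfolding K3_def L3_def using g2 f f' by (auto intro!: graph_add simp: v)
  have 1: "iso_map (h(c := c')) K1 L1"
    using iso_map_add[OF assms(1,2) f(9) f'(9) order_refl h] by (simp add: K1_def L1_def im)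
  have 2: "iso_map (h(c := c', b := b')) K2 L2"
    using iso_map_add[OF g1 _ _ _ 1, of b b' "insert c (vertices H)"] f f' cong
    by (simp add: K2_def L2_def v)
  have 3: "iso_map (h(c := c', b := b', d := d')) K3 L3"
    using iso_map_add[OF g2 _ _ _ 2, of d d' "{c}"] f f' by (simp add: K3_def L3_def v)
  have "iso_map (h(c := c', b := b', d := d', a := a')) (add K3 a {b}) (add L3 a' {b'})"
    using iso_map_add[OF g3 _ _ _ 3, of a a' "{b}"] f f' by (simp add: v)
  then show ?thesis by (simp add: p4_join_def K1_def K2_def K3_def L1_def L2_def L3_def)
qed

text \<open>Reversing the path is a symmetry; it exchanges the two tops.\<close>

lemma p4_join_reverse:
  assumes "graph H" "fresh4 H a b c d"
  shows "p4_join H d c b a = p4_join H a b c d" "fresh4 H d c b a"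
proof -
  show f: "fresh4 H d c b a" using assms(2) by (auto simp: fresh4_def)
  have e: "{x, y} = {d, c} \<longleftrightarrow> {x, y} = {c, d}" "{x, y} = {c, b} \<longleftrightarrow> {x, y} = {b, c}"
    "{x, y} = {b, a} \<longleftrightarrow> {x, y} = {a, b}" for x y by (simp_all add: insert_commute)
  show "p4_join H d c b a = p4_join H a b c d"
  proof (rule graph_eqI)
    fix x y
    show "adj (p4_join H d c b a) x y \<longleftrightarrow> adj (p4_join H a b c d) x y"
      unfolding adj_p4_join e by argo
  qed (use assms f in auto)
qed

lemma iso_map_card: "iso_map f G H \<Longrightarrow> card (vertices G) = card (vertices H)"
  unfolding iso_map_def using bij_betw_same_card by blast

lemma iso_map_tops_leaves:
  assumes "graph G" "graph H" "iso_map f G H"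
  shows "f ` tops G = tops H" "f ` leaves G = leaves H"
proof -
  have c: "card (vertices G) = card (vertices H)"
    using iso_map_card[OF assms(3)] .
  have d: "\<And>x. x \<in> vertices G \<Longrightarrow> vertex_degree H (f x) = vertex_degree G x"
    using iso_map_degree[OF assms] .
  show "f ` tops G = tops H" "f ` leaves G = leaves H"
    using d c unfolding iso_mapD(4)[OF assms(3), symmetric] tops_def leaves_def by auto
qed

text \<open>When a leaf is to be attached to a top of a core, the choice of the top matters only through
  whether that top is adjacent to a leaf. With one top there is no choice. With two tops and two leaves the
  reversal of the path exchanges the tops. With a single leaf, the tops not adjacent to it miss nothing else and
  are twins, while the leaf has only one neighbour.\<close>

lemma iso_map_to_top:
  assumes "core H" "core H'" "iso_map h H H'" "u \<in> tops H" "u' \<in> tops H'"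
    and status: "(\<exists>l\<in>leaves H. adj H u l) \<longleftrightarrow> (\<exists>l\<in>leaves H'. adj H' u' l)"
  obtains k where "iso_map k H H'" "k u = u'"
proof -
  note g = coreD(2)[OF assms(1)] coreD(2)[OF assms(2)]
  have t: "h u \<in> tops H'" using iso_map_tops_leaves(1)[OF g assms(3)] assms(4) by blast
  have "\<exists>k. iso_map k H' H' \<and> k (h u) = u'"
  proof (cases "h u = u'")
    case True
    then show ?thesis using iso_map_id[of H'] by (intro exI[of _ id]) simp
  next
    case ne: False
    have inV: "h u \<in> vertices H'" "u' \<in> vertices H'" using t assms(5) by (auto simp: tops_def)
    have "card {h u, u'} \<le> card (tops H')" using t assms(5) g by (intro card_mono) auto
    then have two: "card (tops H') \<ge> 2" using ne by simp
    show ?thesis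
    proof (cases "card (leaves H') \<ge> 2")
      case True
      obtain K a b c d where K: "wt K" "fresh4 K a b c d" "H' = p4_join K a b c d"
        using p4_join_decomp[OF assms(2) two True] .
      note k = wt_graph[OF K(1)]
      have f: "a \<noteq> b" "a \<noteq> c" "b \<noteq> c" "b \<noteq> d" "c \<noteq> d"
        using K(2) by (auto simp: fresh4_def)
      have auto: "iso_map (id(c := b, b := c, d := a, a := d)) H' H'"
        using iso_map_p4_join[OF k k K(2) p4_join_reverse(2)[OF k K(2)] iso_map_id]
          p4_join_reverse(1)[OF k K(2)] K(3) by simp
      have "h u \<in> {b, c}" "u' \<in> {b, c}" using t assms(5) core_p4_join(2)[OF K(1,2)] K(3) by auto
      then have "(id(c := b, b := c, d := a, a := d)) (h u) = u'" using ne f by auto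
      then show ?thesis using auto by blast
    next
      case False
      then have "card (leaves H') = 1" using core_tops_leaves(2)[OF assms(2)] by linarith
      then obtain l where l: "leaves H' = {l}" by (rule card_1_singletonE)
      have lV: "l \<in> vertices H'" using l by (auto simp: leaves_def)
      have "l \<notin> tops H'" using l core_tops_leaves_disjoint[OF assms(2)] by blast
      then have nl: "l \<noteq> h u" "l \<noteq> u'" using t assms(5) by auto
      obtain l0 where l0: "leaves H = {l0}" "h l0 = l"
        using iso_map_tops_leaves(2)[OF g assms(3)] l iso_mapD(3)[OF assms(3)]
        by (metis (no_types, lifting) assms(3) card_image card_1_singletonE image_insert image_empty
            inj_on_subset is_singletonI is_singleton_altdef iso_map_def bij_betw_def leaves_def
            mem_Collect_eq singleton_inject subsetI)
      have "u \<in> vertices H" "l0 \<in> vertices H" using assms(4) l0 by (auto simp: tops_def leaves_def)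
      then have st: "adj H' (h u) l \<longleftrightarrow> adj H' u' l"
        using status l l0 iso_mapD(2)[OF assms(3)] by auto
      obtain w where w: "nbhd H' l = {w}" using leaf_nbhd[of H' l] g l by blast
      have nadj: "\<not> adj H' (h u) l" "\<not> adj H' u' l"
        using st ne w adj_sym[of H' l] by (metis mem_Collect_eq singletonD)+
      have full: "adj H' x z" if "x \<in> tops H'" "\<not> adj H' x l" "l \<noteq> x" "z \<in> vertices H'" "z \<noteq> x" "z \<noteq> l" for x z
        using top_nonnbhd[OF assms(2) that(1)] that lV by metis
      have "iso_map (id(h u := u', u' := h u)) H' H'"
      proof (rule twin_swap[OF g(2) inV])
        fix z assume "z \<noteq> h u" "z \<noteq> u'"
        then show "adj H' (h u) z \<longleftrightarrow> adj H' u' z"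
          using full[OF t nadj(1) nl(1), of z] full[OF assms(5) nadj(2) nl(2), of z] nadj adjD[OF g(2)]
          by metis
      qed
      then show ?thesis using ne by (intro exI[of _ "id(h u := u', u' := h u)"]) auto
    qed
  qed
  then obtain k where "iso_map k H' H'" "k (h u) = u'" by blast
  then show ?thesis using that[of "k \<circ> h"] iso_map_comp[OF assms(3), of k H'] by simp
qed

text \<open>An isomorphism of the enlarged graphs need not match the added vertices. If the image of one is a
  twin of the other, swapping the twins repairs this.\<close>

lemma iso_map_del_twin:
  assumes "graph H" "graph H'" "v \<notin> vertices H" "v' \<notin> vertices H'"
    and "graph (add H v N)" "graph (add H' v' N')"
    and f: "iso_map f (add H v N) (add H' v' N')"
    and twin: "\<And>z. z \<noteq> f v \<Longrightarrow> z \<noteq> v' \<Longrightarrow> adj (add H' v' N') (f v) z \<longleftrightarrow> adj (add H' v' N') v' z"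
  obtains k where "iso_map k H H'"
proof -
  have "f v \<in> vertices (add H' v' N')" "v' \<in> vertices (add H' v' N')"
    using iso_mapD(1)[OF f] by auto
  then have "iso_map (id(f v := v', v' := f v)) (add H' v' N') (add H' v' N')"
    using assms twin by (intro twin_swap) auto
  then have "iso_map (id(f v := v', v' := f v) \<circ> f) (add H v N) (add H' v' N')"
    by (rule iso_map_comp[OF f])
  moreover have "(id(f v := v', v' := f v) \<circ> f) v = v'" by simp
  ultimately show ?thesis using iso_map_add_cancel[OF assms(1-4)] that by blast
qed

section \<open>Recursion common to sequences and isomorphism classes\<close>

definition wt_of_size :: "nat \<Rightarrow> nat ugraph set" where
  "wt_of_size n = {G. wt G \<and> card (vertices G) = n}"

definition one_top :: "nat \<Rightarrow> nat ugraph set" where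
  "one_top n = {G. core G \<and> card (vertices G) = n \<and> card (tops G) = 1}"

definition one_leaf :: "nat \<Rightarrow> nat ugraph set" where
  "one_leaf n = {G. core G \<and> card (vertices G) = n \<and> card (leaves G) = 1}"

definition p4_type :: "nat \<Rightarrow> nat ugraph set" where
  "p4_type n = {G. core G \<and> card (vertices G) = n \<and> 2 \<le> card (tops G) \<and> 2 \<le> card (leaves G)}"

definition with_isolated :: "nat \<Rightarrow> nat ugraph set" where
  "with_isolated n = {G \<in> wt_of_size n. 0 \<in> set (degree_list G)}"

definition with_dominating :: "nat \<Rightarrow> nat ugraph set" where
  "with_dominating n = {G \<in> wt_of_size n. n - 1 \<in> set (degree_list G)}"

lemma obtain_fresh:
  assumes "graph (H :: nat ugraph)" obtains v where "v \<notin> vertices H"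
  using assms infinite_UNIV_nat ex_new_if_finite graph_finite by blast

lemma obtain_fresh4:
  assumes "graph (H :: nat ugraph)" obtains a b c d where "fresh4 H a b c d"
proof -
  have "finite (vertices H)" using assms by simp
  then obtain m where m: "\<forall>x\<in>vertices H. x < m" using finite_nat_set_iff_bounded by blast
  have "fresh4 H m (m + 1) (m + 2) (m + 3)" using m by (auto simp: fresh4_def)
  then show ?thesis by (rule that)
qed

lemma core_types:
  "{G. core G \<and> card (vertices G) = n} = one_top n \<union> one_leaf n \<union> p4_type n"
  "one_top n \<inter> one_leaf n = {}"
  using core_tops_leaves by (fastforce simp: one_top_def one_leaf_def p4_type_def)+

lemma core_degree_bounds:
  assumes "core G" "card (vertices G) = n"
  shows "0 \<notin> set (degree_list G)" "n - 1 \<notin> set (degree_list G)"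
  using assms coreD(2)[OF assms(1)] by (auto simp: core_iff)

lemma wt_of_size_cases:
  "n \<ge> 1 \<Longrightarrow> wt_of_size n = with_isolated n \<union> with_dominating n \<union> (one_top n \<union> one_leaf n \<union> p4_type n)"
proof -
  assume "n \<ge> 1"
  then have "core G \<longleftrightarrow> wt G \<and> 0 \<notin> set (degree_list G) \<and> n - 1 \<notin> set (degree_list G)"
    if c: "card (vertices G) = n" for G :: "nat ugraph"
  proof (cases "wt G")
    case True
    have "vertices G \<noteq> {}" using c \<open>n \<ge> 1\<close> by auto
    then show ?thesis
      using True c unfolding core_iff set_degree_list[OF wt_graph[OF True]] image_iff by metis
  qed (simp add: core_iff)
  then show ?thesis
    unfolding core_types(1)[symmetric] by (auto simp: wt_of_size_def with_isolated_def with_dominating_def)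
qed

lemma isolated_not_dominating:
  assumes "graph G" "0 \<in> set (degree_list G)" "card (vertices G) \<ge> 2"
  shows "card (vertices G) - 1 \<notin> set (degree_list G)"
proof
  assume "card (vertices G) - 1 \<in> set (degree_list G)"
  then obtain u v where u: "u \<in> vertices G" "vertex_degree G u = card (vertices G) - 1"
    and v: "v \<in> vertices G" "vertex_degree G v = 0" using assms by auto
  have "nbhd G u = vertices G - {u}"
    using u nbhd_subset[OF assms(1), of u] assms(1) by (intro card_subset_eq) (auto simp: degree_eq_card_nbhd)
  moreover have "v \<noteq> u" using u v assms(3) by auto
  ultimately have "adj G v u" using v adj_sym[of G v u] by auto
  then show False using v assms(1) by (simp add: degree_eq_card_nbhd)
qed

lemma with_isolated_decomp:
  "G \<in> with_isolated (Suc n) \<longleftrightarrow> (\<exists>H\<in>wt_of_size n. \<exists>v. v \<notin> vertices H \<and> G = add H v {})"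
proof
  assume G: "G \<in> with_isolated (Suc n)"
  then have w: "wt G" "graph G" "card (vertices G) = Suc n"
    by (auto simp: with_isolated_def wt_of_size_def wt_graph)
  then obtain v where v: "v \<in> vertices G" "vertex_degree G v = 0" using G by (auto simp: with_isolated_def)
  then have "nbhd G v = {}" using w by (simp add: degree_eq_card_nbhd)
  then have e: "G = add (del G v) v {}" using add_del[OF w(2) v(1)] by simp
  moreover have "wt (del G v)" using wt_add_isolated(2)[of "del G v" v] w e by simp
  ultimately show "\<exists>H\<in>wt_of_size n. \<exists>v. v \<notin> vertices H \<and> G = add H v {}"
    using w v by (intro bexI[of _ "del G v"]) (auto simp: wt_of_size_def)
next
  assume "\<exists>H\<in>wt_of_size n. \<exists>v. v \<notin> vertices H \<and> G = add H v {}"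
  then obtain H v where H: "wt H" "card (vertices H) = n" "v \<notin> vertices H" "G = add H v {}"
    by (auto simp: wt_of_size_def)
  then show "G \<in> with_isolated (Suc n)"
    using wt_add_isolated[OF wt_graph[OF H(1)] H(3)] wt_graph[OF H(1)]
    by (simp add: with_isolated_def wt_of_size_def del: set_degree_list)
qed

lemma with_dominating_decomp:
  "G \<in> with_dominating (Suc n) \<longleftrightarrow> (\<exists>H\<in>wt_of_size n. \<exists>v. v \<notin> vertices H \<and> G = add H v (vertices H))"
proof
  assume G: "G \<in> with_dominating (Suc n)"
  then have w: "wt G" "graph G" "card (vertices G) = Suc n"
    by (auto simp: with_dominating_def wt_of_size_def wt_graph)
  then obtain v where v: "v \<in> vertices G" "vertex_degree G v = n" using G by (auto simp: with_dominating_def)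
  have "nbhd G v = vertices (del G v)"
    using v w nbhd_subset[of G v] by (intro card_subset_eq) (auto simp: degree_eq_card_nbhd)
  then have e: "G = add (del G v) v (vertices (del G v))" using add_del[OF w(2) v(1)] by simp
  moreover have "wt (del G v)" using wt_add_dominating(2)[of "del G v" v] w e by simp
  ultimately show "\<exists>H\<in>wt_of_size n. \<exists>v. v \<notin> vertices H \<and> G = add H v (vertices H)"
    using w v by (intro bexI[of _ "del G v"]) (auto simp: wt_of_size_def)
next
  assume "\<exists>H\<in>wt_of_size n. \<exists>v. v \<notin> vertices H \<and> G = add H v (vertices H)"
  then obtain H v where H: "wt H" "card (vertices H) = n" "v \<notin> vertices H" "G = add H v (vertices H)"
    by (auto simp: wt_of_size_def)
  then show "G \<in> with_dominating (Suc n)"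
    using wt_add_dominating[OF wt_graph[OF H(1)] H(3)] wt_graph[OF H(1)]
    by (simp add: with_dominating_def wt_of_size_def del: set_degree_list)
qed

lemma p4_type_decomp:
  "G \<in> p4_type (n + 4) \<longleftrightarrow> (\<exists>H\<in>wt_of_size n. \<exists>a b c d. fresh4 H a b c d \<and> G = p4_join H a b c d)"
proof
  assume "G \<in> p4_type (n + 4)"
  then have "core G" "2 \<le> card (tops G)" "2 \<le> card (leaves G)" "card (vertices G) = n + 4"
    by (auto simp: p4_type_def)
  moreover from this obtain H a b c d where H: "wt H" "fresh4 H a b c d" "G = p4_join H a b c d"
    using p4_join_decomp by blast
  ultimately have "H \<in> wt_of_size n" using core_p4_join(4)[OF H(1,2)] by (simp add: wt_of_size_def)
  then show "\<exists>H\<in>wt_of_size n. \<exists>a b c d. fresh4 H a b c d \<and> G = p4_join H a b c d"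
    using H by blast
next
  assume "\<exists>H\<in>wt_of_size n. \<exists>a b c d. fresh4 H a b c d \<and> G = p4_join H a b c d"
  then obtain H a b c d where H: "wt H" "card (vertices H) = n" "fresh4 H a b c d" "G = p4_join H a b c d"
    by (auto simp: wt_of_size_def)
  moreover have "card {a, d} = 2" "card {b, c} = 2" using H(3) by (auto simp: fresh4_def)
  ultimately show "G \<in> p4_type (n + 4)" using core_p4_join[OF H(1,3)] by (simp add: p4_type_def)
qed

lemma small_types_empty:
  "n < 4 \<Longrightarrow> one_top n = {}" "n < 4 \<Longrightarrow> one_leaf n = {}" "n < 4 \<Longrightarrow> p4_type n = {}"
  using core_card by (fastforce simp: one_top_def one_leaf_def p4_type_def)+

lemma wt_of_size_0: "wt_of_size 0 = {({}, {})}"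
proof -
  have "G = ({}, {})" if "wt G" "card (vertices G) = 0" for G :: "nat ugraph"
  proof (rule graph_eqI)
    have "vertices G = {}" using that wt_graph[OF that(1)] by simp
    then show "adj G x y = adj ({}, {}) x y" for x y
      using adjD[OF wt_graph[OF that(1)], of x y] by (auto simp: adj_def)
  qed (use that wt_graph[OF that(1)] in \<open>auto simp: graph_def\<close>)
  moreover have "wt ({}, {})"
    using length_degree_list[of "({}, {})"] by (simp add: wt_def graph_def small_slack_def)
  ultimately show ?thesis by (auto simp: wt_of_size_def)
qed

text \<open>Degree sequences and isomorphism classes are counted together, as numbers of values of an
  invariant \<open>\<kappa>\<close>. The assumptions hold for both; only the effect of attaching a leaf differs.\<close>

locale graph_invariant =
  fixes \<kappa> :: "nat ugraph \<Rightarrow> 'c"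
  assumes iso: "graph G \<Longrightarrow> graph H \<Longrightarrow> iso_map f G H \<Longrightarrow> \<kappa> G = \<kappa> H"
    and degree: "graph G \<Longrightarrow> graph H \<Longrightarrow> \<kappa> G = \<kappa> H \<Longrightarrow> degree_list G = degree_list H"
    and isolated: "graph H \<Longrightarrow> graph H' \<Longrightarrow> v \<notin> vertices H \<Longrightarrow> v' \<notin> vertices H' \<Longrightarrow>
      \<kappa> (add H v {}) = \<kappa> (add H' v' {}) \<longleftrightarrow> \<kappa> H = \<kappa> H'"
    and dominating: "graph H \<Longrightarrow> graph H' \<Longrightarrow> v \<notin> vertices H \<Longrightarrow> v' \<notin> vertices H' \<Longrightarrow>
      \<kappa> (add H v (vertices H)) = \<kappa> (add H' v' (vertices H')) \<longleftrightarrow> \<kappa> H = \<kappa> H'"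
    and p4_join: "wt H \<Longrightarrow> wt H' \<Longrightarrow> fresh4 H a b c d \<Longrightarrow> fresh4 H' a' b' c' d' \<Longrightarrow>
      \<kappa> (p4_join H a b c d) = \<kappa> (p4_join H' a' b' c' d') \<longleftrightarrow> \<kappa> H = \<kappa> H'"
    and compl: "graph G \<Longrightarrow> graph H \<Longrightarrow> \<kappa> G = \<kappa> H \<Longrightarrow> \<kappa> (compl G) = \<kappa> (compl H)"
begin

definition cnt :: "nat ugraph set \<Rightarrow> nat" where
  "cnt S = card (\<kappa> ` S)"

lemma finite_image:
  assumes "\<And>G. G \<in> S \<Longrightarrow> graph G \<and> card (vertices G) = n"
  shows "finite (\<kappa> ` S)"
proof (rule finite_subset)
  let ?F = "Pow {..<n} \<times> Pow (Pow {..<n})"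
  show "finite (\<kappa> ` ?F)" by simp
  show "\<kappa> ` S \<subseteq> \<kappa> ` ?F"
  proof
    fix c assume "c \<in> \<kappa> ` S"
    then obtain G where G: "G \<in> S" "c = \<kappa> G" by blast
    then have g: "graph G" "card (vertices G) = n" using assms by auto
    then obtain f where f: "bij_betw f (vertices G) {..<n}"
      using finite_same_card_bij[of "vertices G" "{..<n}"] by auto
    \<comment> \<open>Up to isomorphism the vertices are the first \<open>n\<close> numbers, which leaves finitely many graphs.\<close>
    define H where "H = ({..<n}, (\<lambda>e. f ` e) ` edges G)"
    have inj: "inj_on f (vertices G)" and im: "f ` vertices G = {..<n}" using f by (auto simp: bij_betw_def)
    have sub: "f ` e \<subseteq> {..<n}" "card (f ` e) = 2" if "e \<in> edges G" for e
      using g(1) that im inj_on_subset[OF inj, of e] by (auto simp: graph_def card_image)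
    then have "graph H" by (auto simp: graph_def H_def)
    moreover have "isomorphic G H" using f by (auto simp: isomorphic_def H_def)
    ultimately have "\<kappa> G = \<kappa> H" using iso isomorphic_iff g(1) by metis
    moreover have "H \<in> ?F" using sub(1) by (auto simp: H_def)
    ultimately show "c \<in> \<kappa> ` ?F" using G(2) by blast
  qed
qed

lemma cnt_Un:
  assumes "\<And>G. G \<in> S \<union> T \<Longrightarrow> graph G \<and> card (vertices G) = n"
    and "\<And>G H. G \<in> S \<Longrightarrow> H \<in> T \<Longrightarrow> \<kappa> G \<noteq> \<kappa> H"
  shows "cnt (S \<union> T) = cnt S + cnt T"
  unfolding cnt_def image_Un
proof (rule card_Un_disjoint)
  show "finite (\<kappa> ` S)" by (rule finite_image[of _ n]) (rule assms(1), simp)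
  show "finite (\<kappa> ` T)" by (rule finite_image[of _ n]) (rule assms(1), simp)
qed (use assms(2) in auto)

lemma same_value_tops_leaves:
  assumes "graph G" "graph H" "\<kappa> G = \<kappa> H"
  shows "card (vertices G) = card (vertices H)" "card (tops G) = card (tops H)" "card (leaves G) = card (leaves H)"
proof -
  have d: "degree_list G = degree_list H" using degree[OF assms] .
  show "card (vertices G) = card (vertices H)" using arg_cong[OF d, of length] by simp
  then show "card (tops G) = card (tops H)" "card (leaves G) = card (leaves H)"
    using d assms(1,2) by (simp_all add: card_tops card_leaves)
qed

lemma cnt_isolated: "cnt (with_isolated (Suc n)) = cnt (wt_of_size n)"
  unfolding cnt_def
proof (rule card_image_correspondence[where T = "\<lambda>G H. \<exists>v. v \<notin> vertices H \<and> G = add H v {}"])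
  show "\<exists>H\<in>wt_of_size n. \<exists>v. v \<notin> vertices H \<and> G = add H v {}" if "G \<in> with_isolated (Suc n)" for G
    using that with_isolated_decomp by simp
  show "\<exists>G\<in>with_isolated (Suc n). \<exists>v. v \<notin> vertices H \<and> G = add H v {}" if H: "H \<in> wt_of_size n" for H
  proof -
    have "graph H" using H by (simp add: wt_of_size_def wt_graph)
    then obtain v where "v \<notin> vertices H" by (rule obtain_fresh)
    then show ?thesis using H with_isolated_decomp by blast
  qed
  fix G H G' H'
  assume "H \<in> wt_of_size n" "H' \<in> wt_of_size n"
  then have g: "graph H" "graph H'" by (simp_all add: wt_of_size_def wt_graph)
  assume "\<exists>v. v \<notin> vertices H \<and> G = add H v {}" "\<exists>v. v \<notin> vertices H' \<and> G' = add H' v {}"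
  then show "\<kappa> G = \<kappa> G' \<longleftrightarrow> \<kappa> H = \<kappa> H'" using isolated[OF g] by blast
qed

lemma cnt_dominating: "cnt (with_dominating (Suc n)) = cnt (wt_of_size n)"
  unfolding cnt_def
proof (rule card_image_correspondence[where T = "\<lambda>G H. \<exists>v. v \<notin> vertices H \<and> G = add H v (vertices H)"])
  show "\<exists>H\<in>wt_of_size n. \<exists>v. v \<notin> vertices H \<and> G = add H v (vertices H)" if "G \<in> with_dominating (Suc n)" for G
    using that with_dominating_decomp by simp
  show "\<exists>G\<in>with_dominating (Suc n). \<exists>v. v \<notin> vertices H \<and> G = add H v (vertices H)" if H: "H \<in> wt_of_size n" for H
  proof -
    have "graph H" using H by (simp add: wt_of_size_def wt_graph)
    then obtain v where "v \<notin> vertices H" by (rule obtain_fresh)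
    then show ?thesis using H with_dominating_decomp by blast
  qed
  fix G H G' H'
  assume "H \<in> wt_of_size n" "H' \<in> wt_of_size n"
  then have g: "graph H" "graph H'" by (simp_all add: wt_of_size_def wt_graph)
  assume "\<exists>v. v \<notin> vertices H \<and> G = add H v (vertices H)"
    "\<exists>v. v \<notin> vertices H' \<and> G' = add H' v (vertices H')"
  then show "\<kappa> G = \<kappa> G' \<longleftrightarrow> \<kappa> H = \<kappa> H'" using dominating[OF g] by blast
qed

text \<open>For \<open>n = 4\<close> the smaller graph is empty.\<close>

lemma cnt_p4_type: "cnt (p4_type n) = (if n < 4 then 0 else cnt (wt_of_size (n - 4)))"
proof (cases "n < 4")
  case False
  then obtain m where m: "n = m + 4" by (metis add.commute le_Suc_ex not_less)
  have "cnt (p4_type (m + 4)) = cnt (wt_of_size m)"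
    unfolding cnt_def
  proof (rule card_image_correspondence[where T = "\<lambda>G H. \<exists>a b c d. fresh4 H a b c d \<and> G = p4_join H a b c d"])
    show "\<exists>H\<in>wt_of_size m. \<exists>a b c d. fresh4 H a b c d \<and> G = p4_join H a b c d" if "G \<in> p4_type (m + 4)" for G
      using that p4_type_decomp by simp
    show "\<exists>G\<in>p4_type (m + 4). \<exists>a b c d. fresh4 H a b c d \<and> G = p4_join H a b c d"
      if H: "H \<in> wt_of_size m" for H
    proof -
      have "graph H" using H by (simp add: wt_of_size_def wt_graph)
      then obtain a b c d where "fresh4 H a b c d" by (rule obtain_fresh4)
      then show ?thesis using H p4_type_decomp by blast
    qed
    fix G H G' H'
    assume "H \<in> wt_of_size m" "H' \<in> wt_of_size m"
    then have w: "wt H" "wt H'" by (simp_all add: wt_of_size_def)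
    assume "\<exists>a b c d. fresh4 H a b c d \<and> G = p4_join H a b c d"
      "\<exists>a b c d. fresh4 H' a b c d \<and> G' = p4_join H' a b c d"
    then show "\<kappa> G = \<kappa> G' \<longleftrightarrow> \<kappa> H = \<kappa> H'"
      using p4_join[OF w] by blast
  qed
  then show ?thesis using m by simp
qed (simp add: small_types_empty cnt_def)

lemma cnt_compl:
  assumes "\<And>G. G \<in> S \<Longrightarrow> graph G \<and> compl G \<in> S'" "\<And>G. G \<in> S' \<Longrightarrow> graph G \<and> compl G \<in> S"
  shows "cnt S = cnt S'"
  unfolding cnt_def
proof (rule card_image_correspondence[where T = "\<lambda>G H. H = compl G"])
  show "\<exists>G\<in>S. H = compl G" if "H \<in> S'" for H
    using assms(2)[OF that] by (intro bexI[of _ "compl H"]) auto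
  show "\<kappa> G = \<kappa> G' \<longleftrightarrow> \<kappa> H = \<kappa> H'"
    if "G \<in> S" "H \<in> S'" "G' \<in> S" "H' \<in> S'" "H = compl G" "H' = compl G'" for G H G' H'
    using compl[of G G'] compl[of H H'] assms that by auto
qed (use assms(1) in auto)

lemma cnt_one_leaf: "cnt (one_leaf n) = cnt (one_top n)"
proof (rule cnt_compl)
  fix G :: "nat ugraph"
  have c: "graph G" "core (compl G)" "tops (compl G) = leaves G" "leaves (compl G) = tops G" if "core G"
    using core_compl[OF that wt_compl] coreD(1,2)[OF that] by simp_all
  show "G \<in> one_leaf n \<Longrightarrow> graph G \<and> compl G \<in> one_top n" "G \<in> one_top n \<Longrightarrow> graph G \<and> compl G \<in> one_leaf n"
    using c by (simp_all add: one_top_def one_leaf_def)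
qed

lemma type_members:
  "G \<in> wt_of_size n \<Longrightarrow> graph G \<and> card (vertices G) = n"
  "G \<in> with_isolated n \<Longrightarrow> graph G \<and> card (vertices G) = n"
  "G \<in> with_dominating n \<Longrightarrow> graph G \<and> card (vertices G) = n"
  "G \<in> one_top n \<Longrightarrow> graph G \<and> card (vertices G) = n"
  "G \<in> one_leaf n \<Longrightarrow> graph G \<and> card (vertices G) = n"
  "G \<in> p4_type n \<Longrightarrow> graph G \<and> card (vertices G) = n"
  by (auto simp: wt_of_size_def with_isolated_def with_dominating_def one_top_def one_leaf_def p4_type_def
      wt_graph coreD(2))

lemma cnt_core: "cnt (one_top n \<union> one_leaf n \<union> p4_type n) = 2 * cnt (one_top n) + cnt (p4_type n)"
proof -
  have "cnt (one_top n \<union> one_leaf n \<union> p4_type n) = cnt (one_top n \<union> one_leaf n) + cnt (p4_type n)"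
  proof (rule cnt_Un[where n = n])
    fix G H assume "G \<in> one_top n \<union> one_leaf n" "H \<in> p4_type n"
    then show "\<kappa> G \<noteq> \<kappa> H"
      using same_value_tops_leaves(2,3)[of G H] by (auto simp: one_top_def one_leaf_def p4_type_def coreD(2))
  qed (use type_members in blast)
  moreover have "cnt (one_top n \<union> one_leaf n) = cnt (one_top n) + cnt (one_leaf n)"
  proof (rule cnt_Un[where n = n])
    fix G H assume GH: "G \<in> one_top n" "H \<in> one_leaf n"
    then have "card (tops G) = 1" "card (leaves H) = 1" "card (leaves G) \<noteq> 1"
      using core_types(2) by (auto simp: one_top_def one_leaf_def)
    then show "\<kappa> G \<noteq> \<kappa> H" using same_value_tops_leaves(3)[of G H] type_members(4,5) GH by metis
  qed (use type_members in blast)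
  ultimately show ?thesis by (simp add: cnt_one_leaf)
qed

lemma cnt_wt_0: "cnt (wt_of_size 0) = 1" by (simp add: cnt_def wt_of_size_0)

lemma cnt_wt_1: "cnt (wt_of_size 1) = 1"
proof -
  have "with_dominating 1 = with_isolated 1" by (simp add: with_dominating_def with_isolated_def)
  then have "wt_of_size 1 = with_isolated (Suc 0)"
    using wt_of_size_cases[of 1] by (simp add: small_types_empty)
  then show ?thesis using cnt_isolated[of 0] cnt_wt_0 by simp
qed

text \<open>Isolated and dominating vertices cannot coexist when there are at least two vertices, so these
  two cases and the three kinds of core partition the weakly threshold graphs.\<close>

lemma cnt_wt_Suc:
  assumes "n \<ge> 1"
  shows "cnt (wt_of_size (Suc n)) = 2 * cnt (wt_of_size n) + 2 * cnt (one_top (Suc n)) + cnt (p4_type (Suc n))"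
proof -
  let ?C = "one_top (Suc n) \<union> one_leaf (Suc n) \<union> p4_type (Suc n)"
  have c: "core G" "card (vertices G) = Suc n" if "G \<in> ?C" for G
    using that core_types(1)[of "Suc n"] by blast+
  have "cnt (wt_of_size (Suc n)) = cnt (with_isolated (Suc n) \<union> with_dominating (Suc n)) + cnt ?C"
    unfolding wt_of_size_cases[of "Suc n", simplified]
  proof (rule cnt_Un[where n = "Suc n"])
    fix G H assume GH: "G \<in> with_isolated (Suc n) \<union> with_dominating (Suc n)" "H \<in> ?C"
    have "0 \<in> set (degree_list G) \<or> n \<in> set (degree_list G)"
      using GH(1) by (auto simp: with_isolated_def with_dominating_def)
    then have "degree_list G \<noteq> degree_list H" using core_degree_bounds[OF c[OF GH(2)]] by auto
    moreover have "graph G" "graph H" using GH type_members by blast+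
    ultimately show "\<kappa> G \<noteq> \<kappa> H" using degree by blast
  qed (use type_members in blast)
  moreover have "cnt (with_isolated (Suc n) \<union> with_dominating (Suc n)) =
      cnt (with_isolated (Suc n)) + cnt (with_dominating (Suc n))"
  proof (rule cnt_Un[where n = "Suc n"])
    fix G H assume GH: "G \<in> with_isolated (Suc n)" "H \<in> with_dominating (Suc n)"
    have g: "graph G" "graph H" "card (vertices G) = Suc n" using GH type_members by blast+
    moreover have "0 \<in> set (degree_list G)" "n \<in> set (degree_list H)"
      using GH by (auto simp: with_isolated_def with_dominating_def)
    ultimately have "degree_list G \<noteq> degree_list H"
      using isolated_not_dominating[of G] assms by (metis One_nat_def Suc_1 Suc_le_mono diff_Suc_1)
    then show "\<kappa> G \<noteq> \<kappa> H" using degree g by blast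
  qed (use type_members in blast)
  ultimately show ?thesis by (simp add: cnt_isolated cnt_dominating cnt_core)
qed

end

section \<open>The two invariants\<close>

definition iso_class :: "nat ugraph \<Rightarrow> nat ugraph set" where
  "iso_class G = {H. graph H \<and> isomorphic G H}"

lemma iso_class_eq_iff:
  assumes "graph G" "graph H"
  shows "iso_class G = iso_class H \<longleftrightarrow> (\<exists>f. iso_map f G H)"
proof
  assume "iso_class G = iso_class H"
  moreover have "H \<in> iso_class H"
    using assms(2) isomorphic_iff[OF assms(2,2)] iso_map_id[of H] by (auto simp: iso_class_def)
  ultimately have "H \<in> iso_class G" by simp
  then have "isomorphic G H" by (simp add: iso_class_def)
  then show "\<exists>f. iso_map f G H" using isomorphic_iff[OF assms] by simp
next
  assume "\<exists>f. iso_map f G H"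
  then obtain f where f: "iso_map f G H" by blast
  have "isomorphic G K \<longleftrightarrow> isomorphic H K" if "graph K" for K :: "nat ugraph"
    using isomorphic_iff[OF assms(1) that] isomorphic_iff[OF assms(2) that]
      iso_map_comp[OF f] iso_map_comp[OF iso_map_inv[OF f]] by blast
  then show "iso_class G = iso_class H" by (auto simp: iso_class_def)
qed

lemma degree_zero_iff: "graph G \<Longrightarrow> vertex_degree G v = 0 \<longleftrightarrow> (\<forall>z. \<not> adj G v z)"
  by (simp add: degree_eq_card_nbhd)

lemma iso_map_add_isolated_iff:
  assumes "graph H" "graph H'" "v \<notin> vertices H" "v' \<notin> vertices H'"
  shows "(\<exists>f. iso_map f (add H v {}) (add H' v' {})) \<longleftrightarrow> (\<exists>f. iso_map f H H')"
proof
  assume "\<exists>f. iso_map f (add H v {}) (add H' v' {})"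
  then obtain f where f: "iso_map f (add H v {}) (add H' v' {})" by blast
  have g: "graph (add H v {})" "graph (add H' v' {})" using assms by simp_all
  have "vertex_degree (add H' v' {}) (f v) = 0" "vertex_degree (add H' v' {}) v' = 0"
    using iso_map_degree[OF g f, of v] degree_add(1)[of H v "{}"] degree_add(1)[of H' v' "{}"] assms by simp_all
  then have "adj (add H' v' {}) (f v) z \<longleftrightarrow> adj (add H' v' {}) v' z" for z
    using degree_zero_iff[OF g(2)] by blast
  then show "\<exists>f. iso_map f H H'" using iso_map_del_twin[OF assms g f] by blast
next
  assume "\<exists>f. iso_map f H H'"
  then obtain h where "iso_map h H H'" by blast
  from iso_map_add[OF assms empty_subsetI this]
  show "\<exists>f. iso_map f (add H v {}) (add H' v' {})" by auto
qed

lemma iso_map_compl: "iso_map f G H \<Longrightarrow> iso_map f (compl G) (compl H)"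
  by (auto simp: iso_map_def bij_betw_def inj_on_def)

lemma iso_map_compl_iff:
  assumes "graph G" "graph H"
  shows "(\<exists>f. iso_map f (compl G) (compl H)) \<longleftrightarrow> (\<exists>f. iso_map f G H)"
  using iso_map_compl[of _ G H] iso_map_compl[of _ "compl G" "compl H"] assms by auto

lemma iso_map_add_dominating_iff:
  assumes "graph H" "graph H'" "v \<notin> vertices H" "v' \<notin> vertices H'"
  shows "(\<exists>f. iso_map f (add H v (vertices H)) (add H' v' (vertices H'))) \<longleftrightarrow> (\<exists>f. iso_map f H H')"
proof -
  have "add K w (vertices K) = compl (add (compl K) w {})" if "graph K" "w \<notin> vertices K" for K :: "'x ugraph" and w
    using compl_add[of "compl K" w "{}"] that by simp
  then show ?thesis
    using assms iso_map_compl_iff[of "add (compl H) v {}" "add (compl H') v' {}"]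
      iso_map_add_isolated_iff[of "compl H" "compl H'" v v'] iso_map_compl_iff[OF assms(1,2)]
    by (metis (full_types) compl_add compl_compl graph_add graph_compl vertices_ops(3) empty_subsetI Diff_empty)
qed

lemma iso_map_p4_join_iff:
  assumes w: "wt H" "wt H'" and f4: "fresh4 H a b c d" "fresh4 H' a' b' c' d'"
  shows "(\<exists>f. iso_map f (p4_join H a b c d) (p4_join H' a' b' c' d')) \<longleftrightarrow> (\<exists>f. iso_map f H H')"
proof
  note g = wt_graph[OF w(1)] wt_graph[OF w(2)]
  note c = core_p4_join[OF w(1) f4(1)] and c' = core_p4_join[OF w(2) f4(2)]
  assume "\<exists>f. iso_map f (p4_join H a b c d) (p4_join H' a' b' c' d')"
  then obtain f where f: "iso_map f (p4_join H a b c d) (p4_join H' a' b' c' d')" by blast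
  let ?G = "p4_join H a b c d" and ?G' = "p4_join H' a' b' c' d'"
  have inj: "inj_on f (vertices ?G)" using f by (simp add: iso_map_def bij_betw_def)
  have V: "vertices H = vertices ?G - (tops ?G \<union> leaves ?G)"
    "vertices H' = vertices ?G' - (tops ?G' \<union> leaves ?G')"
    using f4 c(2,3) c'(2,3) by (auto simp: fresh4_def)
  have "tops ?G \<union> leaves ?G \<subseteq> vertices ?G" unfolding tops_def leaves_def by blast
  then have "f ` (vertices ?G - (tops ?G \<union> leaves ?G)) = f ` vertices ?G - f ` (tops ?G \<union> leaves ?G)"
    by (rule inj_on_image_set_diff[OF inj Diff_subset])
  also have "\<dots> = vertices ?G' - (tops ?G' \<union> leaves ?G')"
    using iso_map_tops_leaves[OF coreD(2)[OF c(1)] coreD(2)[OF c'(1)] f] iso_mapD(4)[OF f]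
    by (simp only: image_Un)
  finally have "f ` vertices H = vertices H'" unfolding V[symmetric] .
  moreover have "inj_on f (vertices H)" using inj by (rule inj_on_subset) (unfold V(1), rule Diff_subset)
  moreover have "adj H' (f x) (f y) \<longleftrightarrow> adj H x y" if xy: "x \<in> vertices H" "y \<in> vertices H" for x y
  proof -
    have "f x \<in> vertices H'" "f y \<in> vertices H'" using calculation(1) xy by auto
    then have "adj ?G' (f x) (f y) \<longleftrightarrow> adj H' (f x) (f y)" "adj ?G x y \<longleftrightarrow> adj H x y"
      using f4 xy by (auto simp: adj_p4_join fresh4_def doubleton_eq_iff)
    then show ?thesis using iso_mapD(2)[OF f, of x y] xy by simp
  qed
  ultimately have "iso_map f H H'" by (simp add: iso_map_def bij_betw_def)
  then show "\<exists>f. iso_map f H H'" by blast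
next
  assume "\<exists>f. iso_map f H H'"
  then show "\<exists>f. iso_map f (p4_join H a b c d) (p4_join H' a' b' c' d')"
    using iso_map_p4_join[OF wt_graph[OF w(1)] wt_graph[OF w(2)] f4] by blast
qed

interpretation by_iso: graph_invariant iso_class
proof
  fix G H :: "nat ugraph" and f assume "graph G" "graph H" "iso_map f G H"
  then show "iso_class G = iso_class H" using iso_class_eq_iff by blast
next
  fix G H :: "nat ugraph" assume "graph G" "graph H" "iso_class G = iso_class H"
  then show "degree_list G = degree_list H"
    using iso_class_eq_iff iso_map_degrees unfolding degree_list_eq_iff by blast
next
  fix H H' :: "nat ugraph" and v v' assume "graph H" "graph H'" "v \<notin> vertices H" "v' \<notin> vertices H'"
  then show "iso_class (add H v {}) = iso_class (add H' v' {}) \<longleftrightarrow> iso_class H = iso_class H'"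
    using iso_map_add_isolated_iff[of H H' v v'] by (simp add: iso_class_eq_iff)
next
  fix H H' :: "nat ugraph" and v v' assume "graph H" "graph H'" "v \<notin> vertices H" "v' \<notin> vertices H'"
  then show "iso_class (add H v (vertices H)) = iso_class (add H' v' (vertices H')) \<longleftrightarrow> iso_class H = iso_class H'"
    using iso_map_add_dominating_iff[of H H' v v'] by (simp add: iso_class_eq_iff)
next
  fix H H' :: "nat ugraph" and a b c d a' b' c' d'
  assume "wt H" "wt H'" "fresh4 H a b c d" "fresh4 H' a' b' c' d'"
  then show "iso_class (p4_join H a b c d) = iso_class (p4_join H' a' b' c' d') \<longleftrightarrow> iso_class H = iso_class H'"
    using iso_map_p4_join_iff[of H H' a b c d a' b' c' d'] by (simp add: iso_class_eq_iff wt_graph)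
next
  fix G H :: "nat ugraph" assume "graph G" "graph H" "iso_class G = iso_class H"
  then show "iso_class (compl G) = iso_class (compl H)"
    using iso_map_compl_iff[of G H] by (simp add: iso_class_eq_iff)
qed

lemma degrees_compl:
  assumes "graph G"
  shows "degrees (compl G) = image_mset (\<lambda>x. card (vertices G) - 1 - x) (degrees G)"
  unfolding image_mset.compositionality vertices_ops
  using assms by (intro image_mset_cong) (simp add: degree_compl)

interpretation by_degree: graph_invariant degree_list
proof
  fix G H :: "nat ugraph" and f assume "graph G" "graph H" "iso_map f G H"
  then show "degree_list G = degree_list H" unfolding degree_list_eq_iff by (rule iso_map_degrees)
next
  fix H H' :: "nat ugraph" and v v' assume "graph H" "graph H'" "v \<notin> vertices H" "v' \<notin> vertices H'"
  then show "degree_list (add H v {}) = degree_list (add H' v' {}) \<longleftrightarrow> degree_list H = degree_list H'"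
    by (simp add: wt_add_isolated)
next
  fix H H' :: "nat ugraph" and v v' assume "graph H" "graph H'" "v \<notin> vertices H" "v' \<notin> vertices H'"
  then show "degree_list (add H v (vertices H)) = degree_list (add H' v' (vertices H')) \<longleftrightarrow> degree_list H = degree_list H'"
    using map_injective[of Suc "degree_list H" "degree_list H'"]
    by (simp add: wt_add_dominating) (metis inj_Suc length_degree_list)
next
  fix H H' :: "nat ugraph" and a b c d a' b' c' d'
  assume a: "wt H" "wt H'" "fresh4 H a b c d" "fresh4 H' a' b' c' d'"
  have inj: "inj (\<lambda>x::nat. x + 2)" by (simp add: inj_on_def)
  show "degree_list (p4_join H a b c d) = degree_list (p4_join H' a' b' c' d') \<longleftrightarrow> degree_list H = degree_list H'"
    unfolding wt_p4_join(1)[OF wt_graph[OF a(1)] a(3)] wt_p4_join(1)[OF wt_graph[OF a(2)] a(4)]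
    using inj_map_eq_map[OF inj] by (auto simp flip: length_degree_list)
next
  fix G H :: "nat ugraph" assume g: "graph G" "graph H" "degree_list G = degree_list H"
  then have "card (vertices G) = card (vertices H)" by (metis length_degree_list)
  then show "degree_list (compl G) = degree_list (compl H)"
    using g unfolding degree_list_eq_iff by (simp only: degrees_compl)
qed auto

section \<open>Cores with a single top\<close>

lemma leaf_correspondence:
  fixes n :: nat
  shows "G \<in> one_top (Suc n) \<Longrightarrow> \<exists>H. core H \<and> card (vertices H) = n \<and> (\<exists>v u. v \<notin> vertices H \<and> u \<in> tops H \<and> G = add H v {u})"
    and "core (H :: nat ugraph) \<Longrightarrow> card (vertices H) = n \<Longrightarrow> v \<notin> vertices H \<Longrightarrow> u \<in> tops H \<Longrightarrow> add H v {u} \<in> one_top (Suc n)"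
proof -
  assume "G \<in> one_top (Suc n)"
  then have G: "core G" "card (vertices G) = Suc n" "card (tops G) = 1" by (auto simp: one_top_def)
  obtain H v u where H: "core H" "v \<notin> vertices H" "u \<in> tops H" "G = add H v {u}"
    using one_top_decomp[OF G(1,3)] .
  moreover have "card (vertices H) = n" using G(2) H coreD(2)[OF H(1)] by simp
  ultimately show "\<exists>H. core H \<and> card (vertices H) = n \<and> (\<exists>v u. v \<notin> vertices H \<and> u \<in> tops H \<and> G = add H v {u})" by blast
next
  assume a: "core H" "card (vertices H) = n" "v \<notin> vertices H" "u \<in> tops H"
  then show "add H v {u} \<in> one_top (Suc n)"
    using core_add_leaf[OF a(1,4,3)] coreD(2)[OF a(1)] by (simp add: one_top_def)
qed

text \<open>For degree lists all tops look alike: each core gives exactly one core with a single top on one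
  vertex more.\<close>

lemma degree_count_one_top:
  "by_degree.cnt (one_top (Suc n)) = 2 * by_degree.cnt (one_top n) + by_degree.cnt (p4_type n)"
proof -
  have "by_degree.cnt (one_top (Suc n)) = by_degree.cnt {G. core G \<and> card (vertices G) = n}"
    unfolding by_degree.cnt_def
  proof (rule card_image_correspondence[where T = "\<lambda>G H. \<exists>v u. v \<notin> vertices H \<and> u \<in> tops H \<and> G = add H v {u}"])
    show "\<exists>H\<in>{G. core G \<and> card (vertices G) = n}. \<exists>v u. v \<notin> vertices H \<and> u \<in> tops H \<and> G = add H v {u}"
      if "G \<in> one_top (Suc n)" for G
      using leaf_correspondence(1)[OF that] by simp
    show "\<exists>G\<in>one_top (Suc n). \<exists>v u. v \<notin> vertices H \<and> u \<in> tops H \<and> G = add H v {u}"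
      if "H \<in> {G. core G \<and> card (vertices G) = n}" for H
    proof -
      have H: "core H" "card (vertices H) = n" using that by auto
      obtain v where "v \<notin> vertices H" using obtain_fresh[OF coreD(2)[OF H(1)]] .
      moreover obtain u where "u \<in> tops H" using core_tops_leaves(1)[OF H(1)] by fastforce
      ultimately show ?thesis using leaf_correspondence(2)[OF H] by blast
    qed
    have deg: "degree_list (add H v {u}) = Suc (hd (degree_list H)) # tl (degree_list H) @ [1] \<and> degree_list H \<noteq> []"
      if "core H" "v \<notin> vertices H" "u \<in> tops H" for H :: "nat ugraph" and v u
    proof -
      have "card (vertices H) \<ge> 4" using core_card[OF that(1)] .
      moreover from this have "degree_list H \<noteq> []" using length_degree_list[of H] by force
      moreover have "1 \<le> vertex_degree H x \<and> vertex_degree H x \<le> vertex_degree H u" if "x \<in> vertices H" for x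
        using coreD(3,4)[OF \<open>core H\<close> that] \<open>u \<in> tops H\<close> by (auto simp: tops_def)
      ultimately show ?thesis
        using wt_add_leaf(1)[OF coreD(2)[OF that(1)] that(2), of u] that(3) by (simp add: tops_def)
    qed
    fix G H G' H' :: "nat ugraph"
    assume H: "H \<in> {G. core G \<and> card (vertices G) = n}" "H' \<in> {G. core G \<and> card (vertices G) = n}"
      and "\<exists>v u. v \<notin> vertices H \<and> u \<in> tops H \<and> G = add H v {u}" "\<exists>v u. v \<notin> vertices H' \<and> u \<in> tops H' \<and> G' = add H' v {u}"
    then have "degree_list G = Suc (hd (degree_list H)) # tl (degree_list H) @ [1]"
      "degree_list G' = Suc (hd (degree_list H')) # tl (degree_list H') @ [1]"
      "degree_list H \<noteq> []" "degree_list H' \<noteq> []" using deg[of H] deg[of H'] by auto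
    then show "degree_list G = degree_list G' \<longleftrightarrow> degree_list H = degree_list H'"
      by (auto simp: list.expand)
  qed
  then show ?thesis unfolding core_types(1) by_degree.cnt_core .
qed

definition top_hits_leaf :: "'a ugraph \<Rightarrow> 'a \<Rightarrow> bool" where
  "top_hits_leaf G u \<longleftrightarrow> (\<exists>l\<in>leaves G. adj G u l)"

definition top_misses_leaf :: "'a ugraph \<Rightarrow> 'a \<Rightarrow> bool" where
  "top_misses_leaf G u \<longleftrightarrow> (\<exists>l\<in>leaves G. \<not> adj G u l)"

definition top_hits_two_leaves :: "'a ugraph \<Rightarrow> 'a \<Rightarrow> bool" where
  "top_hits_two_leaves G u \<longleftrightarrow> (\<exists>l\<in>leaves G. \<exists>l'\<in>leaves G. l \<noteq> l' \<and> adj G u l \<and> adj G u l')"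

text \<open>How the position of the new leaf can be read off afterwards, so that the recursion on
  isomorphism classes separates the two possible choices of the top.\<close>

lemma hits_after_add_leaf:
  assumes "core H" "u \<in> tops H" "v \<notin> vertices H"
  shows "top_hits_two_leaves (add H v {u}) u \<longleftrightarrow> top_hits_leaf H u"
    and "top_misses_leaf (add H v {u}) u \<longleftrightarrow> top_misses_leaf H u"
proof -
  have "u \<noteq> v" "\<And>l. l \<in> leaves H \<Longrightarrow> l \<noteq> v" using assms by (auto simp: tops_def leaves_def)
  then show "top_hits_two_leaves (add H v {u}) u \<longleftrightarrow> top_hits_leaf H u"
    "top_misses_leaf (add H v {u}) u \<longleftrightarrow> top_misses_leaf H u"
    unfolding top_hits_two_leaves_def top_hits_leaf_def top_misses_leaf_def core_add_leaf(3)[OF assms] adj_add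
    by auto
qed

text \<open>The isomorphism class of the smaller core, together with whether the chosen top is adjacent to a
  leaf, determines the class of the larger one by \<open>iso_map_to_top\<close>. Conversely, the new leaf can be
  recovered because all leaves on the single top are twins. The hypothesis on \<open>P\<close> says that \<open>P\<close> fixes that status.\<close>

lemma iso_count_leaf:
  fixes Q :: "nat ugraph \<Rightarrow> nat \<Rightarrow> bool"
  assumes Q: "\<And>H u v. core H \<Longrightarrow> u \<in> tops H \<Longrightarrow> v \<notin> vertices H \<Longrightarrow> Q (add H v {u}) u \<longleftrightarrow> P H u"
    and P: "(\<forall>H u. P H u \<longrightarrow> top_hits_leaf H u) \<or> (\<forall>H u. P H u \<longrightarrow> \<not> top_hits_leaf H u)"
  shows "by_iso.cnt {G \<in> one_top (Suc n). \<exists>u\<in>tops G. Q G u} =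
    by_iso.cnt {H. core H \<and> card (vertices H) = n \<and> (\<exists>u\<in>tops H. P H u)}"
  unfolding by_iso.cnt_def
proof (rule card_image_correspondence[where
      T = "\<lambda>G H. \<exists>v u. v \<notin> vertices H \<and> u \<in> tops H \<and> P H u \<and> G = add H v {u}"])
  fix G assume "G \<in> {G \<in> one_top (Suc n). \<exists>u\<in>tops G. Q G u}"
  then obtain w where G: "G \<in> one_top (Suc n)" "w \<in> tops G" "Q G w" by auto
  obtain H v u where H: "core H" "card (vertices H) = n" "v \<notin> vertices H" "u \<in> tops H" "G = add H v {u}"
    using leaf_correspondence(1)[OF G(1)] by blast
  have "w = u" using G(2) H core_add_leaf(2)[OF H(1,4,3)] by simp
  then have "P H u" using Q[OF H(1,4,3)] G(3) H(5) by simp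
  then show "\<exists>H\<in>{H. core H \<and> card (vertices H) = n \<and> (\<exists>u\<in>tops H. P H u)}.
      \<exists>v u. v \<notin> vertices H \<and> u \<in> tops H \<and> P H u \<and> G = add H v {u}" using H by blast
next
  fix H assume "H \<in> {H :: nat ugraph. core H \<and> card (vertices H) = n \<and> (\<exists>u\<in>tops H. P H u)}"
  then obtain u where H: "core H" "card (vertices H) = n" "u \<in> tops H" "P H u" by blast
  obtain v where v: "v \<notin> vertices H" using obtain_fresh[OF coreD(2)[OF H(1)]] .
  have "Q (add H v {u}) u" using Q[OF H(1,3) v] H(4) by simp
  then have "add H v {u} \<in> {G \<in> one_top (Suc n). \<exists>u\<in>tops G. Q G u}"
    using leaf_correspondence(2)[OF H(1,2) v H(3)] core_add_leaf(2)[OF H(1,3) v] by simp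
  then show "\<exists>G\<in>{G \<in> one_top (Suc n). \<exists>u\<in>tops G. Q G u}. \<exists>v u. v \<notin> vertices H \<and> u \<in> tops H \<and> P H u \<and> G = add H v {u}"
    using H v by blast
next
  fix G H G' H'
  assume "H \<in> {H :: nat ugraph. core H \<and> card (vertices H) = n \<and> (\<exists>u\<in>tops H. P H u)}"
    "H' \<in> {H :: nat ugraph. core H \<and> card (vertices H) = n \<and> (\<exists>u\<in>tops H. P H u)}"
  then have c: "core H" "core H'" by auto
  assume "\<exists>v u. v \<notin> vertices H \<and> u \<in> tops H \<and> P H u \<and> G = add H v {u}"
    "\<exists>v u. v \<notin> vertices H' \<and> u \<in> tops H' \<and> P H' u \<and> G' = add H' v {u}"
  then obtain v u v' u' where H: "v \<notin> vertices H" "u \<in> tops H" "P H u" "G = add H v {u}"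
    and H': "v' \<notin> vertices H'" "u' \<in> tops H'" "P H' u'" "G' = add H' v' {u'}" by blast
  note g = coreD(2)[OF c(1)] coreD(2)[OF c(2)]
  note a = core_add_leaf[OF c(1) H(2,1), folded H(4)] and a' = core_add_leaf[OF c(2) H'(2,1), folded H'(4)]
  note gG = coreD(2)[OF a(1)] coreD(2)[OF a'(1)]
  have uV: "u \<in> vertices H" "u' \<in> vertices H'" using H(2) H'(2) by (auto simp: tops_def)
  show "iso_class G = iso_class G' \<longleftrightarrow> iso_class H = iso_class H'"
    unfolding iso_class_eq_iff[OF gG] iso_class_eq_iff[OF g]
  proof
    assume "\<exists>f. iso_map f G G'"
    then obtain f where f: "iso_map f G G'" by blast
    have "f u = u'" using iso_map_tops_leaves(1)[OF gG f] a(2) a'(2) by simp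
    moreover have "adj G v u" using H(4) by simp
    ultimately have 1: "adj G' (f v) u'" using iso_mapD(2)[OF f, of v u] H(4) uV by simp
    have "f v \<in> leaves G'" using iso_map_tops_leaves(2)[OF gG f] a(3) by blast
    then obtain w where w: "nbhd G' (f v) = {w}" using leaf_nbhd[OF gG(2)] by blast
    have nfv: "adj G' (f v) z \<longleftrightarrow> z = u'" for z using w 1 by (metis mem_Collect_eq singletonD)
    have nv': "adj G' v' z \<longleftrightarrow> z = u'" for z using H'(1,4) adjD[OF g(2), of v' z] uV by auto
    show "\<exists>f. iso_map f H H'"
      using iso_map_del_twin[OF g H(1) H'(1), of "{u}" "{u'}" f] gG f nfv nv' unfolding H(4) H'(4) by metis
  next
    assume "\<exists>f. iso_map f H H'"
    then obtain h where h: "iso_map h H H'" by blast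
    have "top_hits_leaf H u \<longleftrightarrow> top_hits_leaf H' u'" using P H(3) H'(3) by blast
    then obtain k where k: "iso_map k H H'" "k u = u'"
      using iso_map_to_top[OF c h H(2) H'(2)] unfolding top_hits_leaf_def by blast
    have "iso_map (k(v := v')) G G'"
      using iso_map_add[OF g H(1) H'(1) _ k(1), of "{u}"] k(2) uV H(4) H'(4) by simp
    then show "\<exists>f. iso_map f G G'" by blast
  qed
qed

lemma degree_list_eq_Nil_iff: "degree_list G = [] \<longleftrightarrow> card (vertices G) = 0"
  by (metis length_0_conv length_degree_list)

abbreviation misses_leaf :: "nat \<Rightarrow> nat ugraph set" where
  "misses_leaf n \<equiv> {G \<in> one_top n. \<exists>u\<in>tops G. top_misses_leaf G u}"

lemma top_hits_some_leaf:
  assumes "core G" "u \<in> tops G" "card (leaves G) \<ge> 2"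
  shows "top_hits_leaf G u"
proof -
  obtain s where s: "\<And>x. x \<in> vertices G \<Longrightarrow> x \<noteq> u \<Longrightarrow> x \<noteq> s \<Longrightarrow> adj G u x"
    using top_nonnbhd[OF assms(1,2)] by metis
  have "\<not> leaves G \<subseteq> {s}" using assms(3) card_mono[of "{s}" "leaves G"] by auto
  then obtain l where l: "l \<in> leaves G" "l \<noteq> s" by blast
  moreover have "l \<noteq> u" "l \<in> vertices G"
    using l assms(2) core_tops_leaves_disjoint[OF assms(1)] by (auto simp: leaves_def)
  ultimately show ?thesis using s unfolding top_hits_leaf_def by blast
qed

lemma not_two_hits_misses:
  assumes "core G" "card (leaves G) \<ge> 2" "\<not> top_hits_two_leaves G u"
  shows "top_misses_leaf G u"
proof -
  obtain l l' where "l \<in> leaves G" "l' \<in> leaves G" "l \<noteq> l'"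
    using assms(2) by (metis card_le_Suc0_iff_eq coreD(2)[OF assms(1)] finite_tops_leaves(2) not_less_eq_eq numeral_2_eq_2)
  then show ?thesis using assms(3) unfolding top_hits_two_leaves_def top_misses_leaf_def by blast
qed

lemma p4_type_top_misses_leaf:
  assumes "G \<in> p4_type n" "u \<in> tops G"
  shows "top_misses_leaf G u"
proof -
  have G: "core G" "card (tops G) \<ge> 2" "card (leaves G) \<ge> 2" using assms(1) by (auto simp: p4_type_def)
  obtain H a b c d where H: "wt H" "fresh4 H a b c d" "G = p4_join H a b c d" using p4_join_decomp[OF G] .
  have f: "a \<noteq> b" "a \<noteq> c" "a \<noteq> d" "b \<noteq> c" "b \<noteq> d" "c \<noteq> d"
    "a \<notin> vertices H" "b \<notin> vertices H" "c \<notin> vertices H" "d \<notin> vertices H"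
    using H(2) by (auto simp: fresh4_def)
  then have "\<not> adj G b d" "\<not> adj G c a"
    using adjD[OF wt_graph[OF H(1)]] unfolding H(3) adj_p4_join doubleton_eq_iff by blast+
  then show ?thesis
    using core_p4_join(2,3)[OF H(1,2)] assms(2) unfolding H(3) top_misses_leaf_def by auto
qed

text \<open>The only leaf has just one neighbour, so among at least two tops one is not adjacent to it.\<close>

lemma one_leaf_top:
  assumes "G \<in> one_leaf n"
  shows "\<exists>u\<in>tops G. \<not> top_hits_leaf G u" "top_hits_leaf G u \<Longrightarrow> \<not> top_misses_leaf G u"
proof -
  have G: "core G" "card (leaves G) = 1" using assms by (auto simp: one_leaf_def)
  then obtain l where l: "leaves G = {l}" using card_1_singletonE by blast
  obtain w where w: "nbhd G l = {w}" using leaf_nbhd[OF coreD(2)[OF G(1)]] l by blast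
  have "card (tops G) \<ge> 2" using core_tops_leaves(3)[OF G(1)] G(2) by simp
  then have "\<not> tops G \<subseteq> {w}" using card_mono[of "{w}" "tops G"] by auto
  then obtain t where "t \<in> tops G" "t \<noteq> w" by blast
  moreover from this have "\<not> adj G t l" using w adj_sym[of G t l] by auto
  ultimately show "\<exists>u\<in>tops G. \<not> top_hits_leaf G u" using l unfolding top_hits_leaf_def by auto
  show "top_hits_leaf G u \<Longrightarrow> \<not> top_misses_leaf G u"
    using l unfolding top_hits_leaf_def top_misses_leaf_def by auto
qed

lemma core_cases:
  fixes G :: "nat ugraph"
  assumes "core G" "card (vertices G) = n"
  obtains "G \<in> one_top n" "card (leaves G) \<ge> 2" | "G \<in> one_leaf n" | "G \<in> p4_type n"
  using core_tops_leaves[OF assms(1)] assms that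
  by (cases "card (tops G) = 1"; cases "card (leaves G) = 1")
    (auto simp: one_top_def one_leaf_def p4_type_def)

lemma one_top_leaves: "G \<in> one_top n \<Longrightarrow> card (leaves G) \<ge> 2"
  using core_tops_leaves(3)[of G] by (auto simp: one_top_def)

lemma core_of_type:
  "G \<in> one_top n \<Longrightarrow> core G \<and> card (vertices G) = n"
  "G \<in> one_leaf n \<Longrightarrow> core G \<and> card (vertices G) = n"
  "G \<in> p4_type n \<Longrightarrow> core G \<and> card (vertices G) = n"
  by (auto simp: one_top_def one_leaf_def p4_type_def)

lemma top_exists: "core G \<Longrightarrow> \<exists>u. u \<in> tops G"
  using core_tops_leaves(1)[of G] by (metis card.empty ex_in_conv not_one_le_zero)

lemma cores_hitting:
  "{H. core H \<and> card (vertices H) = n \<and> (\<exists>u\<in>tops H. top_hits_leaf H u)} =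
    one_top n \<union> {G \<in> one_leaf n. \<exists>u\<in>tops G. top_hits_leaf G u} \<union> p4_type n" (is "?L = ?R")
proof (intro equalityI subsetI)
  fix G assume "G \<in> ?L"
  then have G: "core G" "card (vertices G) = n" "\<exists>u\<in>tops G. top_hits_leaf G u" by auto
  from G(1,2) show "G \<in> ?R" by (cases rule: core_cases) (use G(3) in auto)
next
  fix G assume G: "G \<in> ?R"
  then have c: "core G \<and> card (vertices G) = n" using core_of_type by blast
  moreover have "\<exists>u\<in>tops G. top_hits_leaf G u"
  proof (cases "card (leaves G) \<ge> 2")
    case True
    then show ?thesis using top_hits_some_leaf[of G] top_exists[of G] c by blast
  next
    case False
    then have "G \<notin> one_top n" "G \<notin> p4_type n" using one_top_leaves[of G n] by (auto simp: p4_type_def)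
    then show ?thesis using G by blast
  qed
  ultimately show "G \<in> ?L" by blast
qed

lemma cores_not_hitting:
  "{H. core H \<and> card (vertices H) = n \<and> (\<exists>u\<in>tops H. \<not> top_hits_leaf H u)} = one_leaf n" (is "?L = ?R")
proof (intro equalityI subsetI)
  fix G assume "G \<in> ?L"
  then obtain u where G: "core G" "card (vertices G) = n" "u \<in> tops G" "\<not> top_hits_leaf G u" by blast
  then have "\<not> card (leaves G) \<ge> 2" using top_hits_some_leaf[of G u] by blast
  then show "G \<in> ?R" using G(1,2) core_tops_leaves(2)[OF G(1)] by (simp add: one_leaf_def)
next
  fix G assume "G \<in> ?R"
  then show "G \<in> ?L" using one_leaf_top(1)[of G n] core_of_type(2)[of G n] by blast
qed

lemma cores_hitting_and_missing:
  "{H. core H \<and> card (vertices H) = n \<and> (\<exists>u\<in>tops H. top_hits_leaf H u \<and> top_misses_leaf H u)} =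
    misses_leaf n \<union> p4_type n" (is "?L = ?R")
proof (intro equalityI subsetI)
  fix G assume "G \<in> ?L"
  then obtain u where G: "core G" "card (vertices G) = n" "u \<in> tops G" "top_hits_leaf G u" "top_misses_leaf G u" by blast
  from G(1,2) show "G \<in> ?R"
    by (cases rule: core_cases) (use G(3-5) one_leaf_top(2) in blast)+
next
  fix G assume "G \<in> ?R"
  then consider "G \<in> misses_leaf n" | "G \<in> p4_type n" by blast
  then show "G \<in> ?L"
  proof cases
    case 1
    then obtain u where "G \<in> one_top n" "u \<in> tops G" "top_misses_leaf G u" by blast
    then show ?thesis
      using top_hits_some_leaf[of G u] one_top_leaves[of G n] core_of_type(1)[of G n] by blast
  next
    case 2
    have "card (leaves G) \<ge> 2" using 2 by (simp add: p4_type_def)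
    moreover obtain u where "u \<in> tops G" using core_of_type(3)[OF 2] top_exists[of G] by blast
    ultimately show ?thesis
      using p4_type_top_misses_leaf[OF 2, of u] top_hits_some_leaf[of G u] core_of_type(3)[OF 2] by blast
  qed
qed

lemma one_top_unique: "G \<in> one_top n \<Longrightarrow> \<exists>u. tops G = {u}"
  unfolding one_top_def by (simp add: card_1_singleton_iff)

lemma iso_map_two_hits:
  assumes "graph G" "graph H" "iso_map f G H" "u \<in> tops G" "top_hits_two_leaves G u"
  shows "top_hits_two_leaves H (f u)"
proof -
  obtain l l' where l: "l \<in> leaves G" "l' \<in> leaves G" "l \<noteq> l'" "adj G u l" "adj G u l'"
    using assms(5) unfolding top_hits_two_leaves_def by blast
  have "l \<in> vertices G" "l' \<in> vertices G" "u \<in> vertices G"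
    using l assms(4) by (auto simp: leaves_def tops_def)
  then have "adj H (f u) (f l)" "adj H (f u) (f l')" "f l \<noteq> f l'"
    using iso_mapD(2,3)[OF assms(3)] l by blast+
  moreover have "f l \<in> leaves H" "f l' \<in> leaves H" using iso_map_tops_leaves(2)[OF assms(1-3)] l by blast+
  ultimately show ?thesis unfolding top_hits_two_leaves_def by blast
qed

abbreviation two_hits where
  "two_hits n \<equiv> {G \<in> one_top n. \<exists>u\<in>tops G. top_hits_two_leaves G u}"

abbreviation not_two_hits where
  "not_two_hits n \<equiv> {G \<in> one_top n. \<exists>u\<in>tops G. \<not> top_hits_two_leaves G u}"

lemma two_hits_disjoint:
  assumes "G \<in> two_hits n" "H \<in> not_two_hits n"
  shows "iso_class G \<noteq> iso_class H"
proof
  have g: "graph G" "graph H" using assms core_of_type(1) coreD(2) by blast+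
  assume "iso_class G = iso_class H"
  then obtain f where f: "iso_map f G H" using iso_class_eq_iff[OF g] by blast
  obtain u where u: "u \<in> tops G" "top_hits_two_leaves G u" using assms(1) by blast
  obtain w where w: "w \<in> tops H" "\<not> top_hits_two_leaves H w" using assms(2) by blast
  obtain w' where "tops H = {w'}" using assms(2) one_top_unique by blast
  moreover have "f u \<in> tops H" using iso_map_tops_leaves(1)[OF g f] u by blast
  ultimately have "f u = w" using w(1) by simp
  then show False using iso_map_two_hits[OF g f u] w by blast
qed

text \<open>Complementation turns a top adjacent to the only leaf into a leaf not adjacent to the only top.\<close>

lemma iso_count_hits_compl:
  "by_iso.cnt {G \<in> one_leaf n. \<exists>u\<in>tops G. top_hits_leaf G u} = by_iso.cnt (misses_leaf n)"
proof (rule by_iso.cnt_compl)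
  fix G :: "nat ugraph"
  have c: "graph G" "core (compl G)" "tops (compl G) = leaves G" "leaves (compl G) = tops G" if "core G"
    using core_compl[OF that wt_compl] coreD(1,2)[OF that] by simp_all
  have a: "adj (compl G) l u \<longleftrightarrow> \<not> adj G u l" if "core G" "u \<in> tops G" "l \<in> leaves G" for u l
  proof -
    have "u \<noteq> l" using core_tops_leaves_disjoint that by blast
    then show ?thesis using that adj_sym[of G u l] by (auto simp: tops_def leaves_def)
  qed
  { assume "G \<in> {G \<in> one_leaf n. \<exists>u\<in>tops G. top_hits_leaf G u}"
    then obtain u l where G: "core G" "card (vertices G) = n" "card (leaves G) = 1" "u \<in> tops G" "l \<in> leaves G" "adj G u l"
      by (auto simp: one_leaf_def top_hits_leaf_def)
    then have "top_misses_leaf (compl G) l" using a[OF G(1,4,5)] c[OF G(1)] unfolding top_misses_leaf_def by blast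
    then show "graph G \<and> compl G \<in> misses_leaf n" using G c[OF G(1)] by (auto simp: one_top_def) }
  { assume "G \<in> misses_leaf n"
    then obtain u l where G: "core G" "card (vertices G) = n" "card (tops G) = 1" "u \<in> tops G" "l \<in> leaves G" "\<not> adj G u l"
      by (auto simp: one_top_def top_misses_leaf_def)
    then have "top_hits_leaf (compl G) l" using a[OF G(1,4,5)] c[OF G(1)] unfolding top_hits_leaf_def by blast
    then show "graph G \<and> compl G \<in> {G \<in> one_leaf n. \<exists>u\<in>tops G. top_hits_leaf G u}"
      using G c[OF G(1)] by (auto simp: one_leaf_def) }
qed

text \<open>Here the attached leaf is the only leaf on its top, so that top was not adjacent to a leaf before;
  such tops exist exactly on the cores with a single leaf.\<close>

lemma iso_count_not_two_hits: "by_iso.cnt (not_two_hits (Suc n)) = by_iso.cnt (one_top n)"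
  unfolding by_iso.cnt_one_leaf[symmetric] cores_not_hitting[symmetric]
proof (rule iso_count_leaf)
  fix H :: "nat ugraph" and u v assume "core H" "u \<in> tops H" "v \<notin> vertices H"
  from hits_after_add_leaf(1)[OF this]
  show "\<not> top_hits_two_leaves (add H v {u}) u \<longleftrightarrow> \<not> top_hits_leaf H u" by simp
qed blast

text \<open>A core with one top or of path type has one orbit of tops; a core with one leaf has two orbits if
  the neighbour of the leaf is a top, and one orbit otherwise.\<close>

lemma iso_count_one_top:
  "by_iso.cnt (one_top (Suc n)) = 2 * by_iso.cnt (one_top n) + by_iso.cnt (misses_leaf n) + by_iso.cnt (p4_type n)"
proof -
  have "one_top (Suc n) = two_hits (Suc n) \<union> not_two_hits (Suc n)"
    using one_top_unique by blast
  moreover have "by_iso.cnt (two_hits (Suc n) \<union> not_two_hits (Suc n)) =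
      by_iso.cnt (two_hits (Suc n)) + by_iso.cnt (not_two_hits (Suc n))"
    by (rule by_iso.cnt_Un[where n = "Suc n"]) (use by_iso.type_members(4) two_hits_disjoint in blast)+
  moreover have "by_iso.cnt (two_hits (Suc n)) =
      by_iso.cnt (one_top n \<union> {G \<in> one_leaf n. \<exists>u\<in>tops G. top_hits_leaf G u} \<union> p4_type n)"
    unfolding cores_hitting[symmetric]
  proof (rule iso_count_leaf)
    fix H :: "nat ugraph" and u v assume "core H" "u \<in> tops H" "v \<notin> vertices H"
    from hits_after_add_leaf[OF this]
    show "top_hits_two_leaves (add H v {u}) u \<longleftrightarrow> top_hits_leaf H u" by simp
  qed blast
  moreover have "by_iso.cnt (one_top n \<union> {G \<in> one_leaf n. \<exists>u\<in>tops G. top_hits_leaf G u} \<union> p4_type n) =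
    by_iso.cnt (one_top n \<union> {G \<in> one_leaf n. \<exists>u\<in>tops G. top_hits_leaf G u}) + by_iso.cnt (p4_type n)"
  proof (rule by_iso.cnt_Un[where n = n])
    fix G H assume GH: "G \<in> one_top n \<union> {G \<in> one_leaf n. \<exists>u\<in>tops G. top_hits_leaf G u}" "H \<in> p4_type n"
    then have "graph G" "graph H" using by_iso.type_members(4-6) by blast+
    then show "iso_class G \<noteq> iso_class H"
      using by_iso.same_value_tops_leaves(2,3)[of G H] GH by (auto simp: one_top_def one_leaf_def p4_type_def)
  qed (use by_iso.type_members(4-6) in blast)
  moreover have "by_iso.cnt (one_top n \<union> {G \<in> one_leaf n. \<exists>u\<in>tops G. top_hits_leaf G u}) =
    by_iso.cnt (one_top n) + by_iso.cnt {G \<in> one_leaf n. \<exists>u\<in>tops G. top_hits_leaf G u}"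
  proof (rule by_iso.cnt_Un[where n = n])
    fix G H assume GH: "G \<in> one_top n" "H \<in> {G \<in> one_leaf n. \<exists>u\<in>tops G. top_hits_leaf G u}"
    then have "graph G" "graph H" using by_iso.type_members(4,5) by blast+
    then show "iso_class G \<noteq> iso_class H"
      using by_iso.same_value_tops_leaves(3)[of G H] GH one_top_leaves[of G n] by (auto simp: one_leaf_def)
  qed (use by_iso.type_members(4-6) in blast)
  ultimately show ?thesis by (simp add: iso_count_not_two_hits iso_count_hits_compl)
qed

text \<open>The refined count needed by the previous recursion: attaching a leaf to a top does not change
  whether that top misses a leaf.\<close>

lemma iso_count_misses_leaf:
  "by_iso.cnt (misses_leaf (Suc n)) = by_iso.cnt (misses_leaf n) + by_iso.cnt (one_top n) + by_iso.cnt (p4_type n)"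
proof -
  let ?M = "{G \<in> one_top (Suc n). \<exists>u\<in>tops G. top_hits_two_leaves G u \<and> top_misses_leaf G u}"
  have "misses_leaf (Suc n) = ?M \<union> not_two_hits (Suc n)"
  proof (intro equalityI subsetI)
    fix G assume G: "G \<in> misses_leaf (Suc n)"
    then obtain u where "tops G = {u}" using one_top_unique by blast
    then show "G \<in> ?M \<union> not_two_hits (Suc n)" using G by auto
  next
    fix G assume G: "G \<in> ?M \<union> not_two_hits (Suc n)"
    show "G \<in> misses_leaf (Suc n)"
      using G not_two_hits_misses[of G] one_top_leaves[of G "Suc n"] core_of_type(1)[of G "Suc n"] by blast
  qed
  moreover have "by_iso.cnt (?M \<union> not_two_hits (Suc n)) = by_iso.cnt ?M + by_iso.cnt (not_two_hits (Suc n))"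
    by (rule by_iso.cnt_Un[where n = "Suc n"]) (use by_iso.type_members(4) two_hits_disjoint in blast)+
  moreover have "by_iso.cnt ?M = by_iso.cnt (misses_leaf n \<union> p4_type n)"
    unfolding cores_hitting_and_missing[symmetric]
  proof (rule iso_count_leaf)
    fix H :: "nat ugraph" and u v assume "core H" "u \<in> tops H" "v \<notin> vertices H"
    from hits_after_add_leaf[OF this]
    show "(top_hits_two_leaves (add H v {u}) u \<and> top_misses_leaf (add H v {u}) u) \<longleftrightarrow> (top_hits_leaf H u \<and> top_misses_leaf H u)" by simp
  qed blast
  moreover have "by_iso.cnt (misses_leaf n \<union> p4_type n) = by_iso.cnt (misses_leaf n) + by_iso.cnt (p4_type n)"
  proof (rule by_iso.cnt_Un[where n = n])
    fix G H assume GH: "G \<in> misses_leaf n" "H \<in> p4_type n"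
    then have "graph G" "graph H" using by_iso.type_members(4-6) by blast+
    then show "iso_class G \<noteq> iso_class H"
      using by_iso.same_value_tops_leaves(2)[of G H] GH by (auto simp: one_top_def p4_type_def)
  qed (use by_iso.type_members(4-6) in blast)
  ultimately show ?thesis by (simp add: iso_count_not_two_hits)
qed

lemma num_wt_sequences_eq:
  assumes "n \<ge> 1" shows "num_wt_sequences n = by_degree.cnt (wt_of_size n)"
proof -
  have *: "weakly_threshold_sequence d \<and> length d = n \<longleftrightarrow>
      (\<exists>G :: nat ugraph. simple_graph G \<and> degree_list G = d \<and> card (vertices G) = n \<and> small_slack d)" for d
  proof -
    have "(\<forall>k\<in>{1..seq_m (degree_list G)}. seq_Delta k (degree_list G) \<le> 1) \<longleftrightarrow> small_slack (degree_list G)"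
      if "simple_graph (G :: nat ugraph)" for G
    proof (rule small_slack_iff[OF sorted_degree_list])
      show "degree_list G \<noteq> []" using that by (simp add: simple_graph_iff degree_list_eq_Nil_iff)
    qed
    note ss = this
    show ?thesis
    proof
      assume "weakly_threshold_sequence d \<and> length d = n"
      then obtain G :: "nat ugraph" where "simple_graph G" "degree_list G = d" "card (vertices G) = n"
        "\<forall>k\<in>{1..seq_m d}. seq_Delta k d \<le> 1"
        unfolding weakly_threshold_sequence_def degree_sequence_def by auto
      moreover from this have "small_slack d" using ss[of G] by simp
      ultimately show "\<exists>G :: nat ugraph. simple_graph G \<and> degree_list G = d \<and> card (vertices G) = n \<and> small_slack d"
        by blast
    next
      assume "\<exists>G :: nat ugraph. simple_graph G \<and> degree_list G = d \<and> card (vertices G) = n \<and> small_slack d"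
      then obtain G :: "nat ugraph" where "simple_graph G" "degree_list G = d" "card (vertices G) = n" "small_slack d"
        by blast
      then show "weakly_threshold_sequence d \<and> length d = n"
        using ss[of G] length_degree_list[of G]
        unfolding weakly_threshold_sequence_def degree_sequence_def by blast
    qed
  qed
  have "{d. weakly_threshold_sequence d \<and> length d = n} = degree_list ` wt_of_size n"
    unfolding * using assms by (fastforce simp: wt_of_size_def wt_def simple_graph_iff)
  then show ?thesis by (simp add: num_wt_sequences_def by_degree.cnt_def)
qed

lemma num_wt_graphs_eq:
  assumes "n \<ge> 1" shows "num_wt_graphs n = by_iso.cnt (wt_of_size n)"
proof -
  have wt: "weakly_threshold_graph G \<and> card (vertices G) = n \<longleftrightarrow> G \<in> wt_of_size n" for G :: "nat ugraph"
  proof (cases "simple_graph G \<and> card (vertices G) = n")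
    case True
    then have "degree_list G \<noteq> []" using assms by (simp add: degree_list_eq_Nil_iff)
    moreover have "degree_sequence (degree_list G)" using True unfolding degree_sequence_def by blast
    ultimately show ?thesis
      using True small_slack_iff[OF sorted_degree_list, of G]
      by (auto simp: weakly_threshold_graph_def weakly_threshold_sequence_def
          wt_of_size_def wt_def simple_graph_iff)
  next
    case False
    then show ?thesis using assms
      by (auto simp: weakly_threshold_graph_def wt_of_size_def wt_def simple_graph_iff)
  qed
  have "iso_rel `` {G} = iso_class G" if "G \<in> wt_of_size n" for G
  proof -
    have "graph G" "vertices G \<noteq> {}" using that assms by (auto simp: wt_of_size_def wt_graph)
    then show ?thesis
      by (auto simp: iso_rel_def iso_class_def simple_graph_iff isomorphic_def bij_betw_def)
  qed
  then have "wt_of_size n // iso_rel = iso_class ` wt_of_size n"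
    by (auto simp: quotient_def)
  then show ?thesis by (simp add: num_wt_graphs_def wt by_iso.cnt_def)
qed

section \<open>Closed forms\<close>

lemma recurrence_unique_4:
  fixes f g :: "nat \<Rightarrow> real"
  assumes "\<And>n. f (n + 4) = 4 * f (n + 3) - 4 * f (n + 2) + f n"
    and "\<And>n. g (n + 4) = 4 * g (n + 3) - 4 * g (n + 2) + g n"
    and "f 0 = g 0" "f 1 = g 1" "f 2 = g 2" "f 3 = g 3"
  shows "f n = g n"
proof (induction n rule: less_induct)
  case (less n)
  show ?case
  proof (cases "n < 4")
    case True
    then have "n = 0 \<or> n = 1 \<or> n = 2 \<or> n = 3" by auto
    then show ?thesis using assms(3-6) by auto
  next
    case False
    then obtain m where "n = m + 4" by (metis add.commute le_Suc_ex not_less)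
    then show ?thesis using assms(1,2)[of m] less by simp
  qed
qed

lemma sequence_recurrence_solution:
  fixes s a c :: "nat \<Rightarrow> nat"
  assumes s: "s 0 = 1" "s 1 = 1" "\<And>n. n \<ge> 1 \<Longrightarrow> s (Suc n) = 2 * s n + 2 * a (Suc n) + c (Suc n)"
    and a: "\<And>n. a (Suc n) = 2 * a n + c n" "\<And>n. n < 4 \<Longrightarrow> a n = 0"
    and c: "\<And>n. c n = (if n < 4 then 0 else s (n - 4))"
  shows "real (s n) = (2 + (1 + sqrt 2) ^ n + (1 - sqrt 2) ^ n) / 4"
proof -
  \<comment> \<open>Eliminating \<open>a\<close> leaves characteristic polynomial \<open>x^4 - 4x^3 + 4x^2 - 1 = (x - 1)^2 (x^2 - 2x - 1)\<close>.\<close>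
  have rec: "real (s (n + 4)) = 4 * real (s (n + 3)) - 4 * real (s (n + 2)) + real (s n)" for n
    using s(3)[of "n + 3"] s(3)[of "n + 2"] a(1)[of "n + 3"] c[of "n + 4"]
    by (simp add: numeral_eq_Suc)
  have s23: "s 2 = 2" "s 3 = 4"
    using s(2) s(3)[of 1] s(3)[of 2] a(2) c by (simp_all add: numeral_eq_Suc)
  have pow: "x ^ (n + 4) = 4 * x ^ (n + 3) - 4 * x ^ (n + 2) + x ^ n" if "x\<^sup>2 = 2 * x + 1" for x :: real and n
  proof -
    have "x ^ 4 = 4 * x ^ 3 - 4 * x\<^sup>2 + 1" using that by algebra
    then have "x ^ n * x ^ 4 = x ^ n * (4 * x ^ 3 - 4 * x\<^sup>2 + 1)" by simp
    then show ?thesis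
      unfolding power_add by (simp only: ring_distribs mult_ac mult_1_right)
  qed
  have r: "(1 + sqrt 2)\<^sup>2 = 2 * (1 + sqrt 2) + 1" "(1 - sqrt 2)\<^sup>2 = 2 * (1 - sqrt 2) + 1"
    by (simp_all add: power2_eq_square algebra_simps)
  show ?thesis
  proof (rule recurrence_unique_4[of "\<lambda>n. real (s n)"])
    fix n
    show "(2 + (1 + sqrt 2) ^ (n + 4) + (1 - sqrt 2) ^ (n + 4)) / 4 =
      4 * ((2 + (1 + sqrt 2) ^ (n + 3) + (1 - sqrt 2) ^ (n + 3)) / 4) -
      4 * ((2 + (1 + sqrt 2) ^ (n + 2) + (1 - sqrt 2) ^ (n + 2)) / 4) +
      (2 + (1 + sqrt 2) ^ n + (1 - sqrt 2) ^ n) / 4"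
      unfolding pow[OF r(1)] pow[OF r(2)] by (simp add: field_simps)
  qed (use s s23 rec r in \<open>simp_all add: power3_eq_cube power2_eq_square algebra_simps\<close>)
qed

text \<open>Here \<open>z\<close> is a primitive sixth root of unity, so that \<open>-z\<close> and \<open>-(1 - z)\<close> are the two nonreal cube
  roots of unity and the \<open>x\<close> are Cardano's three roots of \<open>x^3 - 3 x^2 + x - 1\<close>, shifted by one from those of
  \<open>t^3 - 2 t - 2\<close>. In the sums of a coefficient times a power of its root, only the terms survive in which the
  cube roots of unity cancel; this gives the three moments.\<close>

lemma cardano_coefficients:
  fixes a b P Q z :: complex
  assumes z: "z\<^sup>2 = z - 1" and "a * b = 6" "a ^ 3 + b ^ 3 = 54" "P * b = Q * a" "P * a\<^sup>2 - Q * b\<^sup>2 = -3"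
  defines "x1 \<equiv> 1 - (z * a + (1 - z) * b) / 3" and "x2 \<equiv> 1 - ((1 - z) * a + z * b) / 3"
    and "x3 \<equiv> 1 + (a + b) / 3"
    and "e1 \<equiv> 1 / 9 * (1 - z * P + (1 - z) * Q)" and "e2 \<equiv> 1 / 9 * (1 - (1 - z) * P + z * Q)"
    and "e3 \<equiv> 1 / 9 * (1 + P - Q)"
  shows "x1 ^ 3 = 3 * x1\<^sup>2 - x1 + 1" "x2 ^ 3 = 3 * x2\<^sup>2 - x2 + 1" "x3 ^ 3 = 3 * x3\<^sup>2 - x3 + 1"
    and "e1 + e2 + e3 = 1 / 3" "e1 * x1 + e2 * x2 + e3 * x3 = 1 / 3"
    and "e1 * x1\<^sup>2 + e2 * x2\<^sup>2 + e3 * x3\<^sup>2 = 2 / 3"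
proof -
  have cubic: "(1 + y / 3) ^ 3 = 3 * (1 + y / 3)\<^sup>2 - (1 + y / 3) + 1" if "y ^ 3 = 18 * y + 54" for y :: complex
  proof -
    define t where "t = y / 3"
    have "t ^ 3 = 2 * t + 2" using that by (simp add: t_def power_divide field_simps)
    then show ?thesis unfolding t_def[symmetric] by (simp add: power3_eq_cube power2_eq_square algebra_simps)
  qed
  have x: "x1 = 1 + (- (z * a + (1 - z) * b)) / 3" "x2 = 1 + (- ((1 - z) * a + z * b)) / 3"
    by (simp_all only: x1_def x2_def minus_divide_left diff_conv_add_uminus)
  show "x1 ^ 3 = 3 * x1\<^sup>2 - x1 + 1" unfolding x by (rule cubic) (use assms(1-3) in algebra)
  show "x2 ^ 3 = 3 * x2\<^sup>2 - x2 + 1" unfolding x by (rule cubic) (use assms(1-3) in algebra)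
  show "x3 ^ 3 = 3 * x3\<^sup>2 - x3 + 1" unfolding x3_def by (rule cubic) (use assms(1-3) in algebra)
  show s0: "e1 + e2 + e3 = 1 / 3" by (simp add: e1_def e2_def e3_def field_simps)
  \<comment> \<open>Clearing denominators reduces the moments to polynomial identities in \<open>a\<close>, \<open>b\<close>, \<open>P\<close>, \<open>Q\<close>, \<open>z\<close>.\<close>
  define y1 where "y1 = - (z * a + (1 - z) * b)"
  define y2 where "y2 = - ((1 - z) * a + z * b)"
  define y3 where "y3 = a + b"
  define h1 where "h1 = 1 - z * P + (1 - z) * Q"
  define h2 where "h2 = 1 - (1 - z) * P + z * Q"
  define h3 where "h3 = 1 + P - Q"
  have xy: "x1 = 1 + y1 / 3" "x2 = 1 + y2 / 3" "x3 = 1 + y3 / 3"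
    by (simp_all only: x1_def x2_def x3_def y1_def y2_def y3_def minus_divide_left diff_conv_add_uminus)
  have eh: "e1 = h1 / 9" "e2 = h2 / 9" "e3 = h3 / 9"
    by (simp_all add: e1_def e2_def e3_def h1_def h2_def h3_def)
  have h0: "h1 + h2 + h3 = 3" by (simp add: h1_def h2_def h3_def algebra_simps)
  have m1: "h1 * y1 + h2 * y2 + h3 * y3 = 0"
    unfolding h1_def h2_def h3_def y1_def y2_def y3_def using assms(1,4) by algebra
  have m2: "h1 * y1\<^sup>2 + h2 * y2\<^sup>2 + h3 * y3\<^sup>2 = 27"
    unfolding h1_def h2_def h3_def y1_def y2_def y3_def using assms(1,2,5) by algebra
  have "27 * (e1 * x1 + e2 * x2 + e3 * x3) = 3 * (h1 + h2 + h3) + (h1 * y1 + h2 * y2 + h3 * y3)"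
    unfolding xy eh by (simp add: field_simps)
  also have "\<dots> = 27 * (1 / 3)" using h0 m1 by simp
  finally show "e1 * x1 + e2 * x2 + e3 * x3 = 1 / 3"
    by (subst (asm) mult_left_cancel) simp_all
  have "81 * (e1 * x1\<^sup>2 + e2 * x2\<^sup>2 + e3 * x3\<^sup>2) =
      9 * (h1 + h2 + h3) + 6 * (h1 * y1 + h2 * y2 + h3 * y3) + (h1 * y1\<^sup>2 + h2 * y2\<^sup>2 + h3 * y3\<^sup>2)"
    unfolding xy eh by (simp add: field_simps power2_eq_square)
  also have "\<dots> = 81 * (2 / 3)" using h0 m1 m2 by simp
  finally show "e1 * x1\<^sup>2 + e2 * x2\<^sup>2 + e3 * x3\<^sup>2 = 2 / 3"
    by (subst (asm) mult_left_cancel) simp_all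
qed

text \<open>Each identity between positive reals is checked after cubing. The relations say that \<open>P\<close> and \<open>Q\<close> are
  \<open>a\<close> and \<open>b\<close>, each divided by \<open>2 sqrt 57\<close>.\<close>

lemma real_radicals:
  defines "a \<equiv> root 3 (27 - 3 * sqrt 57)" and "b \<equiv> root 3 (27 + 3 * sqrt 57)"
    and "P \<equiv> root 3 (3 * sqrt 57 - 19) / (2 * 19 powr (2 / 3))"
    and "Q \<equiv> 1 / root 3 (19 * (3 * sqrt 57 - 19))"
  shows "a * b = 6" "a ^ 3 + b ^ 3 = 54" "P * b = Q * a" "P * a\<^sup>2 - Q * b\<^sup>2 = -3"
proof -
  define s where "s = sqrt (57 :: real)"
  have ss: "s * s = 57" "s\<^sup>2 = 57" by (simp_all add: s_def)
  have "19 / 3 < s" unfolding s_def by (rule real_less_rsqrt) (simp add: power2_eq_square)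
  moreover have "s < 9" unfolding s_def by (rule real_less_lsqrt) simp_all
  ultimately have pos: "27 - 3 * s > 0" "27 + 3 * s > 0" "3 * s - 19 > 0" by auto
  have a: "a > 0" "a ^ 3 = 27 - 3 * s" and b: "b > 0" "b ^ 3 = 27 + 3 * s"
    using pos by (simp_all add: a_def b_def s_def[symmetric] real_root_pow_pos)
  have r3: "(19 powr (2 / 3) :: real) ^ 3 = 361"
    by (simp add: powr_power)
  have P: "P > 0" "P ^ 3 = (3 * s - 19) / 2888"
    using pos r3 by (simp_all add: P_def s_def[symmetric] power_divide power_mult_distrib real_root_pow_pos)
  have Q: "Q > 0" "Q ^ 3 = 1 / (19 * (3 * s - 19))"
    using pos by (simp_all add: Q_def s_def[symmetric] power_divide real_root_pow_pos)
  have "(a * b) ^ 3 = 6 ^ 3" unfolding power_mult_distrib a b using ss by (simp add: algebra_simps)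
  then show ab: "a * b = 6" by (rule power_eq_imp_eq_base) (use a b in auto)
  show "a ^ 3 + b ^ 3 = 54" using a b by simp
  have "(P * b) ^ 3 = (Q * a) ^ 3"
    unfolding power_mult_distrib a b P Q using pos ss by (simp add: field_simps)
  then show PQ: "P * b = Q * a" by (rule power_eq_imp_eq_base) (use a b P Q in auto)
  have "(2 * P * s) ^ 3 = 8 * P ^ 3 * (s * s * s)" by (simp add: power3_eq_cube)
  also have "\<dots> = a ^ 3" unfolding P a ss using ss by (simp add: field_simps)
  finally have "2 * P * s = a" by (rule power_eq_imp_eq_base) (use a P pos in auto)
  then have 1: "P * (a ^ 3 - b ^ 3) = -3 * a" unfolding a b by (simp add: algebra_simps)
  have "a * (P * a\<^sup>2 - Q * b\<^sup>2) = P * a ^ 3 - (Q * a) * b\<^sup>2" by (simp add: power2_eq_square power3_eq_cube algebra_simps)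
  also have "\<dots> = -3 * a" unfolding PQ[symmetric] using 1 by (simp add: power2_eq_square power3_eq_cube algebra_simps)
  finally have "a * (P * a\<^sup>2 - Q * b\<^sup>2) = a * -3" by simp
  then show "P * a\<^sup>2 - Q * b\<^sup>2 = -3" using a(1) by (metis less_irrefl mult_left_cancel)
qed

lemma recurrence_unique_6:
  fixes f g :: "nat \<Rightarrow> complex"
  assumes "\<And>n. f (n + 6) = 5 * f (n + 5) - 7 * f (n + 4) + 2 * f (n + 3) + f (n + 2) - f (n + 1) + f n"
    and "\<And>n. g (n + 6) = 5 * g (n + 5) - 7 * g (n + 4) + 2 * g (n + 3) + g (n + 2) - g (n + 1) + g n"
    and "\<And>n. n < 6 \<Longrightarrow> f n = g n"
  shows "f n = g n"
proof (induction n rule: less_induct)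
  case (less n)
  show ?case
  proof (cases "n < 6")
    case False
    then obtain m where "n = m + 6" by (metis add.commute le_Suc_ex not_less)
    then show ?thesis using assms(1,2)[of m] less by simp
  qed (use assms(3) in simp)
qed

text \<open>The generating function of \<open>w\<close> has the denominator \<open>(1 - x - x^2) (1 - 3 x + x^2 - x^3)\<close>. The two
  factors account for a Fibonacci part with initial values 2/3, 2/3 and a cubic part with initial values
  1/3, 1/3, 2/3.\<close>

lemma graph_recurrence_solution:
  fixes w a m c :: "nat \<Rightarrow> nat" and f1 f2 y1 y2 y3 :: complex
  assumes w: "w 0 = 1" "w 1 = 1" "\<And>n. n \<ge> 1 \<Longrightarrow> w (Suc n) = 2 * w n + 2 * a (Suc n) + c (Suc n)"
    and a: "\<And>n. a (Suc n) = 2 * a n + m n + c n" "\<And>n. n < 4 \<Longrightarrow> a n = 0"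
    and m: "\<And>n. m (Suc n) = m n + a n + c n" "\<And>n. n < 4 \<Longrightarrow> m n = 0"
    and c: "\<And>n. c n = (if n < 4 then 0 else w (n - 4))"
    and f: "f1\<^sup>2 = f1 + 1" "f2\<^sup>2 = f2 + 1" "d1 + d2 = 2 / 3" "d1 * f1 + d2 * f2 = 2 / 3"
    and y: "y1 ^ 3 = 3 * y1\<^sup>2 - y1 + 1" "y2 ^ 3 = 3 * y2\<^sup>2 - y2 + 1" "y3 ^ 3 = 3 * y3\<^sup>2 - y3 + 1"
      "e1 + e2 + e3 = 1 / 3" "e1 * y1 + e2 * y2 + e3 * y3 = 1 / 3"
      "e1 * y1\<^sup>2 + e2 * y2\<^sup>2 + e3 * y3\<^sup>2 = 2 / 3"
  shows "of_nat (w n) = d1 * f1 ^ n + d2 * f2 ^ n + e1 * y1 ^ n + e2 * y2 ^ n + e3 * y3 ^ n"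
proof -
  have "int (w (n + 6)) = 5 * int (w (n + 5)) - 7 * int (w (n + 4)) + 2 * int (w (n + 3)) + int (w (n + 2)) -
      int (w (n + 1)) + int (w n)" for n
  proof -
    \<comment> \<open>\<open>m\<close> is eliminated first; substituting \<open>a\<close> from the recurrence for \<open>w\<close> then removes \<open>a\<close>.\<close>
    have *: "int (a (k + 2)) = 3 * int (a (k + 1)) - int (a k) + int (c (k + 1))" for k
      using a(1)[of k] a(1)[of "k + 1"] m(1)[of k] by simp
    show ?thesis
      using w(3)[of "n + 3"] w(3)[of "n + 4"] w(3)[of "n + 5"] *[of "n + 4"] c[of "n + 4"] c[of "n + 5"] c[of "n + 6"]
      by (simp add: numeral_eq_Suc)
  qed
  from arg_cong[OF this, of "of_int :: int \<Rightarrow> complex"]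
  have rec: "complex_of_nat (w (n + 6)) = 5 * of_nat (w (n + 5)) - 7 * of_nat (w (n + 4)) + 2 * of_nat (w (n + 3))
      + of_nat (w (n + 2)) - of_nat (w (n + 1)) + of_nat (w n)" for n by simp
  have vals: "w 2 = 2" "w 3 = 4" "w 4 = 9" "w 5 = 21"
    using w(1,2) w(3)[of 1] w(3)[of 2] w(3)[of 3] w(3)[of 4] a(2) a(1)[of 3] a(1)[of 4] m(2) m(1)[of 3] c
    by (simp_all add: numeral_eq_Suc)
  \<comment> \<open>The characteristic polynomial is \<open>(x - 1) (x^2 - x - 1) (x^3 - 3x^2 + x - 1)\<close>.\<close>
  have pow: "x ^ (n + 6) = 5 * x ^ (n + 5) - 7 * x ^ (n + 4) + 2 * x ^ (n + 3) + x ^ (n + 2) - x ^ (n + 1) + x ^ n"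
    if "x\<^sup>2 = x + 1 \<or> x ^ 3 = 3 * x\<^sup>2 - x + 1" for x :: complex and n
  proof -
    have "x ^ 6 = 5 * x ^ 5 - 7 * x ^ 4 + 2 * x ^ 3 + x\<^sup>2 - x + 1"
      using that by (elim disjE; algebra)
    then have "x ^ n * x ^ 6 = x ^ n * (5 * x ^ 5 - 7 * x ^ 4 + 2 * x ^ 3 + x\<^sup>2 - x + 1)" by simp
    then show ?thesis
      unfolding power_add by (simp only: ring_distribs mult_ac mult_1_left mult_1_right power_one_right)
  qed
  define g where "g n = d1 * f1 ^ n + d2 * f2 ^ n + e1 * y1 ^ n + e2 * y2 ^ n + e3 * y3 ^ n" for n
  have fib: "d1 * f1 ^ (n + 2) + d2 * f2 ^ (n + 2) = (d1 * f1 ^ (n + 1) + d2 * f2 ^ (n + 1)) + (d1 * f1 ^ n + d2 * f2 ^ n)" for n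
    unfolding power_add[of _ n 2] f(1,2) by (simp add: algebra_simps)
  have cub: "e1 * y1 ^ (n + 3) + e2 * y2 ^ (n + 3) + e3 * y3 ^ (n + 3) =
      3 * (e1 * y1 ^ (n + 2) + e2 * y2 ^ (n + 2) + e3 * y3 ^ (n + 2))
      - (e1 * y1 ^ (n + 1) + e2 * y2 ^ (n + 1) + e3 * y3 ^ (n + 1))
      + (e1 * y1 ^ n + e2 * y2 ^ n + e3 * y3 ^ n)" for n
    unfolding power_add[of _ n 3] y by (simp add: power_add power2_eq_square algebra_simps)
  define F where "F n = d1 * f1 ^ n + d2 * f2 ^ n" for n
  define C where "C n = e1 * y1 ^ n + e2 * y2 ^ n + e3 * y3 ^ n" for n
  have F: "F 0 = 2 / 3" "F 1 = 2 / 3" "F (n + 2) = F (n + 1) + F n" for n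
    using f fib[of n] by (simp_all add: F_def)
  have C: "C 0 = 1 / 3" "C 1 = 1 / 3" "C 2 = 2 / 3" "C (n + 3) = 3 * C (n + 2) - C (n + 1) + C n" for n
    using y cub[of n] by (simp_all add: C_def)
  have Fr: "F 2 = F 1 + F 0" "F 3 = F 2 + F 1" "F 4 = F 3 + F 2" "F 5 = F 4 + F 3"
    using F(3)[of 0] F(3)[of 1] F(3)[of 2] F(3)[of 3] by (simp_all add: numeral_eq_Suc)
  have Cr: "C 3 = 3 * C 2 - C 1 + C 0" "C 4 = 3 * C 3 - C 2 + C 1" "C 5 = 3 * C 4 - C 3 + C 2"
    using C(4)[of 0] C(4)[of 1] C(4)[of 2] by (simp_all add: numeral_eq_Suc)
  have F': "F 2 = 4 / 3" "F 3 = 2" "F 4 = 10 / 3" "F 5 = 16 / 3"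
    unfolding Fr F(1,2) by simp_all
  have C': "C 3 = 2" "C 4 = 17 / 3" "C 5 = 47 / 3"
    unfolding Cr C(1-3) by simp_all
  have "of_nat (w n) = g n"
  proof (rule recurrence_unique_6[of "\<lambda>n. of_nat (w n)"])
    show "g (n + 6) = 5 * g (n + 5) - 7 * g (n + 4) + 2 * g (n + 3) + g (n + 2) - g (n + 1) + g n" for n
      unfolding g_def pow[OF disjI1[OF f(1)]] pow[OF disjI1[OF f(2)]] pow[OF disjI2[OF y(1)]]
        pow[OF disjI2[OF y(2)]] pow[OF disjI2[OF y(3)]]
      by (simp add: algebra_simps)
    have g: "g n = F n + C n" for n by (simp add: g_def F_def C_def)
    have "g 0 = 1" "g 1 = 1" "g 2 = 2" "g 3 = 4" "g 4 = 9" "g 5 = 21"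
      unfolding g F(1,2) F' C(1-3) C' by simp_all
    moreover fix n :: nat assume "n < 6"
    then have "n = 0 \<or> n = 1 \<or> n = 2 \<or> n = 3 \<or> n = 4 \<or> n = 5" by auto
    ultimately show "complex_of_nat (w n) = g n" using w(1,2) vals by auto
  qed (rule rec)
  then show ?thesis by (simp add: g_def)
qed

theorem theorem5p8:
  fixes n :: nat
  assumes "n \<ge> 1"
  shows "real (num_wt_sequences n) = (2 + (1 + sqrt 2) ^ n + (1 - sqrt 2) ^ n) / 4 \<and>
      (let
        s3 = complex_of_real (sqrt 3);
        s5 = complex_of_real (sqrt 5);
        a = complex_of_real (root 3 (27 - 3 * sqrt 57));
        b = complex_of_real (root 3 (27 + 3 * sqrt 57));
        p = complex_of_real (root 3 (3 * sqrt 57 - 19));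
        q = complex_of_real (root 3 (19 * (3 * sqrt 57 - 19)));
        r = complex_of_real (19 powr (2 / 3));
        c1 = (s5 + 1) / (3 * s5);
        c2 = (s5 - 1) / (3 * s5);
        c3 = 1 / 9 * (1 - (1 + \<i> * s3) * p / (4 * r) + (1 - \<i> * s3) / (2 * q));
        c4 = 1 / 9 * (1 - (1 - \<i> * s3) * p / (4 * r) + (1 + \<i> * s3) / (2 * q));
        c5 = 1 / 9 * (1 + p / (2 * r) - 1 / q)
      in
        complex_of_nat (num_wt_graphs n) =
          c1 * ((1 + s5) / 2) ^ n + c2 * ((1 - s5) / 2) ^ n
          + c3 * ((6 - (1 + \<i> * s3) * a - (1 - \<i> * s3) * b) / 6) ^ n
          + c4 * ((6 - (1 - \<i> * s3) * a - (1 + \<i> * s3) * b) / 6) ^ n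
          + c5 * ((3 + a + b) / 3) ^ n)"
proof (intro conjI)
  show "real (num_wt_sequences n) = (2 + (1 + sqrt 2) ^ n + (1 - sqrt 2) ^ n) / 4"
    unfolding num_wt_sequences_eq[OF assms]
  proof (rule sequence_recurrence_solution[where a = "\<lambda>n. by_degree.cnt (one_top n)"
        and c = "\<lambda>n. by_degree.cnt (p4_type n)"])
    show "by_degree.cnt (one_top n) = 0" if "n < 4" for n
      using small_types_empty(1)[OF that] by (simp add: by_degree.cnt_def)
  qed (rule by_degree.cnt_wt_0 by_degree.cnt_wt_1 by_degree.cnt_wt_Suc by_degree.cnt_p4_type
      degree_count_one_top | assumption)+
next
  define s3 where "s3 = complex_of_real (sqrt 3)"
  define s5 where "s5 = complex_of_real (sqrt 5)"
  define a where "a = complex_of_real (root 3 (27 - 3 * sqrt 57))"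
  define b where "b = complex_of_real (root 3 (27 + 3 * sqrt 57))"
  define p where "p = complex_of_real (root 3 (3 * sqrt 57 - 19))"
  define q where "q = complex_of_real (root 3 (19 * (3 * sqrt 57 - 19)))"
  define r where "r = complex_of_real (19 powr (2 / 3))"
  define P where "P = p / (2 * r)"
  define Q where "Q = 1 / q"
  define z where "z = (1 + \<i> * s3) / 2"
  have s: "s3\<^sup>2 = 3" "s5\<^sup>2 = 5" "s5 \<noteq> 0" by (simp_all add: s3_def s5_def flip: of_real_power)
  have z: "z\<^sup>2 = z - 1" "1 - z = (1 - \<i> * s3) / 2"
    using s(1) by (simp_all add: z_def power2_eq_square field_simps)
  have rad: "a * b = 6" "a ^ 3 + b ^ 3 = 54" "P * b = Q * a" "P * a\<^sup>2 - Q * b\<^sup>2 = -3"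
  proof -
    have PQ: "P = complex_of_real (root 3 (3 * sqrt 57 - 19) / (2 * 19 powr (2 / 3)))"
      "Q = complex_of_real (1 / root 3 (19 * (3 * sqrt 57 - 19)))"
      by (simp_all add: P_def Q_def p_def q_def r_def)
    show "a * b = 6" "a ^ 3 + b ^ 3 = 54" "P * b = Q * a" "P * a\<^sup>2 - Q * b\<^sup>2 = -3"
      unfolding PQ a_def b_def
      by (simp_all only: real_radicals of_real_numeral of_real_minus
          flip: of_real_mult of_real_add of_real_diff of_real_power)
  qed
  note cardano = cardano_coefficients[OF z(1) rad]
  have count: "complex_of_nat (by_iso.cnt (wt_of_size n)) =
      (s5 + 1) / (3 * s5) * ((1 + s5) / 2) ^ n + (s5 - 1) / (3 * s5) * ((1 - s5) / 2) ^ n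
      + 1 / 9 * (1 - z * P + (1 - z) * Q) * (1 - (z * a + (1 - z) * b) / 3) ^ n
      + 1 / 9 * (1 - (1 - z) * P + z * Q) * (1 - ((1 - z) * a + z * b) / 3) ^ n
      + 1 / 9 * (1 + P - Q) * (1 + (a + b) / 3) ^ n"
  proof (rule graph_recurrence_solution[where a = "\<lambda>n. by_iso.cnt (one_top n)"
        and c = "\<lambda>n. by_iso.cnt (p4_type n)" and m = "\<lambda>n. by_iso.cnt (misses_leaf n)"])
    show "((1 + s5) / 2)\<^sup>2 = (1 + s5) / 2 + 1" "((1 - s5) / 2)\<^sup>2 = (1 - s5) / 2 + 1"
      using s(2) by (simp_all add: power2_eq_square field_simps)
    show "(s5 + 1) / (3 * s5) + (s5 - 1) / (3 * s5) = 2 / 3" using s(3) by (simp add: field_simps)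
    show "(s5 + 1) / (3 * s5) * ((1 + s5) / 2) + (s5 - 1) / (3 * s5) * ((1 - s5) / 2) = 2 / 3"
      using s(3) by (simp add: field_simps)
    show "by_iso.cnt (one_top n) = 0" "by_iso.cnt (misses_leaf n) = 0" if "n < 4" for n
      using small_types_empty(1)[OF that] by (simp_all add: by_iso.cnt_def)
  qed (rule cardano by_iso.cnt_wt_0 by_iso.cnt_wt_1 by_iso.cnt_wt_Suc by_iso.cnt_p4_type
      iso_count_one_top iso_count_misses_leaf | assumption)+
  have roots: "1 - (z * a + (1 - z) * b) / 3 = (6 - (1 + \<i> * s3) * a - (1 - \<i> * s3) * b) / 6"
    "1 - ((1 - z) * a + z * b) / 3 = (6 - (1 - \<i> * s3) * a - (1 + \<i> * s3) * b) / 6"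
    "1 + (a + b) / 3 = (3 + a + b) / 3"
    unfolding z(2) unfolding z_def by (simp_all add: field_simps)
  have coefficients: "1 - z * P + (1 - z) * Q = 1 - (1 + \<i> * s3) * p / (4 * r) + (1 - \<i> * s3) / (2 * q)"
    "1 - (1 - z) * P + z * Q = 1 - (1 - \<i> * s3) * p / (4 * r) + (1 + \<i> * s3) / (2 * q)"
    unfolding z(2) unfolding z_def P_def Q_def by simp_all
  show "let
        s3 = complex_of_real (sqrt 3);
        s5 = complex_of_real (sqrt 5);
        a = complex_of_real (root 3 (27 - 3 * sqrt 57));
        b = complex_of_real (root 3 (27 + 3 * sqrt 57));
        p = complex_of_real (root 3 (3 * sqrt 57 - 19));
        q = complex_of_real (root 3 (19 * (3 * sqrt 57 - 19)));
        r = complex_of_real (19 powr (2 / 3));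
        c1 = (s5 + 1) / (3 * s5);
        c2 = (s5 - 1) / (3 * s5);
        c3 = 1 / 9 * (1 - (1 + \<i> * s3) * p / (4 * r) + (1 - \<i> * s3) / (2 * q));
        c4 = 1 / 9 * (1 - (1 - \<i> * s3) * p / (4 * r) + (1 + \<i> * s3) / (2 * q));
        c5 = 1 / 9 * (1 + p / (2 * r) - 1 / q)
      in
        complex_of_nat (num_wt_graphs n) =
          c1 * ((1 + s5) / 2) ^ n + c2 * ((1 - s5) / 2) ^ n
          + c3 * ((6 - (1 + \<i> * s3) * a - (1 - \<i> * s3) * b) / 6) ^ n
          + c4 * ((6 - (1 - \<i> * s3) * a - (1 + \<i> * s3) * b) / 6) ^ n
          + c5 * ((3 + a + b) / 3) ^ n"
    using count[unfolded roots coefficients, unfolded P_def Q_def]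
    unfolding num_wt_graphs_eq[OF assms] Let_def s3_def s5_def a_def b_def p_def q_def r_def .
qed

end
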